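(* Let $r>0$, $T_0>0$, $H\in(\tfrac12,1)$, $\alpha\in(1-H,\tfrac12)$, and let $W^H=\{W^H_t,\ t\in[0,T_0]\}$ be a one-dimensional fractional Brownian motion with Hurst parameter $H$. Assume $b,\sigma\in\mathcal C^2_b$ and that $\eta:[-r,0]\to[0,+\infty)$ belongs to $\mathcal C^{1-\alpha}(-r,0)$. Let $X$ be the solution of the reflected stochastic delay differential equation $$X_t=\eta_0+\int_0^t b(X_s)\,ds+\int_0^t\sigma(X_{s-r})\,dW^H_s+Y_t,\quad t\in(0,T_0],\qquad X_t=\eta_t,\quad t\in[-r,0],$$ where $Y$ is the regulator term, i.e. $Y_t=\max_{s\in[0,t]}(Z_s)^-$ with $Z_t=\eta_0+\int_0^t b(X_s)\,ds+\int_0^t\sigma(X_{s-r})\,dW^H_s$. Assume moreover that $\sigma(x)>0$ for all $x\in[0,+\infty)$. Then, for any $t_0\in(0,T_0]$, the law of $X_{t_0}$ restricted to $(0,+\infty)$ is absolutely continuous (with respect to Lebesgue measure).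
   Context: A fractional Brownian motion with Hurst parameter $H$ is a centered continuous Gaussian process with covariance $R_H(t,s)=\frac12(t^{2H}+s^{2H}-|t-s|^{2H})$. The underlying probability space is the canonical one: $\Omega=C_0([0,T_0];\mathbb R)$, the continuous functions null at time $0$, with the probability measure under which the canonical process is $W^H$. $\mathcal C^k_b$ is the class of real-valued functions on $\mathbb R$ which are $k$ times continuously differentiable with bounded derivatives up to the $k$-th order. $\mathcal C^{\lambda}(a,b)$ is the space of $\lambda$-Hölder continuous functions on $[a,b]$. $x^-=\max(0,-x)$. The integral with respect to $W^H$ is a pathwise Riemann–Stieltjes (Young) integral. The process $X$ is non-negative; $(X,Y)$ restricted to $[0,T_0]$ solves pathwise the Skorokhod problem for $Z$: $X=Z+Y\ge 0$, $Y_0=0$, $Y$ is non-decreasing and $\int_0^t X_s\,dY_s=0$ for all $t$. It is known that the equation has a unique solution, with paths almost surely in $\mathcal C^{1-\alpha}(0,T_0)$ on $[0,T_0]$. *)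

theory Defs
  imports "HOL-Probability.Probability"
begin

definition holder_continuous_on :: "real \<Rightarrow> real set \<Rightarrow> (real \<Rightarrow> real) \<Rightarrow> bool" where
  "holder_continuous_on \<gamma> S f \<longleftrightarrow>
     (\<exists>C. \<forall>x\<in>S. \<forall>y\<in>S. \<bar>f x - f y\<bar> \<le> C * \<bar>x - y\<bar> powr \<gamma>)"

text \<open>Only the derivatives of order \<open>1, \<dots>, k\<close> are required to be bounded, not \<open>f\<close> itself.\<close>

definition Ckb :: "nat \<Rightarrow> (real \<Rightarrow> real) set" where
  "Ckb k = {f. (\<forall>j<k. (deriv ^^ j) f differentiable_on UNIV) \<and>
               continuous_on UNIV ((deriv ^^ k) f) \<and>
               (\<forall>j\<in>{1..k}. bounded (range ((deriv ^^ j) f)))}"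

text \<open>For an interval \<open>K = {u..v}\<close> of the tagged division, \<open>Inf K = u\<close> and \<open>Sup K = v\<close>, and
  the length is bounded uniformly over the division: the limit is along the mesh,
  not along gauges.\<close>

definition has_rs_integral ::
    "(real \<Rightarrow> real) \<Rightarrow> (real \<Rightarrow> real) \<Rightarrow> real \<Rightarrow> real \<Rightarrow> real \<Rightarrow> bool" where
  "has_rs_integral f g a b I \<longleftrightarrow>
     (\<forall>\<epsilon>>0. \<exists>\<delta>>0. \<forall>p. p tagged_division_of {a..b} \<and> (\<forall>(x, K)\<in>p. Sup K - Inf K < \<delta>) \<longrightarrow>
        \<bar>(\<Sum>(x, K)\<in>p. f x * (g (Sup K) - g (Inf K))) - I\<bar> < \<epsilon>)"

definition rs_integrable :: "(real \<Rightarrow> real) \<Rightarrow> (real \<Rightarrow> real) \<Rightarrow> real \<Rightarrow> real \<Rightarrow> bool" where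
  "rs_integrable f g a b \<longleftrightarrow> (\<exists>I. has_rs_integral f g a b I)"

definition rs_integral :: "(real \<Rightarrow> real) \<Rightarrow> (real \<Rightarrow> real) \<Rightarrow> real \<Rightarrow> real \<Rightarrow> real" where
  "rs_integral f g a b = (THE I. has_rs_integral f g a b I)"

text \<open>Point masses count as Gaussian laws.\<close>

definition gaussian_rv :: "'a measure \<Rightarrow> ('a \<Rightarrow> real) \<Rightarrow> bool" where
  "gaussian_rv M \<xi> \<longleftrightarrow>
     (\<exists>m s. s > 0 \<and> distributed M lborel \<xi> (normal_density m s)) \<or>
     (\<xi> \<in> borel_measurable M \<and> (\<exists>m. AE \<omega> in M. \<xi> \<omega> = m))"

definition gaussian_process :: "'a measure \<Rightarrow> real set \<Rightarrow> (real \<Rightarrow> 'a \<Rightarrow> real) \<Rightarrow> bool" where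
  "gaussian_process M I B \<longleftrightarrow>
     (\<forall>t\<in>I. B t \<in> borel_measurable M) \<and>
     (\<forall>J c. finite J \<and> J \<subseteq> I \<longrightarrow> gaussian_rv M (\<lambda>\<omega>. \<Sum>t\<in>J. c t * B t \<omega>))"

definition fbm_covariance :: "real \<Rightarrow> real \<Rightarrow> real \<Rightarrow> real" where
  "fbm_covariance H t s = (t powr (2 * H) + s powr (2 * H) - \<bar>t - s\<bar> powr (2 * H)) / 2"

definition fractional_brownian_motion ::
    "'a measure \<Rightarrow> real \<Rightarrow> real \<Rightarrow> (real \<Rightarrow> 'a \<Rightarrow> real) \<Rightarrow> bool" where
  "fractional_brownian_motion M T H B \<longleftrightarrow>
     gaussian_process M {0..T} B \<and>
     (\<forall>\<omega>\<in>space M. continuous_on {0..T} (\<lambda>t. B t \<omega>)) \<and>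
     (\<forall>t\<in>{0..T}. (\<integral>\<omega>. B t \<omega> \<partial>M) = 0) \<and>
     (\<forall>t\<in>{0..T}. \<forall>s\<in>{0..T}. (\<integral>\<omega>. B t \<omega> * B s \<omega> \<partial>M) = fbm_covariance H t s)"

text \<open>The measurable space \<open>C\<^sub>0([0,T]; \<real>)\<close>. Paths are represented by functions that are
  \<open>undefined\<close> outside \<open>{0..T}\<close>; the sigma-algebra is generated by the evaluation maps, i.e. it is
  the Borel sigma-algebra of the uniform topology. The measure carried by \<open>C0_space T\<close>
  itself is irrelevant.\<close>

definition C0_space :: "real \<Rightarrow> (real \<Rightarrow> real) measure" where
  "C0_space T = restrict_space (\<Pi>\<^sub>M t\<in>{0..T}. borel) {w. continuous_on {0..T} w \<and> w 0 = 0}"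

definition canonical_process :: "real \<Rightarrow> (real \<Rightarrow> real) \<Rightarrow> real" where
  "canonical_process t w = w t"

definition unreflected_path ::
    "(real \<Rightarrow> real) \<Rightarrow> (real \<Rightarrow> real) \<Rightarrow> (real \<Rightarrow> real) \<Rightarrow> real \<Rightarrow>
     (real \<Rightarrow> real) \<Rightarrow> (real \<Rightarrow> real) \<Rightarrow> real \<Rightarrow> real" where
  "unreflected_path b \<sigma> \<eta> r w x t =
     \<eta> 0 + integral {0..t} (\<lambda>s. b (x s)) + rs_integral (\<lambda>s. \<sigma> (x (s - r))) w 0 t"

text \<open>The regulator \<open>max\<^bsub>s \<in> [0,t]\<^esub> (z\<^sub>s)\<^sup>-\<close>; the supremum is attained for continuous \<open>z\<close>.\<close>

definition regulator :: "(real \<Rightarrow> real) \<Rightarrow> real \<Rightarrow> real" where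
  "regulator z t = (SUP s\<in>{0..t}. max 0 (- z s))"

definition solves_reflected_delay_path ::
    "(real \<Rightarrow> real) \<Rightarrow> (real \<Rightarrow> real) \<Rightarrow> (real \<Rightarrow> real) \<Rightarrow> real \<Rightarrow> real \<Rightarrow>
     (real \<Rightarrow> real) \<Rightarrow> (real \<Rightarrow> real) \<Rightarrow> bool" where
  "solves_reflected_delay_path b \<sigma> \<eta> r T w x \<longleftrightarrow>
     (\<forall>t\<in>{-r..0}. x t = \<eta> t) \<and>
     (\<forall>t\<in>{0<..T}.
        (\<lambda>s. b (x s)) integrable_on {0..t} \<and>
        rs_integrable (\<lambda>s. \<sigma> (x (s - r))) w 0 t \<and>
        x t = unreflected_path b \<sigma> \<eta> r w x t + regulator (unreflected_path b \<sigma> \<eta> r w x) t)"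

text \<open>A pathwise solution is determined only up to null sets, so measurability is with
  respect to the completed sigma-algebra.\<close>

definition reflected_delay_solution ::
    "'a measure \<Rightarrow> (real \<Rightarrow> real) \<Rightarrow> (real \<Rightarrow> real) \<Rightarrow> (real \<Rightarrow> real) \<Rightarrow> real \<Rightarrow> real \<Rightarrow>
     (real \<Rightarrow> 'a \<Rightarrow> real) \<Rightarrow> (real \<Rightarrow> 'a \<Rightarrow> real) \<Rightarrow> bool" where
  "reflected_delay_solution M b \<sigma> \<eta> r T W X \<longleftrightarrow>
     (\<forall>t\<in>{-r..T}. X t \<in> borel_measurable (completion M)) \<and>
     (AE \<omega> in M. solves_reflected_delay_path b \<sigma> \<eta> r T (\<lambda>t. W t \<omega>) (\<lambda>t. X t \<omega>))"

end

theory Submission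
  imports Defs
begin

text \<open>
  Let \<open>h\<close> be the tent function that vanishes on \<open>[0, t\<^sub>0 - d]\<close> and increases linearly to \<open>1\<close> at \<open>t\<^sub>0\<close>, with
  \<open>d \<le> r\<close>. It lies in the Cameron-Martin space of the fractional Brownian motion \<open>W\<close>, so in law
  \<open>W = W' + \<rho> \<zeta> h\<close> with a standard normal variable \<open>\<zeta>\<close> that is independent of \<open>W'\<close>, and by Fubini it is
  enough to study \<open>x \<mapsto> X\<^bsub>t\<^sub>0\<^esub>(W' + \<rho> x h)\<close> for a fixed path of \<open>W'\<close>. Changing \<open>x\<close> alters neither the
  solution on \<open>[-r, t\<^sub>0 - d]\<close> nor, since \<open>d \<le> r\<close>, the diffusion coefficient \<open>\<sigma>(X\<^bsub>s-r\<^esub>)\<close> on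
  \<open>[t\<^sub>0 - d, t\<^sub>0]\<close>. On the event that \<open>X > 0\<close> on \<open>[t\<^sub>0 - d, t\<^sub>0]\<close> there is no reflection on that interval, so
  the difference of two solutions satisfies a differential inequality which shows that
  \<open>x \<mapsto> X\<^bsub>t\<^sub>0\<^esub>\<close> expands distances by a positive factor, and hence pulls null sets back to null sets.
  By continuity the events for \<open>d \<rightarrow> 0\<close> exhaust \<open>{X\<^bsub>t\<^sub>0\<^esub> > 0}\<close>.
\<close>

section \<open>The Riemann-Stieltjes integral along the mesh\<close>

text \<open>The direction of the shift must vanish before \<open>t\<^sub>0 - d\<close>, so that the
  past solution does not move, and must be affine afterwards: then the two diffusion integrals over
  the last interval have the same integrand and integrators that differ by an affine function, so
  their difference is an ordinary integral. The covariance kernel R_H(t0, .), the obvious element of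
  the Cameron-Martin space, has neither property; hence the tent and the Fourier argument that
  places it in that space. The inequality D' \<ge> \<mu> - L |D| for the difference D of two
  solutions compares any two admissible x directly. This matters because the x whose path lies in
  the event form an arbitrary measurable set, not an interval, so that the map from x to
  \<open>X\<close> is not differentiated. Fubini asks for a P-measurable event, while
  \<open>X t\<close> is measurable only for the completion and positivity on an interval is an
  uncountable condition. Hence the lower bound \<epsilon> at rational times and the passage to the
  main part of the event.\<close>

definition rs_sum :: "(real \<Rightarrow> real) \<Rightarrow> (real \<Rightarrow> real) \<Rightarrow> (real \<times> real set) set \<Rightarrow> real" where
  "rs_sum f g p = (\<Sum>(x, K)\<in>p. f x * (g (Sup K) - g (Inf K)))"

definition mesh_less :: "real \<Rightarrow> (real \<times> real set) set \<Rightarrow> bool" where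
  "mesh_less \<delta> p \<longleftrightarrow> (\<forall>(x, K)\<in>p. Sup K - Inf K < \<delta>)"

lemma has_rs_integral_alt:
  "has_rs_integral f g a b I \<longleftrightarrow>
     (\<forall>\<epsilon>>0. \<exists>\<delta>>0. \<forall>p. p tagged_division_of {a..b} \<and> mesh_less \<delta> p \<longrightarrow> \<bar>rs_sum f g p - I\<bar> < \<epsilon>)"
  unfolding has_rs_integral_def rs_sum_def mesh_less_def ..

lemma tagged_division_of_real_cell:
  assumes "p tagged_division_of {a..b::real}" "(x, K) \<in> p"
  obtains u v where "K = {u..v}" "a \<le> u" "u \<le> x" "x \<le> v" "v \<le> b"
proof -
  obtain u v where K: "K = {u..v}" using tagged_division_ofD(4)[OF assms] by auto
  have "x \<in> K" "K \<subseteq> {a..b}" using tagged_division_ofD(2,3)[OF assms] by auto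
  with K show thesis by (intro that[of u v]) auto
qed

text \<open>Cousin's lemma for a constant gauge. It keeps the limit along the mesh from being
  vacuous, and so underlies the uniqueness of the integral.\<close>

lemma mesh_less_division_exists:
  assumes "\<delta> > 0"
  obtains p where "p tagged_division_of {a..b::real}" "mesh_less \<delta> p"
proof -
  have "gauge (\<lambda>x::real. ball x (\<delta>/2))" using assms by (intro gauge_ball) auto
  then obtain p where p: "p tagged_division_of {a..b}" "(\<lambda>x. ball x (\<delta>/2)) fine p"
    by (rule fine_division_exists_real)
  have "mesh_less \<delta> p" unfolding mesh_less_def
  proof (intro ballI, clarify)
    fix x K assume xK: "(x, K) \<in> p"
    from p(1) xK obtain u v where K: "K = {u..v}" "u \<le> x" "x \<le> v"
      by (rule tagged_division_of_real_cell)
    have "K \<subseteq> ball x (\<delta>/2)" using p(2) xK by (auto simp: fine_def)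
    moreover have "u \<in> K" "v \<in> K" using K by auto
    ultimately have "dist x u < \<delta>/2" "dist x v < \<delta>/2" by auto
    then show "Sup K - Inf K < \<delta>" using K by (auto simp: dist_real_def)
  qed
  with p show thesis by (intro that)
qed

lemma mesh_less_mono: "mesh_less \<delta> p \<Longrightarrow> \<delta> \<le> \<delta>' \<Longrightarrow> mesh_less \<delta>' p"
  unfolding mesh_less_def by fastforce

lemma mesh_less_Un: "mesh_less \<delta> p \<Longrightarrow> mesh_less \<delta> q \<Longrightarrow> mesh_less \<delta> (p \<union> q)"
  unfolding mesh_less_def by blast

text \<open>Divisions are sets, so a tagged cell common to both would be counted only once in the
  union. Such a cell can only be the degenerate {c..c}, which contributes nothing.\<close>

lemma rs_sum_join:
  assumes p: "p tagged_division_of {a..c}" and q: "q tagged_division_of {c..b}"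
    and ab: "a \<le> c" "c \<le> (b::real)"
  shows "(p \<union> q) tagged_division_of {a..b}" "rs_sum f g (p \<union> q) = rs_sum f g p + rs_sum f g q"
proof -
  have "interior {a..c} \<inter> interior {c..b} = {}" by auto
  from tagged_division_Un[OF p q this] show "(p \<union> q) tagged_division_of {a..b}"
    using ab by (simp add: ivl_disj_un)
  have fin: "finite p" "finite q" using p q by (auto dest: tagged_division_ofD(1))
  have "f x * (g (Sup K) - g (Inf K)) = 0" if "(x, K) \<in> p" "(x, K) \<in> q" for x K
  proof -
    from p that(1) obtain u v where K: "K = {u..v}" "a \<le> u" "u \<le> x" "x \<le> v" "v \<le> c"
      by (rule tagged_division_of_real_cell)
    from q that(2) have "K \<subseteq> {c..b}" by (auto dest: tagged_division_ofD(3))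
    then have "u \<ge> c" using K by auto
    with K have "u = v" by auto
    with K show ?thesis by simp
  qed
  then show "rs_sum f g (p \<union> q) = rs_sum f g p + rs_sum f g q"
    unfolding rs_sum_def by (intro sum.union_inter_neutral fin) auto
qed

lemma has_rs_integral_unique:
  assumes "has_rs_integral f g a b I" "has_rs_integral f g a b J"
  shows "I = J"
proof (rule ccontr)
  assume "I \<noteq> J"
  then have e: "\<bar>I - J\<bar> / 2 > 0" by simp
  obtain d1 where d1: "d1 > 0" "\<And>p. p tagged_division_of {a..b} \<Longrightarrow> mesh_less d1 p \<Longrightarrow>
      \<bar>rs_sum f g p - I\<bar> < \<bar>I - J\<bar> / 2"
    using assms(1) e unfolding has_rs_integral_alt by meson
  obtain d2 where d2: "d2 > 0" "\<And>p. p tagged_division_of {a..b} \<Longrightarrow> mesh_less d2 p \<Longrightarrow>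
      \<bar>rs_sum f g p - J\<bar> < \<bar>I - J\<bar> / 2"
    using assms(2) e unfolding has_rs_integral_alt by meson
  obtain p where p: "p tagged_division_of {a..b}" "mesh_less (min d1 d2) p"
    using d1(1) d2(1) by (metis mesh_less_division_exists min_less_iff_conj)
  have "\<bar>rs_sum f g p - I\<bar> < \<bar>I - J\<bar> / 2" "\<bar>rs_sum f g p - J\<bar> < \<bar>I - J\<bar> / 2"
    using p d1(2)[of p] d2(2)[of p] mesh_less_mono[OF p(2)] by auto
  moreover have "\<bar>I - J\<bar> \<le> \<bar>rs_sum f g p - I\<bar> + \<bar>rs_sum f g p - J\<bar>" by arith
  ultimately show False by (simp add: field_simps)
qed

lemma rs_integral_eqI: "has_rs_integral f g a b I \<Longrightarrow> rs_integral f g a b = I"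
  unfolding rs_integral_def by (rule the_equality) (auto intro: has_rs_integral_unique)

lemma rs_integrable_has_rs_integral:
  "rs_integrable f g a b \<Longrightarrow> has_rs_integral f g a b (rs_integral f g a b)"
  unfolding rs_integrable_def using rs_integral_eqI by metis

lemma has_rs_integral_refl: "has_rs_integral f g a a 0"
proof -
  have "rs_sum f g p = 0" if p: "p tagged_division_of {a..a}" for p
    unfolding rs_sum_def
  proof (rule sum.neutral, clarify)
    fix x K assume "(x, K) \<in> p"
    from p this obtain u v where "K = {u..v}" "a \<le> u" "u \<le> x" "x \<le> v" "v \<le> a"
      by (rule tagged_division_of_real_cell)
    then have "K = {a..a}" by auto
    then show "f x * (g (Sup K) - g (Inf K)) = 0" by simp
  qed
  then show ?thesis unfolding has_rs_integral_alt by (auto intro: exI[of _ 1])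
qed

lemma rs_sum_cong:
  assumes "p tagged_division_of {a..b}"
    and "\<And>t. t \<in> {a..b} \<Longrightarrow> f t = f' t" "\<And>t. t \<in> {a..b} \<Longrightarrow> g t = g' t"
  shows "rs_sum f g p = rs_sum f' g' p"
  unfolding rs_sum_def
proof (rule sum.cong[OF refl], clarify)
  fix x K assume "(x, K) \<in> p"
  from assms(1) this obtain u v where "K = {u..v}" "a \<le> u" "u \<le> x" "x \<le> v" "v \<le> b"
    by (rule tagged_division_of_real_cell)
  then show "f x * (g (Sup K) - g (Inf K)) = f' x * (g' (Sup K) - g' (Inf K))"
    using assms(2,3) by auto
qed

lemma has_rs_integral_cong:
  assumes "\<And>t. t \<in> {a..b} \<Longrightarrow> f t = f' t" "\<And>t. t \<in> {a..b} \<Longrightarrow> g t = g' t"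
  shows "has_rs_integral f g a b I \<longleftrightarrow> has_rs_integral f' g' a b I"
  unfolding has_rs_integral_alt using rs_sum_cong[of _ a b f f' g g'] assms by (metis (no_types))

lemma rs_integral_cong:
  assumes "\<And>t. t \<in> {a..b} \<Longrightarrow> f t = f' t" "\<And>t. t \<in> {a..b} \<Longrightarrow> g t = g' t"
  shows "rs_integral f g a b = rs_integral f' g' a b"
  unfolding rs_integral_def by (rule arg_cong[where f=The], rule ext, rule has_rs_integral_cong) (use assms in auto)

text \<open>One fixed fine division of {a..c} completes every fine division of {c..b} to a fine
  division of {a..b}. Existence of the integral over {c..b} is thus part of the conclusion.\<close>

lemma has_rs_integral_split:
  assumes I: "has_rs_integral f g a b I" and J: "has_rs_integral f g a c J" and "a \<le> c" "c \<le> b"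
  shows "has_rs_integral f g c b (I - J)"
  unfolding has_rs_integral_alt
proof (intro allI impI)
  fix \<epsilon> :: real assume "\<epsilon> > 0"
  then have e: "\<epsilon>/2 > 0" by simp
  obtain d1 where d1: "d1 > 0" "\<And>p. p tagged_division_of {a..b} \<Longrightarrow> mesh_less d1 p \<Longrightarrow>
      \<bar>rs_sum f g p - I\<bar> < \<epsilon>/2"
    using I e unfolding has_rs_integral_alt by meson
  obtain d2 where d2: "d2 > 0" "\<And>p. p tagged_division_of {a..c} \<Longrightarrow> mesh_less d2 p \<Longrightarrow>
      \<bar>rs_sum f g p - J\<bar> < \<epsilon>/2"
    using J e unfolding has_rs_integral_alt by meson
  obtain p where p: "p tagged_division_of {a..c}" "mesh_less (min d1 d2) p"
    using d1(1) d2(1) by (metis mesh_less_division_exists min_less_iff_conj)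
  have "\<bar>rs_sum f g q - (I - J)\<bar> < \<epsilon>" if q: "q tagged_division_of {c..b}" "mesh_less d1 q" for q
  proof -
    have "mesh_less d1 (p \<union> q)" using p(2) q(2) mesh_less_mono[OF p(2)] by (intro mesh_less_Un) auto
    then have "\<bar>rs_sum f g p + rs_sum f g q - I\<bar> < \<epsilon>/2"
      using d1(2)[of "p \<union> q"] rs_sum_join[OF p(1) q(1) assms(3,4)] by auto
    moreover have "\<bar>rs_sum f g p - J\<bar> < \<epsilon>/2" using d2(2) p mesh_less_mono by auto
    ultimately show ?thesis by linarith
  qed
  with d1(1) show "\<exists>\<delta>>0. \<forall>p. p tagged_division_of {c..b} \<and> mesh_less \<delta> p \<longrightarrow> \<bar>rs_sum f g p - (I - J)\<bar> < \<epsilon>"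
    by auto
qed

lemma has_rs_integral_diff_integrator:
  assumes I: "has_rs_integral f g a b I" and J: "has_rs_integral f h a b J"
  shows "has_rs_integral f (\<lambda>t. g t - h t) a b (I - J)"
  unfolding has_rs_integral_alt
proof (intro allI impI)
  fix \<epsilon> :: real assume "\<epsilon> > 0"
  then have e: "\<epsilon>/2 > 0" by simp
  obtain d1 where d1: "d1 > 0" "\<And>p. p tagged_division_of {a..b} \<Longrightarrow> mesh_less d1 p \<Longrightarrow>
      \<bar>rs_sum f g p - I\<bar> < \<epsilon>/2"
    using I e unfolding has_rs_integral_alt by meson
  obtain d2 where d2: "d2 > 0" "\<And>p. p tagged_division_of {a..b} \<Longrightarrow> mesh_less d2 p \<Longrightarrow>
      \<bar>rs_sum f h p - J\<bar> < \<epsilon>/2"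
    using J e unfolding has_rs_integral_alt by meson
  have "\<bar>rs_sum f (\<lambda>t. g t - h t) q - (I - J)\<bar> < \<epsilon>"
    if q: "q tagged_division_of {a..b}" "mesh_less (min d1 d2) q" for q
  proof -
    have "rs_sum f (\<lambda>t. g t - h t) q = rs_sum f g q - rs_sum f h q"
      unfolding rs_sum_def by (simp add: sum_subtractf[symmetric] case_prod_beta algebra_simps)
    moreover have "\<bar>rs_sum f g q - I\<bar> < \<epsilon>/2" "\<bar>rs_sum f h q - J\<bar> < \<epsilon>/2"
      using d1(2) d2(2) q mesh_less_mono by auto
    ultimately show ?thesis by linarith
  qed
  with d1(1) d2(1) show "\<exists>\<delta>>0. \<forall>p. p tagged_division_of {a..b} \<and> mesh_less \<delta> p \<longrightarrow>
      \<bar>rs_sum f (\<lambda>t. g t - h t) p - (I - J)\<bar> < \<epsilon>"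
    by (intro exI[of _ "min d1 d2"]) auto
qed

text \<open>A limit along the mesh is in particular a limit along gauges.\<close>

lemma has_rs_integral_affine_integrator:
  assumes I: "has_rs_integral f (\<lambda>t. c + k * t) a b I" and fin: "continuous_on {a..b} f"
  shows "I = k * integral {a..b} f"
proof -
  have "((\<lambda>t. k * f t) has_integral I) {a..b}"
    unfolding has_integral_real
  proof (intro allI impI)
    fix \<epsilon> :: real assume "\<epsilon> > 0"
    then obtain d where d: "d > 0" "\<And>p. p tagged_division_of {a..b} \<Longrightarrow> mesh_less d p \<Longrightarrow>
        \<bar>rs_sum f (\<lambda>t. c + k * t) p - I\<bar> < \<epsilon>"
      using I unfolding has_rs_integral_alt by meson
    have "norm ((\<Sum>(x, K)\<in>p. measure lborel K *\<^sub>R (k * f x)) - I) < \<epsilon>"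
      if p: "p tagged_division_of {a..b}" "(\<lambda>x. ball x (d/2)) fine p" for p
    proof -
      have "mesh_less d p" unfolding mesh_less_def
      proof (intro ballI, clarify)
        fix x K assume xK: "(x, K) \<in> p"
        from p(1) xK obtain u v where K: "K = {u..v}" "u \<le> x" "x \<le> v"
          by (rule tagged_division_of_real_cell)
        have "K \<subseteq> ball x (d/2)" using p(2) xK by (auto simp: fine_def)
        moreover have "u \<in> K" "v \<in> K" using K by auto
        ultimately have "dist x u < d/2" "dist x v < d/2" by auto
        then show "Sup K - Inf K < d" using K by (auto simp: dist_real_def)
      qed
      moreover have "rs_sum f (\<lambda>t. c + k * t) p = (\<Sum>(x, K)\<in>p. measure lborel K *\<^sub>R (k * f x))"
        unfolding rs_sum_def
      proof (rule sum.cong[OF refl], clarify)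
        fix x K assume "(x, K) \<in> p"
        from p(1) this obtain u v where "K = {u..v}" "u \<le> x" "x \<le> v"
          by (rule tagged_division_of_real_cell)
        then show "f x * (c + k * Sup K - (c + k * Inf K)) = measure lborel K *\<^sub>R (k * f x)"
          by (simp add: algebra_simps)
      qed
      ultimately show ?thesis using d(2)[OF p(1)] by simp
    qed
    moreover have "gauge (\<lambda>x::real. ball x (d/2))" using d(1) by (intro gauge_ball) auto
    ultimately show "\<exists>\<gamma>. gauge \<gamma> \<and> (\<forall>\<D>. \<D> tagged_division_of {a..b} \<and> \<gamma> fine \<D> \<longrightarrow>
        norm ((\<Sum>(x, K)\<in>\<D>. measure lborel K *\<^sub>R (k * f x)) - I) < \<epsilon>)"
      by blast
  qed
  then have "integral {a..b} (\<lambda>t. k * f t) = I" by (rule integral_unique)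
  then show ?thesis by simp
qed

text \<open>A Saks-Henstock estimate for a single cell: {s..t} with tag \<xi> is completed on both
  sides by fine divisions whose sums are close to the integrals there, each of the three errors
  being at most \<epsilon>/3. The side divisions depend on s and t, but \<delta> comes from {a..b}
  alone, so the estimate is uniform.\<close>

lemma rs_integral_increment:
  assumes F: "\<And>t. t \<in> {a..b} \<Longrightarrow> has_rs_integral f g a t (F t)" and "\<epsilon> > 0"
  obtains \<delta> where "\<delta> > 0"
    "\<And>s t \<xi>. a \<le> s \<Longrightarrow> s \<le> \<xi> \<Longrightarrow> \<xi> \<le> t \<Longrightarrow> t \<le> b \<Longrightarrow> t - s < \<delta> \<Longrightarrow> \<bar>F t - F s - f \<xi> * (g t - g s)\<bar> < \<epsilon>"
proof (cases "a \<le> b")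
  case False
  then show thesis by (intro that[of 1]) auto
next
  case True
  have e: "\<epsilon>/3 > 0" using assms(2) by simp
  have Fb: "has_rs_integral f g a b (F b)" using F True by auto
  obtain d where d: "d > 0" "\<And>p. p tagged_division_of {a..b} \<Longrightarrow> mesh_less d p \<Longrightarrow>
      \<bar>rs_sum f g p - F b\<bar> < \<epsilon>/3"
    using Fb e unfolding has_rs_integral_alt by meson
  show thesis
  proof (rule that[OF d(1)])
    fix s t \<xi> assume st: "a \<le> s" "s \<le> \<xi>" "\<xi> \<le> t" "t \<le> b" "t - s < d"
    have I1: "has_rs_integral f g a s (F s)" using F st by auto
    have I2: "has_rs_integral f g t b (F b - F t)" using F st by (intro has_rs_integral_split[of _ _ a]) auto
    obtain d1 where d1: "d1 > 0" "\<And>p. p tagged_division_of {a..s} \<Longrightarrow> mesh_less d1 p \<Longrightarrow>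
        \<bar>rs_sum f g p - F s\<bar> < \<epsilon>/3"
      using I1 e unfolding has_rs_integral_alt by meson
    obtain d2 where d2: "d2 > 0" "\<And>p. p tagged_division_of {t..b} \<Longrightarrow> mesh_less d2 p \<Longrightarrow>
        \<bar>rs_sum f g p - (F b - F t)\<bar> < \<epsilon>/3"
      using I2 e unfolding has_rs_integral_alt by meson
    obtain p1 where p1: "p1 tagged_division_of {a..s}" "mesh_less (min d d1) p1"
      using d1(1) d(1) by (metis mesh_less_division_exists min_less_iff_conj)
    obtain p2 where p2: "p2 tagged_division_of {t..b}" "mesh_less (min d d2) p2"
      using d2(1) d(1) by (metis mesh_less_division_exists min_less_iff_conj)
    define q where "q = {(\<xi>, {s..t})}"
    have q: "q tagged_division_of {s..t}" unfolding q_def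
      using st tagged_division_of_self_real[of \<xi> s t] by simp
    have qs: "rs_sum f g q = f \<xi> * (g t - g s)" "mesh_less d q"
      using st by (auto simp: q_def rs_sum_def mesh_less_def)
    note j1 = rs_sum_join[OF p1(1) q st(1) order_trans[OF st(2,3)]]
    have "a \<le> t" using st by auto
    note j2 = rs_sum_join[OF j1(1) p2(1) \<open>a \<le> t\<close> st(4)]
    have "mesh_less d (p1 \<union> q \<union> p2)"
      using mesh_less_mono[OF p1(2)] mesh_less_mono[OF p2(2)] qs(2) by (intro mesh_less_Un) auto
    with d(2) j2(1) have "\<bar>rs_sum f g (p1 \<union> q \<union> p2) - F b\<bar> < \<epsilon>/3" by blast
    then have "\<bar>rs_sum f g p1 + f \<xi> * (g t - g s) + rs_sum f g p2 - F b\<bar> < \<epsilon>/3"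
      using j1(2) j2(2) qs(1) by auto
    moreover have "\<bar>rs_sum f g p1 - F s\<bar> < \<epsilon>/3" "\<bar>rs_sum f g p2 - (F b - F t)\<bar> < \<epsilon>/3"
      using p1 p2 d1(2) d2(2) mesh_less_mono by auto
    ultimately show "\<bar>F t - F s - f \<xi> * (g t - g s)\<bar> < \<epsilon>" unfolding abs_less_iff by linarith
  qed
qed

text \<open>The increment estimate is used with the tag at the point s where continuity is tested,
  so that only the constant \<open>f s\<close> multiplies the increment of g.\<close>

lemma continuous_on_rs_integral:
  assumes F: "\<And>t. t \<in> {a..b} \<Longrightarrow> has_rs_integral f g a t (F t)" and g: "continuous_on {a..b} g"
  shows "continuous_on {a..b} F"
  unfolding continuous_on_iff
proof (intro ballI allI impI)
  fix s \<epsilon> :: real assume s: "s \<in> {a..b}" and "\<epsilon> > 0"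
  then have e: "\<epsilon>/2 > 0" by simp
  obtain d where d: "d > 0" "\<And>s t \<xi>. a \<le> s \<Longrightarrow> s \<le> \<xi> \<Longrightarrow> \<xi> \<le> t \<Longrightarrow> t \<le> b \<Longrightarrow> t - s < d \<Longrightarrow>
      \<bar>F t - F s - f \<xi> * (g t - g s)\<bar> < \<epsilon>/2"
    using rs_integral_increment[OF F e] by blast
  have "continuous_on {a..b} (\<lambda>t. f s * g t)" using g by (intro continuous_intros)
  then obtain d' where d': "d' > 0" "\<And>t. t \<in> {a..b} \<Longrightarrow> dist t s < d' \<Longrightarrow> dist (f s * g t) (f s * g s) < \<epsilon>/2"
    using s e unfolding continuous_on_iff by metis
  have "dist (F t) (F s) < \<epsilon>" if t: "t \<in> {a..b}" "dist t s < min d d'" for t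
  proof -
    have *: "\<bar>f s * g t - f s * g s\<bar> < \<epsilon>/2" using d'(2)[of t] t by (auto simp: dist_real_def)
    show ?thesis
    proof (cases "s \<le> t")
      case True
      then have "\<bar>F t - F s - f s * (g t - g s)\<bar> < \<epsilon>/2"
        using d(2)[of s s t] s t by (auto simp: dist_real_def)
      with * show ?thesis unfolding dist_real_def right_diff_distrib abs_less_iff by linarith
    next
      case False
      then have "\<bar>F s - F t - f s * (g s - g t)\<bar> < \<epsilon>/2"
        using d(2)[of t s s] s t by (auto simp: dist_real_def)
      with * show ?thesis unfolding dist_real_def right_diff_distrib abs_less_iff by linarith
    qed
  qed
  with d(1) d'(1) show "\<exists>d>0. \<forall>x'\<in>{a..b}. dist x' s < d \<longrightarrow> dist (F x') (F s) < \<epsilon>"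
    by (intro exI[of _ "min d d'"]) auto
qed

section \<open>Pathwise analysis of the reflected equation\<close>

lemma Ckb_lipschitz:
  assumes "f \<in> Ckb k" "k > 0"
  obtains L where "L \<ge> 0" "\<And>x y. \<bar>f x - f y\<bar> \<le> L * \<bar>x - y\<bar>"
proof -
  have d: "f differentiable_on UNIV" using assms by (auto simp: Ckb_def dest: spec[of _ 0])
  have "bounded (range (deriv f))" using assms by (auto simp: Ckb_def dest: bspec[of _ _ 1])
  then obtain L where L: "\<And>x. norm (deriv f x) \<le> L" unfolding bounded_iff by auto
  have L0: "L \<ge> 0" using L[of 0] norm_ge_zero order_trans by blast
  have "norm (f x - f y) \<le> L * norm (x - y)" for x y
  proof (rule field_differentiable_bound[of UNIV])
    show "(f has_field_derivative deriv f z) (at z within UNIV)" for z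
      using d by (auto simp: differentiable_on_def DERIV_deriv_iff_real_differentiable)
  qed (use L in auto)
  with L0 that show thesis by auto
qed

lemma lipschitz_continuous_on:
  assumes "\<And>x y. \<bar>f x - f y\<bar> \<le> L * \<bar>x - y\<bar>" "L \<ge> (0::real)"
  shows "continuous_on S (f :: real \<Rightarrow> real)"
proof -
  have "L-lipschitz_on S f" using assms by (auto simp: lipschitz_on_def dist_real_def)
  then show ?thesis by (rule lipschitz_on_continuous_on)
qed

lemma holder_continuous_on_imp_continuous_on:
  assumes "holder_continuous_on \<gamma> S f" "\<gamma> > 0"
  shows "continuous_on S f"
proof -
  obtain C where C: "\<And>x y. x \<in> S \<Longrightarrow> y \<in> S \<Longrightarrow> \<bar>f x - f y\<bar> \<le> C * \<bar>x - y\<bar> powr \<gamma>"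
    using assms(1) by (auto simp: holder_continuous_on_def)
  have "(f \<longlongrightarrow> f x) (at x within S)" if x: "x \<in> S" for x
  proof -
    have "((\<lambda>y. C * \<bar>y - x\<bar> powr \<gamma>) \<longlongrightarrow> C * \<bar>x - x\<bar> powr \<gamma>) (at x within S)"
      using assms(2) by (intro tendsto_intros tendsto_powr') auto
    then have "((\<lambda>y. C * \<bar>y - x\<bar> powr \<gamma>) \<longlongrightarrow> 0) (at x within S)" using assms(2) by simp
    moreover have "eventually (\<lambda>y. norm (f y - f x) \<le> C * \<bar>y - x\<bar> powr \<gamma>) (at x within S)"
      using C x by (auto simp: eventually_at intro!: exI[of _ 1])
    ultimately have "((\<lambda>y. f y - f x) \<longlongrightarrow> 0) (at x within S)" by (rule Lim_null_comparison[rotated])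
    then show ?thesis by (simp add: LIM_zero_iff)
  qed
  then show ?thesis by (auto simp: continuous_on_def)
qed

lemma gronwall_zero:
  fixes u :: "real \<Rightarrow> real"
  assumes u: "continuous_on {0..a} u" "\<And>t. t \<in> {0..a} \<Longrightarrow> 0 \<le> u t"
    "\<And>t. t \<in> {0..a} \<Longrightarrow> u t \<le> C * integral {0..t} u"
    and t: "t \<in> {0..a}" and C: "C \<ge> 0"
  shows "u t = 0"
proof -
  define U where "U t = integral {0..t} u" for t
  have Uc: "continuous_on {0..a} U" unfolding U_def
    by (intro indefinite_integral_continuous_1 integrable_continuous_real u)
  have "- (exp (- C * 0) * U 0) \<le> - (exp (- C * t) * U t)"
  proof (rule DERIV_nonneg_imp_increasing_open[where f = "\<lambda>t. - (exp (- C * t) * U t)"])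
    fix s assume s: "0 < s" "s < t"
    have "(U has_real_derivative u s) (at s within {0..a})"
      unfolding U_def using s t u(1) by (intro integral_has_real_derivative) auto
    then have "(U has_real_derivative u s) (at s)" using s t at_within_Icc_at[of 0 s a] by auto
    then have "((\<lambda>t. - (exp (- C * t) * U t)) has_real_derivative exp (- C * s) * (C * U s - u s)) (at s)"
      by (auto intro!: derivative_eq_intros simp: algebra_simps)
    moreover have "exp (- C * s) * (C * U s - u s) \<ge> 0" using u(3)[of s] s t by (auto simp: U_def)
    ultimately show "\<exists>y. ((\<lambda>t. - (exp (- C * t) * U t)) has_real_derivative y) (at s) \<and> 0 \<le> y" by blast
  qed (use t in \<open>auto intro!: continuous_intros continuous_on_subset[OF Uc]\<close>)
  then have "exp (- C * t) * U t \<le> 0" by (simp add: U_def)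
  then have "U t \<le> 0" by (simp add: mult_le_0_iff)
  then have "C * U t \<le> 0" using C by (simp add: mult_nonneg_nonpos)
  then show ?thesis using u(2,3)[OF t] by (simp add: U_def)
qed

text \<open>The sign of D comes first. If D t < 0, let s be the last time before t with D s \<ge> 0;
  after s one has |D| = - D, hence D' \<ge> \<mu> + L * D, and exp (- L x) * D x increases from a
  nonnegative to a negative value, which is absurd. Once D \<ge> 0 is known, |D| = D and exp (L (x -
  a)) * D x - \<mu> (x - a) is increasing.\<close>

lemma linear_differential_inequality:
  fixes D D' :: "real \<Rightarrow> real"
  assumes D: "continuous_on {a..c} D" "\<And>t. a < t \<Longrightarrow> t < c \<Longrightarrow> (D has_real_derivative D' t) (at t)"
    and lb: "\<And>t. a < t \<Longrightarrow> t < c \<Longrightarrow> D' t \<ge> \<mu> - L * \<bar>D t\<bar>"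
    and "D a = 0" "\<mu> \<ge> 0" "L \<ge> 0" "a \<le> c"
  shows "exp (L * (c - a)) * D c \<ge> \<mu> * (c - a)"
proof -
  have nonneg: "D t \<ge> 0" if t: "t \<in> {a..c}" for t
  proof (rule ccontr)
    assume neg: "\<not> D t \<ge> 0"
    define K where "K = {a..t} \<inter> D -` {0..}"
    have Dt: "continuous_on {a..t} D" using D(1) t by (auto intro: continuous_on_subset)
    have "closed K" unfolding K_def by (intro continuous_closed_preimage Dt) auto
    moreover have "bounded K" unfolding K_def by (meson bounded_Int bounded_closed_interval)
    ultimately have "compact K" by (simp add: compact_eq_bounded_closed)
    moreover have "a \<in> K" using t assms(4) by (auto simp: K_def)
    ultimately obtain s where s: "s \<in> K" "\<And>s'. s' \<in> K \<Longrightarrow> s' \<le> s"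
      using compact_attains_sup[of K] by blast
    have st: "a \<le> s" "s \<le> t" "D s \<ge> 0" "s \<noteq> t" using s(1) neg by (auto simp: K_def)
    have below: "D s' < 0" if "s < s'" "s' \<le> t" for s' using s(2)[of s'] that st by (force simp: K_def)
    have "exp (- L * s) * D s \<le> exp (- L * t) * D t"
    proof (rule DERIV_nonneg_imp_increasing_open[where f = "\<lambda>t. exp (- L * t) * D t"])
      fix x assume x: "s < x" "x < t"
      then have xx: "a < x" "x < c" using st t by auto
      have "((\<lambda>t. exp (- L * t) * D t) has_real_derivative exp (- L * x) * (D' x - L * D x)) (at x)"
        using D(2)[OF xx] by (auto intro!: derivative_eq_intros simp: algebra_simps)
      moreover have "exp (- L * x) * (D' x - L * D x) \<ge> 0" using lb[OF xx] below[of x] x assms(5) by auto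
      ultimately show "\<exists>y. ((\<lambda>t. exp (- L * t) * D t) has_real_derivative y) (at x) \<and> 0 \<le> y" by blast
    qed (use st in \<open>auto intro!: continuous_intros continuous_on_subset[OF Dt]\<close>)
    moreover have "exp (- L * s) * D s \<ge> 0" using st by simp
    moreover have "exp (- L * t) * D t < 0" using neg by (intro mult_pos_neg) auto
    ultimately show False by linarith
  qed
  have "exp (L * (a - a)) * D a - \<mu> * (a - a) \<le> exp (L * (c - a)) * D c - \<mu> * (c - a)"
  proof (rule DERIV_nonneg_imp_increasing_open[where f = "\<lambda>t. exp (L * (t - a)) * D t - \<mu> * (t - a)"])
    fix x assume x: "a < x" "x < c"
    have "((\<lambda>t. exp (L * (t - a)) * D t - \<mu> * (t - a)) has_real_derivative
        exp (L * (x - a)) * (D' x + L * D x) - \<mu>) (at x)"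
      using D(2)[OF x] by (auto intro!: derivative_eq_intros simp: algebra_simps)
    moreover have "1 * \<mu> \<le> exp (L * (x - a)) * (D' x + L * D x)"
      using lb[OF x] nonneg[of x] x assms(5,6) by (intro mult_mono) auto
    ultimately show "\<exists>y. ((\<lambda>t. exp (L * (t - a)) * D t - \<mu> * (t - a)) has_real_derivative y) (at x) \<and> 0 \<le> y"
      by fastforce
  qed (use assms in \<open>auto intro!: continuous_intros\<close>)
  then show ?thesis using assms(4) by simp
qed

section \<open>The Skorokhod regulator\<close>

lemma bdd_above_negative_part:
  "continuous_on {0..t} z \<Longrightarrow> bdd_above ((\<lambda>s::real. max 0 (- z s :: real)) ` {0..t})"
  by (intro bounded_imp_bdd_above compact_imp_bounded compact_continuous_image continuous_intros) auto

lemma negative_part_le_regulator: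
  "continuous_on {0..t} z \<Longrightarrow> s \<in> {0..t} \<Longrightarrow> max 0 (- z s) \<le> regulator z t"
  unfolding regulator_def by (intro cSUP_upper bdd_above_negative_part)

lemma regulator_le:
  "t \<ge> 0 \<Longrightarrow> (\<And>s. s \<in> {0..t} \<Longrightarrow> max 0 (- z s) \<le> c) \<Longrightarrow> regulator z t \<le> c"
  unfolding regulator_def by (intro cSUP_least) auto

lemma regulator_mono:
  assumes "continuous_on {0..t} z" "0 \<le> s" "s \<le> t"
  shows "regulator z s \<le> regulator z t"
  using assms by (intro regulator_le negative_part_le_regulator) auto

lemma regulator_lipschitz:
  assumes z: "continuous_on {0..t} z" "continuous_on {0..t} z'" and "t \<ge> 0"
    and c: "\<And>s. s \<in> {0..t} \<Longrightarrow> \<bar>z s - z' s\<bar> \<le> c"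
  shows "\<bar>regulator z t - regulator z' t\<bar> \<le> c"
proof -
  have "regulator z t \<le> regulator z' t + c"
  proof (rule regulator_le[OF assms(3)])
    fix s assume "s \<in> {0..t}"
    then show "max 0 (- z s) \<le> regulator z' t + c"
      using negative_part_le_regulator[OF z(2), of s] c[of s] by auto
  qed
  moreover have "regulator z' t \<le> regulator z t + c"
  proof (rule regulator_le[OF assms(3)])
    fix s assume "s \<in> {0..t}"
    then show "max 0 (- z' s) \<le> regulator z t + c"
      using negative_part_le_regulator[OF z(1), of s] c[of s] by auto
  qed
  ultimately show ?thesis by auto
qed

lemma regulator_increment_le:
  assumes z: "continuous_on {0..t} z" and st: "0 \<le> s" "s \<le> t"
    and c: "\<And>u. u \<in> {s..t} \<Longrightarrow> \<bar>z u - z s\<bar> \<le> c"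
  shows "regulator z t \<le> regulator z s + c"
proof (rule regulator_le)
  have zs: "continuous_on {0..s} z" using z st by (auto intro: continuous_on_subset)
  have "c \<ge> 0" using c[of s] st by auto
  fix u assume u: "u \<in> {0..t}"
  show "max 0 (- z u) \<le> regulator z s + c"
  proof (cases "u \<le> s")
    case True
    then show ?thesis using negative_part_le_regulator[OF zs, of u] u \<open>c \<ge> 0\<close> by auto
  next
    case False
    then show ?thesis using negative_part_le_regulator[OF zs, of s] st c[of u] u \<open>c \<ge> 0\<close> by auto
  qed
qed (use st in auto)

lemma continuous_on_regulator:
  assumes z: "continuous_on {0..t} z"
  shows "continuous_on {0..t} (regulator z)"
proof -
  have unif: "uniformly_continuous_on {0..t} z" using z by (intro compact_uniformly_continuous) auto
  show ?thesis unfolding continuous_on_iff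
  proof (intro ballI allI impI)
    fix s \<epsilon> :: real assume s: "s \<in> {0..t}" and "\<epsilon> > 0"
    then obtain d where d: "d > 0" "\<And>x y. x \<in> {0..t} \<Longrightarrow> y \<in> {0..t} \<Longrightarrow> dist x y < d \<Longrightarrow> dist (z x) (z y) < \<epsilon>/2"
      using unif unfolding uniformly_continuous_on_def by (metis half_gt_zero)
    have main: "\<bar>regulator z y - regulator z x\<bar> \<le> \<epsilon>/2"
      if "x \<in> {0..t}" "y \<in> {0..t}" "x \<le> y" "dist x y < d" for x y
    proof -
      have zy: "continuous_on {0..y} z" using z that by (auto intro: continuous_on_subset)
      have "regulator z y \<le> regulator z x + \<epsilon>/2"
      proof (rule regulator_increment_le[OF zy])
        fix u assume "u \<in> {x..y}"
        then show "\<bar>z u - z x\<bar> \<le> \<epsilon>/2" using d(2)[of u x] that by (auto simp: dist_real_def)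
      qed (use that in auto)
      moreover have "regulator z x \<le> regulator z y" using zy that by (intro regulator_mono) auto
      ultimately show ?thesis by auto
    qed
    have "dist (regulator z y) (regulator z s) < \<epsilon>" if "y \<in> {0..t}" "dist y s < d" for y
    proof -
      have "\<bar>regulator z y - regulator z s\<bar> \<le> \<epsilon>/2"
        using main[of s y] main[of y s] that s by (cases "s \<le> y") (auto simp: dist_commute abs_minus_commute)
      then show ?thesis using \<open>\<epsilon> > 0\<close> by (auto simp: dist_real_def)
    qed
    with d(1) show "\<exists>d>0. \<forall>y\<in>{0..t}. dist y s < d \<longrightarrow> dist (regulator z y) (regulator z s) < \<epsilon>" by blast
  qed
qed

text \<open>This is the complementarity of the Skorokhod problem in the form used later: the
  regulator grows only while the reflected path is at 0. Let s maximise the negative part over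
  {0..t}. If s > a and the maximum were positive, then z s = - regulator z t, so z s + regulator z s
  \<le> 0 against the assumption; hence the maximum is 0 or is attained before a.\<close>

lemma regulator_const_of_positive:
  assumes z: "continuous_on {0..t} z" and a: "0 \<le> a" "a \<le> t"
    and pos: "\<And>s. s \<in> {a..t} \<Longrightarrow> z s + regulator z s > 0"
  shows "regulator z t = regulator z a"
proof (rule antisym)
  show "regulator z a \<le> regulator z t" using regulator_mono[OF z] a by auto
  have za: "continuous_on {0..a} z" using z a by (auto intro: continuous_on_subset)
  have ra: "regulator z a \<ge> 0" using negative_part_le_regulator[OF za, of 0] a by auto
  obtain s where s: "s \<in> {0..t}" "\<And>u. u \<in> {0..t} \<Longrightarrow> max 0 (- z u) \<le> max 0 (- z s)"
  proof -
    have "continuous_on {0..t} (\<lambda>u. max 0 (- z u))" using z by (intro continuous_intros)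
    then have "\<exists>s\<in>{0..t}. \<forall>u\<in>{0..t}. max 0 (- z u) \<le> max 0 (- z s)"
      using a by (intro continuous_attains_sup) auto
    then show thesis using that by blast
  qed
  have rt: "regulator z t \<le> max 0 (- z s)" using s a by (intro regulator_le) auto
  show "regulator z t \<le> regulator z a"
  proof (cases "s \<le> a")
    case True
    then show ?thesis using negative_part_le_regulator[OF za, of s] s rt by auto
  next
    case False
    then have "z s + regulator z s > 0" using pos s by auto
    moreover have "regulator z s \<le> regulator z t" using regulator_mono[OF z] s by auto
    ultimately have "max 0 (- z s) = 0" using rt by auto
    then show ?thesis using rt ra by auto
  qed
qed

section \<open>Solutions along a fixed driving path\<close>

locale reflected_delay_coefficients =
  fixes b \<sigma> \<eta> :: "real \<Rightarrow> real" and r T L :: real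
  assumes r: "r > 0" and T: "T > 0"
    and L: "L \<ge> 0" "\<And>x y. \<bar>b x - b y\<bar> \<le> L * \<bar>x - y\<bar>"
    and \<sigma>_cont: "continuous_on UNIV \<sigma>" and \<sigma>_pos: "\<And>x. x \<ge> 0 \<Longrightarrow> \<sigma> x > 0"
    and \<eta>_cont: "continuous_on {-r..0} \<eta>" and \<eta>_nonneg: "\<And>t. t \<in> {-r..0} \<Longrightarrow> \<eta> t \<ge> 0"
begin

abbreviation solves :: "(real \<Rightarrow> real) \<Rightarrow> (real \<Rightarrow> real) \<Rightarrow> bool" where
  "solves w x \<equiv> solves_reflected_delay_path b \<sigma> \<eta> r T w x"

abbreviation driving :: "(real \<Rightarrow> real) \<Rightarrow> (real \<Rightarrow> real) \<Rightarrow> real \<Rightarrow> real" where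
  "driving w x \<equiv> unreflected_path b \<sigma> \<eta> r w x"

lemma b_continuous: "continuous_on S b"
  using L by (intro lipschitz_continuous_on) auto

lemma solves_initial: "solves w x \<Longrightarrow> t \<in> {-r..0} \<Longrightarrow> x t = \<eta> t"
  by (auto simp: solves_reflected_delay_path_def)

lemma solves_has_rs_integral:
  assumes "solves w x" "t \<in> {0..T}"
  shows "has_rs_integral (\<lambda>s. \<sigma> (x (s - r))) w 0 t (rs_integral (\<lambda>s. \<sigma> (x (s - r))) w 0 t)"
proof (cases "t = 0")
  case True
  then show ?thesis using has_rs_integral_refl rs_integral_eqI[OF has_rs_integral_refl] by metis
next
  case False
  then have "rs_integrable (\<lambda>s. \<sigma> (x (s - r))) w 0 t"
    using assms by (auto simp: solves_reflected_delay_path_def)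
  then show ?thesis by (rule rs_integrable_has_rs_integral)
qed

text \<open>The definition asks for the equation on (0, T] only. At time 0 it holds because \<eta> 0
  \<ge> 0 makes the regulator vanish.\<close>

lemma solves_eq:
  assumes "solves w x" "t \<in> {0..T}"
  shows "x t = driving w x t + regulator (driving w x) t"
proof (cases "t = 0")
  case True
  have "driving w x 0 = \<eta> 0"
    by (simp add: unreflected_path_def rs_integral_eqI[OF has_rs_integral_refl])
  moreover have "\<eta> 0 \<ge> 0" using \<eta>_nonneg r by auto
  moreover have "x 0 = \<eta> 0" using assms(1) r by (intro solves_initial) auto
  ultimately show ?thesis using True by (auto simp: regulator_def)
next
  case False
  then show ?thesis using assms by (auto simp: solves_reflected_delay_path_def)
qed

lemma driving_continuous:
  assumes x: "solves w x" and w: "continuous_on {0..T} w"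
  shows "continuous_on {0..T} (driving w x)"
proof -
  have "(\<lambda>s. b (x s)) integrable_on {0..T}"
    using x T by (auto simp: solves_reflected_delay_path_def)
  then have "continuous_on {0..T} (\<lambda>t. integral {0..t} (\<lambda>s. b (x s)))"
    by (rule indefinite_integral_continuous_1)
  moreover have "continuous_on {0..T} (rs_integral (\<lambda>s. \<sigma> (x (s - r))) w 0)"
    using solves_has_rs_integral[OF x] w by (rule continuous_on_rs_integral)
  ultimately show ?thesis unfolding unreflected_path_def by (intro continuous_intros)
qed

lemma solves_continuous:
  assumes x: "solves w x" and w: "continuous_on {0..T} w"
  shows "continuous_on {-r..T} x"
proof -
  have "continuous_on {0..T} (\<lambda>t. driving w x t + regulator (driving w x) t)"
    by (intro continuous_intros driving_continuous continuous_on_regulator x w)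
  then have "continuous_on {0..T} x" by (rule continuous_on_eq) (simp add: solves_eq[OF x])
  moreover have "continuous_on {-r..0} x"
    using \<eta>_cont by (rule continuous_on_eq) (simp add: solves_initial[OF x])
  ultimately have "continuous_on ({-r..0} \<union> {0..T}) x" by (intro continuous_on_closed_Un) auto
  moreover have "{-r..0} \<union> {0..T} = {-r..T}" using r T by auto
  ultimately show ?thesis by simp
qed

lemma solves_nonneg:
  assumes x: "solves w x" and w: "continuous_on {0..T} w" and t: "t \<in> {-r..T}"
  shows "x t \<ge> 0"
proof (cases "t \<le> 0")
  case True
  then show ?thesis using solves_initial[OF x, of t] \<eta>_nonneg t by auto
next
  case False
  have "continuous_on {0..t} (driving w x)"
    using driving_continuous[OF x w] t by (auto intro: continuous_on_subset)
  then have "max 0 (- driving w x t) \<le> regulator (driving w x) t"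
    using False by (intro negative_part_le_regulator) auto
  then show ?thesis using solves_eq[OF x, of t] t False by auto
qed

lemma delayed_diffusion_continuous:
  assumes x: "solves w x" and w: "continuous_on {0..T} w" and S: "S \<subseteq> {0..T}"
  shows "continuous_on S (\<lambda>s. \<sigma> (x (s - r)))"
proof (rule continuous_on_compose2[OF \<sigma>_cont])
  have "continuous_on {0..T} (\<lambda>s. x (s - r))"
    by (rule continuous_on_compose2[OF solves_continuous[OF x w]]) (use r in \<open>auto intro!: continuous_intros\<close>)
  then show "continuous_on S (\<lambda>s. x (s - r))" using S by (rule continuous_on_subset)
qed auto

text \<open>Agreement up to a - r makes the delayed integrands, hence the diffusion integrals, equal
  on {0..a}; only the drifts can differ. Their difference is at most L times the integral of |x -
  y|. The regulator is 1-Lipschitz in the supremum norm and contributes the same amount again, so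
  Gronwall applies with the constant 2 * L.\<close>

lemma solves_unique_step:
  assumes x: "solves w x" "continuous_on {0..T} w" and y: "solves w' y" "continuous_on {0..T} w'"
    and w: "\<And>t. t \<in> {0..a} \<Longrightarrow> w t = w' t" and a: "0 \<le> a" "a \<le> T"
    and before: "\<And>t. t \<in> {-r..a - r} \<Longrightarrow> x t = y t" and t: "t \<in> {0..a}"
  shows "x t = y t"
proof -
  define u where "u s = \<bar>x s - y s\<bar>" for s
  have xc: "continuous_on {0..a} x" and yc: "continuous_on {0..a} y"
    using solves_continuous[OF x] solves_continuous[OF y] a r by (auto intro: continuous_on_subset)
  have uc: "continuous_on {0..a} u" unfolding u_def using xc yc by (intro continuous_intros)
  have diff: "\<bar>driving w x s - driving w' y s\<bar> \<le> L * integral {0..s} u" if s: "s \<in> {0..a}" for s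
  proof -
    have int: "continuous_on {0..s} x" "continuous_on {0..s} y" "continuous_on {0..s} u"
      using xc yc uc s by (auto intro: continuous_on_subset)
    have ib: "(\<lambda>v. b (x v)) integrable_on {0..s}" "(\<lambda>v. b (y v)) integrable_on {0..s}"
      using int by (auto intro!: integrable_continuous_real continuous_on_compose2[OF b_continuous[of UNIV]])
    have "rs_integral (\<lambda>v. \<sigma> (x (v - r))) w 0 s = rs_integral (\<lambda>v. \<sigma> (y (v - r))) w' 0 s"
      using before w s by (intro rs_integral_cong) auto
    then have "driving w x s - driving w' y s = integral {0..s} (\<lambda>v. b (x v) - b (y v))"
      using ib by (simp add: unreflected_path_def Henstock_Kurzweil_Integration.integral_diff)
    moreover have "norm (integral {0..s} (\<lambda>v. b (x v) - b (y v))) \<le> integral {0..s} (\<lambda>v. L * u v)"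
      using L(2) by (intro integral_norm_bound_integral Henstock_Kurzweil_Integration.integrable_diff ib
          integrable_continuous_real continuous_intros int) (simp add: u_def)
    ultimately show ?thesis by simp
  qed
  have "u t = 0"
  proof (rule gronwall_zero[OF uc _ _ t])
    fix s assume s: "s \<in> {0..a}"
    have zc: "continuous_on {0..s} (driving w x)" "continuous_on {0..s} (driving w' y)"
      using driving_continuous[OF x] driving_continuous[OF y] s a by (auto intro: continuous_on_subset)
    have mono: "L * integral {0..v} u \<le> L * integral {0..s} u" if "v \<in> {0..s}" for v
      using that s L(1) uc
      by (intro mult_left_mono integral_subset_le)
        (auto intro!: integrable_continuous_real continuous_on_subset[OF uc] simp: u_def)
    have "\<bar>regulator (driving w x) s - regulator (driving w' y) s\<bar> \<le> L * integral {0..s} u"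
    proof (rule regulator_lipschitz[OF zc])
      fix v assume v: "v \<in> {0..s}"
      show "\<bar>driving w x v - driving w' y v\<bar> \<le> L * integral {0..s} u"
        using diff[of v] mono[OF v] v s by auto
    qed (use s in auto)
    then have "\<bar>x s - y s\<bar> \<le> L * integral {0..s} u + L * integral {0..s} u"
      using diff[OF s] solves_eq[OF x(1), of s] solves_eq[OF y(1), of s] s a by auto
    then show "u s \<le> 2 * L * integral {0..s} u" by (simp add: u_def)
  qed (use L(1) in \<open>auto simp: u_def\<close>)
  then show ?thesis by (simp add: u_def)
qed

text \<open>The method of steps: each application of the previous lemma extends the agreement by one
  delay r, until a is reached.\<close>

lemma solves_unique:
  assumes x: "solves w x" "continuous_on {0..T} w" and y: "solves w' y" "continuous_on {0..T} w'"
    and w: "\<And>t. t \<in> {0..a} \<Longrightarrow> w t = w' t" and a: "0 \<le> a" "a \<le> T" and t: "t \<in> {-r..a}"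
  shows "x t = y t"
proof -
  have "\<forall>t\<in>{-r..min a (real n * r)}. x t = y t" for n
  proof (induction n)
    case 0
    then show ?case using solves_initial[OF x(1)] solves_initial[OF y(1)] a by auto
  next
    case (Suc n)
    define a' where "a' = min a (real (Suc n) * r)"
    have "x t = y t" if t: "t \<in> {0..a'}" for t
    proof (rule solves_unique_step[OF x y])
      fix s assume "s \<in> {-r..a' - r}"
      moreover have "a' - r \<le> a" "a' - r \<le> real n * r" using r by (auto simp: a'_def algebra_simps)
      ultimately show "x s = y s" using Suc by auto
    qed (use t w a r in \<open>auto simp: a'_def\<close>)
    moreover have "x t = y t" if "t \<in> {-r..0}" for t
      using that solves_initial[OF x(1)] solves_initial[OF y(1)] by auto
    ultimately show ?case unfolding a'_def[symmetric] by (metis atLeastAtMost_iff linear)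
  qed
  moreover obtain n where "a < real n * r" using r reals_Archimedean3 by blast
  ultimately show ?thesis using t by (metis min.absorb1 less_imp_le)
qed

text \<open>Away from 0 the regulator is constant, so the increment of the reflected solution obeys
  the unreflected equation.\<close>

lemma solves_increment:
  assumes x: "solves w x" "continuous_on {0..T} w" and a: "0 \<le> a" "a \<le> t" "t \<le> T"
    and pos: "\<And>s. s \<in> {a..t} \<Longrightarrow> x s > 0"
  obtains J where "has_rs_integral (\<lambda>s. \<sigma> (x (s - r))) w a t J"
    "x t - x a = integral {a..t} (\<lambda>s. b (x s)) + J"
proof -
  define I where "I s = rs_integral (\<lambda>s. \<sigma> (x (s - r))) w 0 s" for s
  have J: "has_rs_integral (\<lambda>s. \<sigma> (x (s - r))) w a t (I t - I a)"
    unfolding I_def using a by (intro has_rs_integral_split[of _ _ 0] solves_has_rs_integral[OF x(1)]) auto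
  have zc: "continuous_on {0..t} (driving w x)"
    using driving_continuous[OF x] a by (auto intro: continuous_on_subset)
  have "regulator (driving w x) t = regulator (driving w x) a"
    using pos solves_eq[OF x(1)] a by (intro regulator_const_of_positive[OF zc]) fastforce+
  then have "x t - x a = driving w x t - driving w x a"
    using solves_eq[OF x(1), of t] solves_eq[OF x(1), of a] a by auto
  moreover have "continuous_on {0..t} (\<lambda>s. b (x s))"
    by (rule continuous_on_compose2[OF b_continuous[of UNIV]])
      (use solves_continuous[OF x] a r in \<open>auto intro: continuous_on_subset\<close>)
  then have "(\<lambda>s. b (x s)) integrable_on {0..t}" by (rule integrable_continuous_real)
  then have "integral {0..a} (\<lambda>s. b (x s)) + integral {a..t} (\<lambda>s. b (x s)) = integral {0..t} (\<lambda>s. b (x s))"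
    using a by (intro Henstock_Kurzweil_Integration.integral_combine) auto
  ultimately have "x t - x a = integral {a..t} (\<lambda>s. b (x s)) + (I t - I a)"
    by (simp add: unreflected_path_def I_def)
  with J that show thesis by blast
qed

text \<open>Though x and y are in general rough, D = y - x is continuously differentiable after a,
  because w cancels and only the affine part of w' remains: D' = b (y) - b (x) + \<kappa> * g with g
  \<ge> m the common diffusion coefficient. The Lipschitz bound on b turns this into D' \<ge>
  \<kappa> * m - L * |D|, with D a = 0.\<close>

lemma solves_expansion:
  assumes x: "solves w x" "continuous_on {0..T} w" and y: "solves w' y" "continuous_on {0..T} w'"
    and a: "0 \<le> a" "a \<le> c" "c \<le> T" "c - a \<le> r" and \<kappa>: "\<kappa> \<ge> 0" and m: "m \<ge> 0"
    and before: "\<And>t. t \<in> {0..a} \<Longrightarrow> w' t = w t"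
    and after: "\<And>t. t \<in> {a..c} \<Longrightarrow> w' t = w t + \<kappa> * (t - a)"
    and pos: "\<And>t. t \<in> {a..c} \<Longrightarrow> x t > 0" "\<And>t. t \<in> {a..c} \<Longrightarrow> y t > 0"
    and lower: "\<And>t. t \<in> {a..c} \<Longrightarrow> m \<le> \<sigma> (x (t - r))"
  shows "\<kappa> * m * (c - a) \<le> exp (L * (c - a)) * (y c - x c)"
proof -
  define g where "g t = \<sigma> (x (t - r))" for t
  define f where "f t = b (y t) - b (x t) + \<kappa> * g t" for t
  have same: "y t = x t" if "t \<in> {-r..a}" for t
    using before a by (intro solves_unique[OF y x _ _ _ that]) auto
  \<comment> \<open>Here c - a \<le> r is used: it puts t - r into the past {-r..a}, where the two
    solutions agree.\<close>
  have g': "\<sigma> (y (t - r)) = g t" if "t \<in> {a..c}" for t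
    unfolding g_def using that a r by (subst same) auto
  have xc: "continuous_on {a..c} x" and yc: "continuous_on {a..c} y"
    using solves_continuous[OF x] solves_continuous[OF y] a r by (auto intro: continuous_on_subset)
  have gc: "continuous_on {a..c} g" unfolding g_def using a by (intro delayed_diffusion_continuous[OF x]) auto
  have bc: "continuous_on {a..c} (\<lambda>t. b (x t))" "continuous_on {a..c} (\<lambda>t. b (y t))"
    using xc yc by (auto intro!: continuous_on_compose2[OF b_continuous[of UNIV]])
  have fc: "continuous_on {a..c} f" unfolding f_def using gc bc by (intro continuous_intros)
  have D: "y t - x t = integral {a..t} f" if t: "t \<in> {a..c}" for t
  proof -
    obtain J where J: "has_rs_integral g w a t J" "x t - x a = integral {a..t} (\<lambda>s. b (x s)) + J"
      using solves_increment[OF x, of a t] t a pos unfolding g_def by auto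
    obtain J' where J': "has_rs_integral (\<lambda>s. \<sigma> (y (s - r))) w' a t J'"
      "y t - y a = integral {a..t} (\<lambda>s. b (y s)) + J'"
      using solves_increment[OF y, of a t] t a pos by auto
    have "has_rs_integral g w' a t J'"
      using J'(1) by (rule has_rs_integral_cong[THEN iffD1, rotated 2]) (use g' t in auto)
    \<comment> \<open>Subtracting the integrators removes w and leaves \<kappa> * (s - a), against
      which the integral is an ordinary one.\<close>
    from has_rs_integral_diff_integrator[OF this J(1)]
    have rs: "has_rs_integral g (\<lambda>s. (- \<kappa> * a) + \<kappa> * s) a t (J' - J)"
      by (rule has_rs_integral_cong[THEN iffD1, rotated 2]) (use after t in \<open>auto simp: algebra_simps\<close>)
    moreover have sub: "{a..t} \<subseteq> {a..c}" using t by auto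
    ultimately have JJ: "J' - J = \<kappa> * integral {a..t} g"
      using has_rs_integral_affine_integrator[OF rs continuous_on_subset[OF gc sub]] by blast
    have "integral {a..t} f = integral {a..t} (\<lambda>s. b (y s)) - integral {a..t} (\<lambda>s. b (x s)) + \<kappa> * integral {a..t} g"
      unfolding f_def using bc gc sub
      by (subst Henstock_Kurzweil_Integration.integral_add Henstock_Kurzweil_Integration.integral_diff;
          auto intro!: integrable_continuous_real continuous_intros intro: continuous_on_subset)+
    moreover have "y a = x a" using same a r by auto
    ultimately show ?thesis using J(2) J'(2) JJ by auto
  qed
  define D where "D t = integral {a..t} f" for t
  have "\<kappa> * m * (c - a) \<le> exp (L * (c - a)) * D c"
  proof (rule linear_differential_inequality[where D' = f])
    show "continuous_on {a..c} D" unfolding D_def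
      by (intro indefinite_integral_continuous_1 integrable_continuous_real fc)
    fix t assume t: "a < t" "t < c"
    have "(D has_real_derivative f t) (at t within {a..c})"
      unfolding D_def using t by (intro integral_has_real_derivative fc) auto
    then show "(D has_real_derivative f t) (at t)" using t at_within_Icc_at[of a t c] by auto
    have "\<bar>b (y t) - b (x t)\<bar> \<le> L * \<bar>D t\<bar>" using L(2)[of "y t" "x t"] D[of t] t by (auto simp: D_def)
    moreover have "\<kappa> * m \<le> \<kappa> * g t" using lower[of t] t \<kappa> by (auto simp: g_def intro: mult_left_mono)
    ultimately show "\<kappa> * m - L * \<bar>D t\<bar> \<le> f t" unfolding f_def by linarith
  qed (use a \<kappa> m L(1) in \<open>auto simp: D_def\<close>)
  then show ?thesis using D[of c] a by (auto simp: D_def)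
qed

end

section \<open>Fourier representations of the covariance and of the tent\<close>

lemma one_minus_cos_le: "1 - cos x \<le> x\<^sup>2 / 2" for x :: real
proof -
  have "1 - cos x = 2 * (sin (x/2))\<^sup>2" using cos_double_sin[of "x/2"] by simp
  also have "\<dots> \<le> 2 * (x/2)\<^sup>2" using abs_sin_x_le_abs_x[of "x/2"] by (simp add: abs_le_square_iff[symmetric])
  finally show ?thesis by (simp add: power2_eq_square)
qed

text \<open>Three exponents occur: p = 1 + 2 * H for the covariance, p = 2 for the tent, and p = 3 -
  2 * H for the Cameron-Martin norm of the tent. All lie strictly between 1 and 3.\<close>

definition cos_kernel :: "real \<Rightarrow> real \<Rightarrow> real \<Rightarrow> real" where
  "cos_kernel p u x = (1 - cos (u * x)) * \<bar>x\<bar> powr (- p)"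

lemma cos_kernel_nonneg: "cos_kernel p u x \<ge> 0"
  by (simp add: cos_kernel_def)

lemma cos_kernel_measurable [measurable]: "cos_kernel p u \<in> borel_measurable borel"
  unfolding cos_kernel_def by measurable

lemma integrable_lborel_of_integrable_on:
  fixes f :: "real \<Rightarrow> real"
  assumes "f integrable_on S" "\<And>x. x \<in> S \<Longrightarrow> f x \<ge> 0" "S \<in> sets borel" "f \<in> borel_measurable borel"
  shows "integrable lborel (\<lambda>x. indicator S x * f x)"
proof -
  have "f absolutely_integrable_on S" using assms(1,2) by (rule nonnegative_absolutely_integrable_1)
  then have "integrable lebesgue (\<lambda>x. indicator S x * f x)" by (simp add: set_integrable_def)
  then show ?thesis using assms(3,4) by (subst (asm) integrable_completion) auto
qed

text \<open>Near 0 the factor 1 - cos x is quadratic and leaves x powr (2 - p), which needs p < 3;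
  at infinity it is bounded by 2, which needs p > 1. The majorant g covers the positive half-line
  and its reflection the negative one.\<close>

lemma integrable_cos_kernel_one:
  assumes p: "1 < p" "p < 3"
  shows "integrable lborel (cos_kernel p 1)"
proof -
  define g where "g x = indicator {0..1} x * x powr (2 - p) + 2 * (indicator {1..} x * x powr (- p))" for x :: real
  have "integrable lborel (\<lambda>x::real. indicator {0..1} x * x powr (2 - p))"
    using p by (intro integrable_lborel_of_integrable_on integrable_on_powr_from_0) auto
  moreover have "(\<lambda>x::real. x powr (- p)) integrable_on {1..}"
    using has_integral_powr_to_inf[of "- p" 1] p by (auto simp: integrable_on_def)
  then have "integrable lborel (\<lambda>x::real. indicator {1..} x * x powr (- p))"
    by (intro integrable_lborel_of_integrable_on) auto
  ultimately have g: "integrable lborel g" unfolding g_def by auto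
  then have g': "integrable lborel (\<lambda>x. g (- x))"
    using lborel_integrable_real_affine[of g "-1" 0] by simp
  show ?thesis
  proof (rule Bochner_Integration.integrable_bound[OF Bochner_Integration.integrable_add[OF g g']])
    have bound: "cos_kernel p 1 x \<le> g x" if x: "x > 0" for x
    proof (cases "x \<le> 1")
      case True
      have "cos_kernel p 1 x \<le> x\<^sup>2 / 2 * x powr (- p)"
        using one_minus_cos_le[of x] x by (auto simp: cos_kernel_def intro!: mult_right_mono)
      also have "\<dots> \<le> x powr 2 * x powr (- p)" using x by simp
      also have "\<dots> = x powr (2 - p)" using x by (simp add: powr_add[symmetric] del: powr_numeral)
      finally show ?thesis using x True by (auto simp: g_def indicator_def)
    next
      case False
      have "1 - cos x \<le> 2" using cos_ge_minus_one[of x] by linarith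
      then have "cos_kernel p 1 x \<le> 2 * x powr (- p)"
        using x by (auto simp: cos_kernel_def intro!: mult_right_mono)
      then show ?thesis using x False by (auto simp: g_def indicator_def)
    qed
    have g0: "g x \<ge> 0" for x by (simp add: g_def)
    have even: "cos_kernel p 1 (- x) = cos_kernel p 1 x" for x by (simp add: cos_kernel_def)
    have "cos_kernel p 1 x \<le> g x + g (- x)" for x
    proof -
      consider "x > 0" | "- x > 0" | "x = 0" by linarith
      then show ?thesis
      proof cases
        case 1 then show ?thesis using bound[of x] g0[of "- x"] by linarith
      next
        case 2 then show ?thesis using bound[of "- x"] g0[of x] even[of x] by linarith
      next
        case 3 then show ?thesis using g0[of 0] by (simp add: cos_kernel_def)
      qed
    qed
    then show "AE x in lborel. norm (cos_kernel p 1 x) \<le> norm (g x + g (- x))"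
      using cos_kernel_nonneg g0 by (auto simp: abs_of_nonneg)
  qed simp
qed

definition cos_const :: "real \<Rightarrow> real" where
  "cos_const p = (LINT x|lborel. cos_kernel p 1 x)"

text \<open>Scaling by the substitution of u * x for x; the Jacobian |u| and the power |u| powr (-
  p) combine to the exponent p - 1.\<close>

lemma has_bochner_integral_cos_kernel:
  assumes p: "1 < p" "p < 3"
  shows "has_bochner_integral lborel (cos_kernel p u) (cos_const p * \<bar>u\<bar> powr (p - 1))"
proof (cases "u = 0")
  case True
  then show ?thesis by (simp add: cos_kernel_def[abs_def] has_bochner_integral_zero)
next
  case False
  have eq: "cos_kernel p 1 (0 + u * x) = \<bar>u\<bar> powr (- p) * cos_kernel p u x" for x
    by (simp add: cos_kernel_def abs_mult powr_mult)
  have "integrable lborel (\<lambda>x. \<bar>u\<bar> powr (- p) * cos_kernel p u x)"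
    using lborel_integrable_real_affine[OF integrable_cos_kernel_one[OF p] False, of 0] unfolding eq .
  then have int: "integrable lborel (cos_kernel p u)" using False by simp
  have "cos_const p = \<bar>u\<bar> *\<^sub>R (LINT x|lborel. cos_kernel p 1 (0 + u * x))"
    unfolding cos_const_def using False by (rule lborel_integral_real_affine)
  also have "\<dots> = \<bar>u\<bar> * (\<bar>u\<bar> powr (- p) * (LINT x|lborel. cos_kernel p u x))"
    unfolding eq by simp
  also have "\<bar>u\<bar> * (\<bar>u\<bar> powr (- p) * (LINT x|lborel. cos_kernel p u x)) =
      \<bar>u\<bar> powr (1 - p) * (LINT x|lborel. cos_kernel p u x)"
    using False powr_add[of "\<bar>u\<bar>" 1 "- p"] by simp
  finally have "cos_const p * \<bar>u\<bar> powr (p - 1) = (LINT x|lborel. cos_kernel p u x)"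
    using False powr_add[of "\<bar>u\<bar>" "1 - p" "p - 1"] by simp
  with int show ?thesis by (simp add: has_bochner_integral_iff)
qed

lemma cos_const_pos:
  assumes p: "1 < p" "p < 3"
  shows "cos_const p > 0"
proof -
  have "cos_const p \<noteq> 0"
  proof
    assume "cos_const p = 0"
    then have "AE x in lborel. cos_kernel p 1 x = 0"
      unfolding cos_const_def using integrable_cos_kernel_one[OF p]
      by (subst (asm) integral_nonneg_eq_0_iff_AE) (auto simp: cos_kernel_nonneg)
    moreover have "cos_kernel p 1 x \<noteq> 0" if "x \<in> {0<..<1}" for x :: real
    proof -
      have "cos x < cos 0" using that pi_gt3 by (intro cos_monotone_0_pi) auto
      then show ?thesis using that by (auto simp: cos_kernel_def)
    qed
    ultimately have "AE x in lborel. x \<notin> {0<..<1::real}" by (auto elim!: eventually_mono)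
    then have "{0<..<1::real} \<in> null_sets lborel" by (simp add: AE_iff_null_sets)
    then show False by (auto dest!: null_setsD1)
  qed
  moreover have "cos_const p \<ge> 0" unfolding cos_const_def by (simp add: cos_kernel_nonneg)
  ultimately show ?thesis by simp
qed

text \<open>The harmonisable representation of fractional Brownian motion: A x and B x are the real
  and imaginary parts of the sum of a t * (exp (i t x) - 1). It rests on (cos u - 1) (cos v - 1) +
  sin u sin v = (1 - cos u) + (1 - cos v) - (1 - cos (u - v)), whose three terms integrate to the
  three powers in the covariance.\<close>

lemma fbm_quadratic_form:
  fixes a :: "real \<Rightarrow> real"
  assumes H: "0 < H" "H < 1" and J: "finite J" "J \<subseteq> {0..}"
  defines "A \<equiv> \<lambda>x. \<Sum>t\<in>J. a t * (cos (t * x) - 1)" and "B \<equiv> \<lambda>x. \<Sum>t\<in>J. a t * sin (t * x)"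
  shows "has_bochner_integral lborel (\<lambda>x. ((A x)\<^sup>2 + (B x)\<^sup>2) * \<bar>x\<bar> powr (- (1 + 2 * H)))
    (2 * cos_const (1 + 2 * H) * (\<Sum>t\<in>J. \<Sum>s\<in>J. a t * a s * fbm_covariance H t s))"
proof -
  define p where "p = 1 + 2 * H"
  have p: "1 < p" "p < 3" using H by (auto simp: p_def)
  note K = has_bochner_integral_cos_kernel[OF p]
  have "has_bochner_integral lborel (\<lambda>x. \<Sum>t\<in>J. \<Sum>s\<in>J. a t * a s * (cos_kernel p t x + cos_kernel p s x - cos_kernel p (t - s) x))
     (\<Sum>t\<in>J. \<Sum>s\<in>J. a t * a s * (cos_const p * \<bar>t\<bar> powr (p - 1) + cos_const p * \<bar>s\<bar> powr (p - 1) - cos_const p * \<bar>t - s\<bar> powr (p - 1)))"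
    by (intro has_bochner_integral_sum has_bochner_integral_mult_right has_bochner_integral_diff has_bochner_integral_add K)
  moreover have "(\<Sum>t\<in>J. \<Sum>s\<in>J. a t * a s * (cos_kernel p t x + cos_kernel p s x - cos_kernel p (t - s) x)) =
      ((A x)\<^sup>2 + (B x)\<^sup>2) * \<bar>x\<bar> powr (- p)" for x
  proof -
    have "a t * a s * (cos_kernel p t x + cos_kernel p s x - cos_kernel p (t - s) x) =
        ((a t * (cos (t * x) - 1)) * (a s * (cos (s * x) - 1)) + (a t * sin (t * x)) * (a s * sin (s * x))) * \<bar>x\<bar> powr (- p)" for t s
      by (simp add: cos_kernel_def left_diff_distrib cos_diff) (simp add: algebra_simps)
    then show ?thesis
      unfolding A_def B_def power2_eq_square sum_product
      by (simp add: sum_distrib_right sum.distrib[symmetric] distrib_right)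
  qed
  moreover have "(\<Sum>t\<in>J. \<Sum>s\<in>J. a t * a s * (cos_const p * \<bar>t\<bar> powr (p - 1) + cos_const p * \<bar>s\<bar> powr (p - 1) - cos_const p * \<bar>t - s\<bar> powr (p - 1)))
      = 2 * cos_const p * (\<Sum>t\<in>J. \<Sum>s\<in>J. a t * a s * fbm_covariance H t s)"
    unfolding sum_distrib_left
  proof (intro sum.cong refl)
    fix t s assume "t \<in> J" "s \<in> J"
    then have "\<bar>t\<bar> = t" "\<bar>s\<bar> = s" using J by auto
    then show "a t * a s * (cos_const p * \<bar>t\<bar> powr (p - 1) + cos_const p * \<bar>s\<bar> powr (p - 1) - cos_const p * \<bar>t - s\<bar> powr (p - 1))
        = 2 * cos_const p * (a t * a s * fbm_covariance H t s)"
      by (simp add: fbm_covariance_def p_def algebra_simps)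
  qed
  ultimately show ?thesis by (simp add: p_def)
qed

text \<open>Symmetric about c with half-width d. For c = t0 its rising half is the function h of the
  overview; the falling half lies after t0 and does not influence the solution at t0. The symmetric
  shape makes it a second difference of the absolute value.\<close>

definition tent :: "real \<Rightarrow> real \<Rightarrow> real \<Rightarrow> real" where
  "tent c d t = max 0 (1 - \<bar>t - c\<bar> / d)"

lemma tent_second_difference:
  assumes "d > 0"
  shows "2 * d * tent c d t = \<bar>t - c + d\<bar> + \<bar>t - c - d\<bar> - 2 * \<bar>t - c\<bar>"
  using assms by (auto simp: tent_def max_def abs_if field_simps)

text \<open>For p = 2 the kernel integrates to a multiple of |u|, so the second difference of |u|
  that gives the tent becomes a second difference of kernels. By the addition theorem the latter is
  cos ((t - c) x) times the Fejer-type factor \<open>cos_kernel 2 d x\<close>.\<close>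

lemma has_bochner_integral_tent:
  assumes d: "d > 0"
  shows "has_bochner_integral lborel (\<lambda>x. cos ((t - c) * x) * cos_kernel 2 d x) (cos_const 2 * d * tent c d t)"
proof -
  have "has_bochner_integral lborel
      (\<lambda>x. (cos_kernel 2 (t - c + d) x + cos_kernel 2 (t - c - d) x - 2 * cos_kernel 2 (t - c) x) / 2)
      ((cos_const 2 * \<bar>t - c + d\<bar> powr (2 - 1) + cos_const 2 * \<bar>t - c - d\<bar> powr (2 - 1) - 2 * (cos_const 2 * \<bar>t - c\<bar> powr (2 - 1))) / 2)"
    by (intro has_bochner_integral_divide_zero has_bochner_integral_diff has_bochner_integral_add
        has_bochner_integral_mult_right has_bochner_integral_cos_kernel) auto
  moreover have "(cos_kernel 2 (t - c + d) x + cos_kernel 2 (t - c - d) x - 2 * cos_kernel 2 (t - c) x) / 2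
      = cos ((t - c) * x) * cos_kernel 2 d x" for x
    by (simp add: cos_kernel_def distrib_right left_diff_distrib[of "t - c" d] cos_add cos_diff)
      (simp add: algebra_simps)
  moreover have "(cos_const 2 * \<bar>t - c + d\<bar> powr (2 - 1) + cos_const 2 * \<bar>t - c - d\<bar> powr (2 - 1) - 2 * (cos_const 2 * \<bar>t - c\<bar> powr (2 - 1))) / 2
      = cos_const 2 * (2 * d * tent c d t) / 2"
    unfolding tent_second_difference[OF d] by (simp add: algebra_simps)
  ultimately show ?thesis by (simp add: mult.assoc)
qed

lemma young_inequality_weighted:
  fixes y k w e :: real
  assumes "w > 0" "e > 0"
  shows "y * k \<le> e * y\<^sup>2 * w + k\<^sup>2 / (4 * e * w)"
proof -
  have "0 \<le> (2 * e * w * y - k)\<^sup>2" by simp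
  then have "4 * e * w * (y * k) \<le> 4 * e * w * (e * y\<^sup>2 * w) + k\<^sup>2"
    by (simp add: power2_eq_square algebra_simps)
  then show ?thesis using assms by (simp add: field_simps)
qed

text \<open>This says that the tent belongs to the Cameron-Martin space of the fractional Brownian motion.
  The proof compares the spectral representation of the covariance, with density proportional to
  \<open>\<bar>x\<bar> powr (- 1 - 2 * H)\<close>, with the Fourier representation of the tent; both come from
  \<open>\<integral> (1 - cos (u * x)) * \<bar>x\<bar> powr (- p) dx = cos_const p * \<bar>u\<bar> powr (p - 1)\<close>.\<close>

lemma fbm_tent_bound:
  assumes H: "0 < H" "H < 1" and d: "0 < d" "d \<le> c" and e: "e > 0"
  obtains C where "\<And>J a. finite J \<Longrightarrow> J \<subseteq> {0..} \<Longrightarrow> (\<Sum>t\<in>J. a t * tent c d t) \<le>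
      e * (\<Sum>t\<in>J. \<Sum>s\<in>J. a t * a s * fbm_covariance H t s) + C"
proof -
  define p where "p = 1 + 2 * H"
  have p: "1 < p" "p < 3" "1 < 4 - p" "4 - p < 3" using H by (auto simp: p_def)
  define k2 where "k2 = cos_const 2 * d"
  have k2: "k2 > 0" unfolding k2_def using d cos_const_pos[of 2] by simp
  have kp: "cos_const p > 0" using p cos_const_pos by simp
  \<comment> \<open>Chosen so that the quadratic term e' * (2 * cos_const p * V), divided by k2, is
    exactly e * V.\<close>
  define e' where "e' = e * k2 / (2 * cos_const p)"
  have e': "e' > 0" using e k2 kp by (simp add: e'_def)
  define C where "C = cos_const (4 - p) * \<bar>d\<bar> powr (4 - p - 1) / (2 * e') / k2"
  show thesis
  proof (rule that[of C])
    fix J :: "real set" and a :: "real \<Rightarrow> real" assume J: "finite J" "J \<subseteq> {0..}"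
    define A where "A = (\<lambda>x. \<Sum>t\<in>J. a t * (cos (t * x) - 1))"
    define B where "B = (\<lambda>x. \<Sum>t\<in>J. a t * sin (t * x))"
    define V where "V = (\<Sum>t\<in>J. \<Sum>s\<in>J. a t * a s * fbm_covariance H t s)"
    have quad: "has_bochner_integral lborel (\<lambda>x. ((A x)\<^sup>2 + (B x)\<^sup>2) * \<bar>x\<bar> powr (- p)) (2 * cos_const p * V)"
      using fbm_quadratic_form[OF H J, of a] by (simp add: A_def B_def V_def p_def)
    \<comment> \<open>The tent vanishes at 0 because d \<le> c. Subtracting its representation at 0
      changes cos ((t - c) x) into (cos (t x) - 1) cos (c x) + sin (t x) sin (c x), so the same A
      and B appear as in the covariance.\<close>
    have "has_bochner_integral lborel
        (\<lambda>x. \<Sum>t\<in>J. a t * (cos ((t - c) * x) * cos_kernel 2 d x - cos ((0 - c) * x) * cos_kernel 2 d x))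
        (\<Sum>t\<in>J. a t * (cos_const 2 * d * tent c d t - cos_const 2 * d * tent c d 0))"
      by (intro has_bochner_integral_sum has_bochner_integral_mult_right has_bochner_integral_diff
          has_bochner_integral_tent d)
    moreover have "(\<Sum>t\<in>J. a t * (cos ((t - c) * x) * cos_kernel 2 d x - cos ((0 - c) * x) * cos_kernel 2 d x))
        = (A x * cos (c * x) + B x * sin (c * x)) * cos_kernel 2 d x" for x
      unfolding A_def B_def sum_distrib_right sum.distrib[symmetric]
      by (intro sum.cong) (auto simp: left_diff_distrib[of _ c] cos_diff algebra_simps)
    moreover have "tent c d 0 = 0" using d by (simp add: tent_def field_simps)
    ultimately have lin: "has_bochner_integral lborel (\<lambda>x. (A x * cos (c * x) + B x * sin (c * x)) * cos_kernel 2 d x)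
        (k2 * (\<Sum>t\<in>J. a t * tent c d t))"
      by (simp add: k2_def sum_distrib_left mult_ac)
    have bd: "has_bochner_integral lborel
        (\<lambda>x. e' * (((A x)\<^sup>2 + (B x)\<^sup>2) * \<bar>x\<bar> powr (- p)) + cos_kernel (4 - p) d x / (2 * e'))
        (e' * (2 * cos_const p * V) + cos_const (4 - p) * \<bar>d\<bar> powr (4 - p - 1) / (2 * e'))"
      by (intro has_bochner_integral_add has_bochner_integral_mult_right quad has_bochner_integral_divide_zero
          has_bochner_integral_cos_kernel p)
    have "k2 * (\<Sum>t\<in>J. a t * tent c d t) \<le> e' * (2 * cos_const p * V) + cos_const (4 - p) * \<bar>d\<bar> powr (4 - p - 1) / (2 * e')"
      unfolding has_bochner_integral_integral_eq[OF lin, symmetric] has_bochner_integral_integral_eq[OF bd, symmetric]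
    proof (rule integral_mono)
      show "integrable lborel (\<lambda>x. (A x * cos (c * x) + B x * sin (c * x)) * cos_kernel 2 d x)"
        "integrable lborel (\<lambda>x. e' * (((A x)\<^sup>2 + (B x)\<^sup>2) * \<bar>x\<bar> powr (- p)) + cos_kernel (4 - p) d x / (2 * e'))"
        using lin bd by (auto simp: has_bochner_integral_iff)
    next
      fix x :: real
      show "(A x * cos (c * x) + B x * sin (c * x)) * cos_kernel 2 d x \<le>
          e' * (((A x)\<^sup>2 + (B x)\<^sup>2) * \<bar>x\<bar> powr (- p)) + cos_kernel (4 - p) d x / (2 * e')"
      proof (cases "x = 0")
        case True
        then show ?thesis by (simp add: cos_kernel_def)
      next
        case False
        define y where "y = A x * cos (c * x) + B x * sin (c * x)"
        define w where "w = \<bar>x\<bar> powr (- p)"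
        have w: "w > 0" using False by (simp add: w_def)
        have "(A x)\<^sup>2 + (B x)\<^sup>2 - y\<^sup>2 = (A x * sin (c * x) - B x * cos (c * x))\<^sup>2"
        proof -
          have "(u\<^sup>2 + v\<^sup>2) * (s\<^sup>2 + k\<^sup>2) - (u * k + v * s)\<^sup>2 = (u * s - v * k)\<^sup>2" for u v s k :: real
            by (simp add: power2_eq_square algebra_simps)
          from this[of "A x" "B x" "sin (c * x)" "cos (c * x)"] show ?thesis by (simp add: y_def)
        qed
        then have y: "y\<^sup>2 \<le> (A x)\<^sup>2 + (B x)\<^sup>2" by (smt (verit) zero_le_power2)
        \<comment> \<open>One factor 1 - cos is bounded by 2; the other tames the origin. The powers
          |x| powr (- 4) and |x| powr p leave the exponent 4 - p, again between 1 and 3, so that the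
          squared norm of the tent is finite.\<close>
        have k: "(cos_kernel 2 d x)\<^sup>2 / w \<le> 2 * cos_kernel (4 - p) d x"
        proof -
          have q: "0 \<le> 1 - cos (d * x)" "1 - cos (d * x) \<le> 2"
            using cos_ge_minus_one[of "d * x"] cos_le_one[of "d * x"] by linarith+
          have w2: "(\<bar>x\<bar> powr (- 2))\<^sup>2 / w = \<bar>x\<bar> powr (- (4 - p))"
            using False by (simp add: w_def power2_eq_square powr_add[symmetric] powr_diff[symmetric] del: powr_numeral)
          have "(cos_kernel 2 d x)\<^sup>2 / w = (1 - cos (d * x))\<^sup>2 * ((\<bar>x\<bar> powr (- 2))\<^sup>2 / w)"
            by (simp add: cos_kernel_def power_mult_distrib)
          also have "\<dots> = (1 - cos (d * x)) * (1 - cos (d * x)) * \<bar>x\<bar> powr (- (4 - p))"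
            unfolding w2 by (simp add: power2_eq_square)
          also have "\<dots> \<le> 2 * (1 - cos (d * x)) * \<bar>x\<bar> powr (- (4 - p))"
            using q by (intro mult_right_mono) auto
          finally show ?thesis unfolding cos_kernel_def[of "4 - p"] mult.assoc .
        qed
        have "y * cos_kernel 2 d x \<le> e' * y\<^sup>2 * w + (cos_kernel 2 d x)\<^sup>2 / (4 * e' * w)"
          using w e' by (rule young_inequality_weighted)
        also have "e' * y\<^sup>2 * w \<le> e' * (((A x)\<^sup>2 + (B x)\<^sup>2) * w)"
          using y w e' by (simp add: mult_left_mono mult_right_mono)
        also have "(cos_kernel 2 d x)\<^sup>2 / (4 * e' * w) = ((cos_kernel 2 d x)\<^sup>2 / w) / (4 * e')" by simp
        also have "\<dots> \<le> (2 * cos_kernel (4 - p) d x) / (4 * e')" using k e' by (intro divide_right_mono) auto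
        finally show ?thesis by (simp add: y_def w_def)
      qed
    qed
    then have "(\<Sum>t\<in>J. a t * tent c d t) \<le> (e' * (2 * cos_const p * V) + cos_const (4 - p) * \<bar>d\<bar> powr (4 - p - 1) / (2 * e')) / k2"
      using k2 by (simp add: field_simps)
    also have "\<dots> = e * V + C" using k2 kp by (simp add: C_def e'_def add_divide_distrib)
    finally show "(\<Sum>t\<in>J. a t * tent c d t) \<le> e * (\<Sum>t\<in>J. \<Sum>s\<in>J. a t * a s * fbm_covariance H t s) + C"
      by (simp add: V_def)
  qed
qed

section \<open>The Cramer-Wold theorem for processes\<close>

lemma (in prob_space) integrable_bounded:
  fixes f :: "'a \<Rightarrow> real"
  assumes "f \<in> borel_measurable M" "\<And>x. \<bar>f x\<bar> \<le> B"
  shows "integrable M f"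
  using assms by (intro integrable_const_bound[of _ B]) auto

text \<open>Dividing the weight by its common mean m turns both sides into laws of X under
  probability densities g / m. The hypotheses say that their characteristic functions agree, so
  Levy's uniqueness theorem applies. For m = 0 the weight vanishes almost everywhere and both sides
  are 0.\<close>

lemma weighted_law_unique:
  fixes X g :: "'a \<Rightarrow> real"
  assumes prob: "prob_space M" "prob_space N" and sets: "sets N = sets M"
    and X: "X \<in> borel_measurable M" and g: "g \<in> borel_measurable M" "\<And>x. 0 \<le> g x" "\<And>x. g x \<le> B"
    and cos: "\<And>u. (LINT x|M. g x * cos (u * X x)) = (LINT x|N. g x * cos (u * X x))"
    and sin: "\<And>u. (LINT x|M. g x * sin (u * X x)) = (LINT x|N. g x * sin (u * X x))"
    and A: "A \<in> sets borel"
  shows "(LINT x|M. g x * indicator A (X x)) = (LINT x|N. g x * indicator A (X x))"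
proof -
  have XN: "X \<in> borel_measurable N" and gN: "g \<in> borel_measurable N"
    using X g(1) sets by (simp_all cong: measurable_cong_sets)
  define m where "m = (LINT x|M. g x)"
  have mN: "m = (LINT x|N. g x)" using cos[of 0] by (simp add: m_def)
  have B0: "B \<ge> 0" using g(2,3) order_trans by blast
  have int: "integrable Q (\<lambda>x. g x * f x)"
    if "prob_space Q" "g \<in> borel_measurable Q" "f \<in> borel_measurable Q" "\<And>x. \<bar>f x\<bar> \<le> 1"
    for Q :: "'a measure" and f :: "'a \<Rightarrow> real"
  proof -
    interpret prob_space Q by fact
    have "\<bar>g x * f x\<bar> \<le> B * 1" for x
      unfolding abs_mult using g(2,3)[of x] that(4) B0 by (intro mult_mono) auto
    then show ?thesis using that by (intro integrable_bounded[of _ "B * 1"]) auto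
  qed
  have intg: "integrable M g" "integrable N g"
    using int[OF prob(1) g(1), of "\<lambda>_. 1"] int[OF prob(2) gN, of "\<lambda>_. 1"] by auto
  have m0: "m \<ge> 0" unfolding m_def using g(2) by simp
  show ?thesis
  proof (cases "m = 0")
    case True
    have "AE x in M. g x = 0" using True intg g(2) by (simp add: m_def integral_nonneg_eq_0_iff_AE)
    then have "(LINT x|M. g x * indicator A (X x)) = (LINT x|M. 0)"
      using X g(1) A by (intro integral_cong_AE) auto
    moreover have "AE x in N. g x = 0" using True intg g(2) by (simp add: mN integral_nonneg_eq_0_iff_AE)
    then have "(LINT x|N. g x * indicator A (X x)) = (LINT x|N. 0)"
      using XN gN A by (intro integral_cong_AE) auto
    ultimately show ?thesis by simp
  next
    case False
    with m0 have m: "m > 0" by simp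
    define law where "law Q = distr (density Q (\<lambda>x. ennreal (g x / m))) borel X" for Q
    have law: "real_distribution (law Q)"
      "char (law Q) u = complex_of_real ((LINT x|Q. g x * cos (u * X x)) / m) + \<i> * complex_of_real ((LINT x|Q. g x * sin (u * X x)) / m)"
      "measure (law Q) A = (LINT x|Q. g x * indicator A (X x)) / m"
      if Q: "prob_space Q" "X \<in> borel_measurable Q" "g \<in> borel_measurable Q" "m = (LINT x|Q. g x)" "integrable Q g" for Q u
    proof -
      interpret prob_space Q by fact
      note [measurable] = Q(2,3)
      have "(\<integral>\<^sup>+ x. ennreal (g x / m) \<partial>Q) = ennreal (LINT x|Q. g x / m)"
        using g(2) m Q(5) by (intro nn_integral_eq_integral) auto
      also have "(LINT x|Q. g x / m) = 1" using m Q(4) by simp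
      finally have "emeasure (density Q (\<lambda>x. ennreal (g x / m))) (space Q) = 1"
        by (subst emeasure_density) (auto simp: nn_integral_indicator cong: nn_integral_cong)
      then have "prob_space (density Q (\<lambda>x. ennreal (g x / m)))" by (intro prob_spaceI) simp
      then have "prob_space (law Q)" unfolding law_def by (rule prob_space.prob_space_distr) simp
      then show rd: "real_distribution (law Q)" by (intro real_distribution.intro real_distribution_axioms.intro) (auto simp: law_def)
      have ic: "integrable Q (\<lambda>x. g x * cos (u * X x))" "integrable Q (\<lambda>x. g x * sin (u * X x))"
        using int[OF Q(1,3)] by auto
      have "char (law Q) u = (CLINT x|Q. (g x / m) *\<^sub>R iexp (u * X x))"
        unfolding char_def law_def using g(2) m
        by (subst integral_distr) (auto intro!: integral_density)
      also have "\<dots> = (CLINT x|Q. complex_of_real (g x * cos (u * X x) / m) + \<i> * complex_of_real (g x * sin (u * X x) / m))"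
        by (intro Bochner_Integration.integral_cong refl) (simp add: complex_eq_iff Re_exp Im_exp)
      also have "\<dots> = complex_of_real ((LINT x|Q. g x * cos (u * X x)) / m) + \<i> * complex_of_real ((LINT x|Q. g x * sin (u * X x)) / m)"
        using ic by (subst Bochner_Integration.integral_add) (auto simp del: of_real_divide of_real_mult)
      finally show "char (law Q) u = complex_of_real ((LINT x|Q. g x * cos (u * X x)) / m) + \<i> * complex_of_real ((LINT x|Q. g x * sin (u * X x)) / m)" .
      interpret L: real_distribution "law Q" by (rule rd)
      have "measure (law Q) A = (LINT y|law Q. indicator A y)" using A by simp
      also have "\<dots> = (LINT x|Q. (g x / m) *\<^sub>R indicator A (X x))"
        unfolding law_def using g(2) m A
        by (subst integral_distr, simp, simp, subst integral_density) auto
      also have "\<dots> = (LINT x|Q. g x * indicator A (X x)) / m" by simp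
      finally show "measure (law Q) A = (LINT x|Q. g x * indicator A (X x)) / m" .
    qed
    note lM = law[OF prob(1) X g(1) m_def intg(1)] and lN = law[OF prob(2) XN gN mN intg(2)]
    have "char (law M) = char (law N)" by (rule ext) (simp only: lM(2) lN(2) cos sin)
    then have "law M = law N" by (rule Levy_uniqueness[OF lM(1) lN(1)])
    then show ?thesis using lM(3) lN(3) m by simp
  qed
qed

text \<open>The one-dimensional uniqueness theorem is applied to one coordinate at a time. The remaining
  trigonometric factor is made into a nonnegative weight as \<open>1 + cos F\<close> or \<open>1 + sin F\<close>.\<close>

lemma joint_law_unique:
  fixes X :: "'i \<Rightarrow> 'a \<Rightarrow> real" and Lin :: "('a \<Rightarrow> real) set"
  assumes prob: "prob_space M" "prob_space N" and sets: "sets N = sets M"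
    and meas: "\<And>F. F \<in> Lin \<Longrightarrow> F \<in> borel_measurable M"
    and zero: "(\<lambda>_. 0) \<in> Lin" and comb: "\<And>F G u. F \<in> Lin \<Longrightarrow> G \<in> Lin \<Longrightarrow> (\<lambda>x. u * F x + G x) \<in> Lin"
    and cos: "\<And>F. F \<in> Lin \<Longrightarrow> (LINT x|M. cos (F x)) = (LINT x|N. cos (F x))"
    and sin: "\<And>F. F \<in> Lin \<Longrightarrow> (LINT x|M. sin (F x)) = (LINT x|N. sin (F x))"
    and J: "finite J" "\<And>j. j \<in> J \<Longrightarrow> X j \<in> Lin" "\<And>j. j \<in> J \<Longrightarrow> A j \<in> sets borel" and F: "F \<in> Lin"
  shows "(LINT x|M. (\<Prod>j\<in>J. indicator (A j) (X j x)) * cos (F x)) = (LINT x|N. (\<Prod>j\<in>J. indicator (A j) (X j x)) * cos (F x)) \<and>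
    (LINT x|M. (\<Prod>j\<in>J. indicator (A j) (X j x)) * sin (F x)) = (LINT x|N. (\<Prod>j\<in>J. indicator (A j) (X j x)) * sin (F x))"
  using J F
proof (induction J arbitrary: F rule: finite_induct)
  case empty
  then show ?case using cos sin by simp
next
  case (insert j J)
  interpret M: prob_space M by fact
  interpret N: prob_space N by fact
  define G :: "'a \<Rightarrow> real" where "G x = (\<Prod>j\<in>J. indicator (A j) (X j x))" for x
  have G01: "0 \<le> G x" "G x \<le> 1" for x unfolding G_def by (auto intro!: prod_nonneg prod_le_1)
  have Gm: "G \<in> borel_measurable M"
    unfolding G_def using insert.prems meas
    by (intro borel_measurable_prod measurable_compose[OF _ borel_measurable_indicator]) auto
  have mN: "f \<in> borel_measurable N" if "f \<in> borel_measurable M" for f :: "'a \<Rightarrow> real"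
    using that sets by (simp cong: measurable_cong_sets)
  have IH: "(LINT x|M. G x * cos (K x)) = (LINT x|N. G x * cos (K x))"
    "(LINT x|M. G x * sin (K x)) = (LINT x|N. G x * sin (K x))" if "K \<in> Lin" for K
    using insert.IH[OF _ _ that] insert.prems by (auto simp: G_def)
  have Xj: "X j \<in> Lin" and Aj: "A j \<in> sets borel" using insert.prems by auto
  have intM: "integrable M (\<lambda>x. G x * cos (K x))" "integrable M (\<lambda>x. G x * sin (K x))"
    and intN: "integrable N (\<lambda>x. G x * cos (K x))" "integrable N (\<lambda>x. G x * sin (K x))" if "K \<in> Lin" for K
  proof -
    have b: "\<bar>G x * cos (K x)\<bar> \<le> 1 * 1" "\<bar>G x * sin (K x)\<bar> \<le> 1 * 1" for x
      unfolding abs_mult using G01[of x] by (intro mult_mono; simp)+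
    have m: "(\<lambda>x. G x * cos (K x)) \<in> borel_measurable M" "(\<lambda>x. G x * sin (K x)) \<in> borel_measurable M"
      using Gm meas[OF that] by measurable
    show "integrable M (\<lambda>x. G x * cos (K x))" "integrable M (\<lambda>x. G x * sin (K x))"
      using M.integrable_bounded[OF m(1) b(1)] M.integrable_bounded[OF m(2) b(2)] by auto
    show "integrable N (\<lambda>x. G x * cos (K x))" "integrable N (\<lambda>x. G x * sin (K x))"
      using N.integrable_bounded[OF mN[OF m(1)] b(1)] N.integrable_bounded[OF mN[OF m(2)] b(2)] by auto
  qed
  have lin: "(\<lambda>x. u * X j x) \<in> Lin" "(\<lambda>x. u * X j x + K x) \<in> Lin" "(\<lambda>x. u * X j x - K x) \<in> Lin"
    if "K \<in> Lin" for u K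
    using comb[OF Xj zero, of u] comb[OF Xj that, of u] comb[OF that comb[OF Xj zero, of u], of "-1"] by auto
  define W :: "(real \<Rightarrow> real) \<Rightarrow> 'a \<Rightarrow> real" where "W \<phi> x = G x * (1 + \<phi> (F x))" for \<phi> x
  have Fm: "F \<in> borel_measurable M" using meas insert.prems by auto
  have weighted: "(LINT x|M. W \<phi> x * indicator (A j) (X j x)) = (LINT x|N. W \<phi> x * indicator (A j) (X j x))"
    if \<phi>: "\<phi> \<in> {cos, sin, (\<lambda>_. 0)}" for \<phi>
  proof (rule weighted_law_unique[OF prob sets meas[OF Xj] _ _ _ _ _ Aj, where B = "1 * 2"])
    have \<phi>b: "- 1 \<le> \<phi> y" "\<phi> y \<le> 1" for y using \<phi> by auto
    show "W \<phi> \<in> borel_measurable M" unfolding W_def using \<phi> Gm Fm by auto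
    show "0 \<le> W \<phi> x" for x unfolding W_def using G01[of x] \<phi>b[of "F x"] by auto
    show "W \<phi> x \<le> 1 * 2" for x unfolding W_def using G01[of x] \<phi>b[of "F x"] by (intro mult_mono) auto
    fix u
    let ?U = "\<lambda>x. u * X j x" and ?P = "\<lambda>x. u * X j x + F x" and ?Q = "\<lambda>x. u * X j x - F x"
    have K: "?U \<in> Lin" "?P \<in> Lin" "?Q \<in> Lin" using lin[OF insert.prems(3)] by auto
    note ints = intM[OF K(1)] intM[OF K(2)] intM[OF K(3)] intN[OF K(1)] intN[OF K(2)] intN[OF K(3)]
    note eqs = IH[OF K(1)] IH[OF K(2)] IH[OF K(3)]
    \<comment> \<open>The variable z cancels. It is instantiated by the second product of the
      addition theorem, so that products such as cos F * cos U become half-sums of the cosine of U +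
      F and U - F, both in \<open>Lin\<close>, where the induction hypothesis applies.\<close>
    have half: "g * (1 + c) * y = g * y + (g * (c * y + z)) / 2 + (g * (c * y - z)) / 2" for g c y z :: real
      by (simp add: field_simps)
    have half': "g * (1 + c) * y = g * y + (g * (z + c * y)) / 2 - (g * (z - c * y)) / 2" for g c y z :: real
      by (simp add: field_simps)
    have e1: "G x * (1 + cos (F x)) * cos (?U x) = G x * cos (?U x) + (G x * cos (?Q x)) / 2 + (G x * cos (?P x)) / 2"
      "G x * (1 + cos (F x)) * sin (?U x) = G x * sin (?U x) + (G x * sin (?P x)) / 2 + (G x * sin (?Q x)) / 2"
      "G x * (1 + sin (F x)) * cos (?U x) = G x * cos (?U x) + (G x * sin (?P x)) / 2 - (G x * sin (?Q x)) / 2"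
      "G x * (1 + sin (F x)) * sin (?U x) = G x * sin (?U x) + (G x * cos (?Q x)) / 2 - (G x * cos (?P x)) / 2" for x
      using half[of "G x" "cos (F x)" "cos (?U x)" "sin (F x) * sin (?U x)"]
        half[of "G x" "cos (F x)" "sin (?U x)" "sin (F x) * cos (?U x)"]
        half'[of "G x" "sin (F x)" "cos (?U x)" "cos (F x) * sin (?U x)"]
        half'[of "G x" "sin (F x)" "sin (?U x)" "cos (F x) * cos (?U x)"]
      by (simp_all only: cos_add cos_diff sin_add sin_diff mult.commute add.commute)
    show "(LINT x|M. W \<phi> x * cos (u * X j x)) = (LINT x|N. W \<phi> x * cos (u * X j x))"
      using \<phi> by (elim insertE emptyE) (simp_all add: W_def e1 ints eqs)
    show "(LINT x|M. W \<phi> x * sin (u * X j x)) = (LINT x|N. W \<phi> x * sin (u * X j x))"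
      using \<phi> by (elim insertE emptyE) (simp_all add: W_def e1 ints eqs)
  qed
  have prod: "(\<Prod>i\<in>insert j J. indicator (A i) (X i x)) = G x * (indicator (A j) (X j x) :: real)" for x
    using insert.hyps by (simp add: G_def)
  have ind: "integrable Q (\<lambda>x. W \<phi> x * indicator (A j) (X j x))"
    if "Q = M \<or> Q = N" "\<phi> \<in> {cos, sin, (\<lambda>_. 0)}" for Q \<phi>
  proof -
    have "- 1 \<le> \<phi> y" "\<phi> y \<le> 1" for y using that by auto
    then have \<phi>b: "\<bar>1 + \<phi> y\<bar> \<le> 2" for y by (smt (verit))
    have "\<bar>W \<phi> x * indicator (A j) (X j x)\<bar> \<le> (1 * 2) * 1" for x
      unfolding W_def abs_mult using G01[of x] \<phi>b[of "F x"] by (intro mult_mono) auto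
    moreover have "(\<lambda>x. W \<phi> x * indicator (A j) (X j x)) \<in> borel_measurable M"
      unfolding W_def using that Gm Fm
      by (intro borel_measurable_times measurable_compose[OF meas[OF Xj] borel_measurable_indicator[OF Aj]]) auto
    ultimately show ?thesis
      using that mN M.integrable_bounded N.integrable_bounded by blast
  qed
  \<comment> \<open>The weight for the zero function is \<open>G\<close> itself; subtracting it
    removes the 1 that was added to keep the weight nonnegative.\<close>
  have split: "(LINT x|Q. (\<Prod>i\<in>insert j J. indicator (A i) (X i x)) * \<phi> (F x)) =
      (LINT x|Q. W \<phi> x * indicator (A j) (X j x)) - (LINT x|Q. W (\<lambda>_. 0) x * indicator (A j) (X j x))"
    if "Q = M \<or> Q = N" "\<phi> \<in> {cos, sin}" for Q \<phi>
  proof -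
    have "(\<Prod>i\<in>insert j J. indicator (A i) (X i x)) * \<phi> (F x) =
      W \<phi> x * indicator (A j) (X j x) - W (\<lambda>_. 0) x * indicator (A j) (X j x)" for x
      unfolding prod W_def by (simp add: algebra_simps)
    then show ?thesis using ind[of Q] that by (simp only:, subst Bochner_Integration.integral_diff) auto
  qed
  show ?case
    using split[of M cos] split[of N cos] split[of M sin] split[of N sin]
      weighted[of cos] weighted[of sin] weighted[of "\<lambda>_. 0"] by simp
qed

text \<open>Finite-dimensional cylinders determine a finite measure on the product. The indicator of
  a cylinder is a product of indicators of coordinates, so its integral is the case F = 0 of
  \<open>joint_law_unique\<close>.\<close>

proposition cramer_wold_PiM:
  fixes M N :: "('i \<Rightarrow> real) measure"
  assumes prob: "prob_space M" "prob_space N"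
    and sets: "sets M = sets (PiM I (\<lambda>_. borel))" "sets N = sets (PiM I (\<lambda>_. borel))"
    and cos: "\<And>K a. finite K \<Longrightarrow> K \<subseteq> I \<Longrightarrow> (LINT x|M. cos (\<Sum>k\<in>K. a k * x k)) = (LINT x|N. cos (\<Sum>k\<in>K. a k * x k))"
    and sin: "\<And>K a. finite K \<Longrightarrow> K \<subseteq> I \<Longrightarrow> (LINT x|M. sin (\<Sum>k\<in>K. a k * x k)) = (LINT x|N. sin (\<Sum>k\<in>K. a k * x k))"
  shows "M = N"
proof (rule measure_eqI_PiM_infinite[OF sets])
  interpret M: prob_space M by fact
  interpret N: prob_space N by fact
  show "finite_measure M" by unfold_locales
  fix A J assume J: "finite J" "J \<subseteq> I" "\<And>i. i \<in> J \<Longrightarrow> A i \<in> sets (borel :: real measure)"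
  define Lin where "Lin = {(\<lambda>x :: 'i \<Rightarrow> real. \<Sum>k\<in>K. a k * x k) | K a. finite K \<and> K \<subseteq> I}"
  have coord: "(\<lambda>x. x i) \<in> borel_measurable M" if "i \<in> I" for i
    using sets(1) measurable_component_singleton[OF that, of "\<lambda>_. borel :: real measure"]
    by (simp cong: measurable_cong_sets)
  have Lm: "F \<in> borel_measurable M" if "F \<in> Lin" for F
    using that coord unfolding Lin_def by (auto intro!: borel_measurable_sum borel_measurable_times)
  have comb: "(\<lambda>x. u * F x + G x) \<in> Lin" if FG: "F \<in> Lin" "G \<in> Lin" for F G u
  proof -
    obtain K a where F: "F = (\<lambda>x. \<Sum>k\<in>K. a k * x k)" "finite K" "K \<subseteq> I" using FG(1) by (auto simp: Lin_def)
    obtain K' a' where G: "G = (\<lambda>x. \<Sum>k\<in>K'. a' k * x k)" "finite K'" "K' \<subseteq> I" using FG(2) by (auto simp: Lin_def)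
    define c where "c k = u * (if k \<in> K then a k else 0) + (if k \<in> K' then a' k else 0)" for k
    have "u * F x + G x = (\<Sum>k\<in>K \<union> K'. c k * x k)" for x
    proof -
      have "F x = (\<Sum>k\<in>K \<union> K'. (if k \<in> K then a k else 0) * x k)"
        unfolding F(1) using F(2) G(2) by (intro sum.mono_neutral_cong_left) auto
      moreover have "G x = (\<Sum>k\<in>K \<union> K'. (if k \<in> K' then a' k else 0) * x k)"
        unfolding G(1) using F(2) G(2) by (intro sum.mono_neutral_cong_left) auto
      ultimately show ?thesis
        by (simp add: c_def sum_distrib_left sum.distrib[symmetric] algebra_simps)
    qed
    then show ?thesis unfolding Lin_def using F G by (intro CollectI exI[of _ "K \<union> K'"] exI[of _ c]) auto
  qed
  have X: "(\<lambda>x. x j) \<in> Lin" if "j \<in> J" for j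
    unfolding Lin_def using that J by (intro CollectI exI[of _ "{j}"] exI[of _ "\<lambda>_. 1"]) auto
  have zero: "(\<lambda>_. 0) \<in> Lin" unfolding Lin_def by (intro CollectI exI[of _ "{}"]) auto
  let ?E = "prod_emb I (\<lambda>_. borel) J (Pi\<^sub>E J A)"
  have E: "?E \<in> sets (PiM I (\<lambda>_. borel))" using J by (intro sets_PiM_I) auto
  have ind: "indicator ?E x = (\<Prod>j\<in>J. indicator (A j) (x j) :: real)" if "x \<in> space (PiM I (\<lambda>_. borel))" for x
  proof -
    have "x \<in> ?E \<longleftrightarrow> (\<forall>j\<in>J. x j \<in> A j)"
      using that by (auto simp: prod_emb_iff space_PiM PiE_iff)
    then show ?thesis using J(1) by (auto simp: indicator_def prod_zero_iff)
  qed
  have "(LINT x|M. (\<Prod>j\<in>J. indicator (A j) (x j)) * cos (0::real)) = (LINT x|N. (\<Prod>j\<in>J. indicator (A j) (x j)) * cos (0::real)) \<and>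
      (LINT x|M. (\<Prod>j\<in>J. indicator (A j) (x j)) * sin 0) = (LINT x|N. (\<Prod>j\<in>J. indicator (A j) (x j)) * sin (0::real))"
  proof (rule joint_law_unique[OF prob _ Lm zero comb, where X = "\<lambda>j x. x j" and F = "\<lambda>_. 0"])
    fix F assume "F \<in> Lin"
    then show "(LINT x|M. cos (F x)) = (LINT x|N. cos (F x))" "(LINT x|M. sin (F x)) = (LINT x|N. sin (F x))"
      using cos sin by (auto simp: Lin_def)
  qed (use X zero J sets in auto)
  then have "(LINT x|M. (\<Prod>j\<in>J. indicator (A j) (x j) :: real)) = (LINT x|N. (\<Prod>j\<in>J. indicator (A j) (x j) :: real))" by simp
  moreover have "(LINT x|M. (\<Prod>j\<in>J. indicator (A j) (x j) :: real)) = (LINT x|M. indicator ?E x)"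
    using sets_eq_imp_space_eq[OF sets(1)] ind by (intro Bochner_Integration.integral_cong) auto
  moreover have "(LINT x|N. (\<Prod>j\<in>J. indicator (A j) (x j) :: real)) = (LINT x|N. indicator ?E x)"
    using sets_eq_imp_space_eq[OF sets(2)] ind by (intro Bochner_Integration.integral_cong) auto
  moreover have "?E \<inter> space M = ?E" "?E \<inter> space N = ?E"
    using E sets sets.sets_into_space by blast+
  ultimately show "emeasure M ?E = emeasure N ?E"
    using E sets by (simp add: M.emeasure_eq_measure N.emeasure_eq_measure)
qed

section \<open>Splitting off a Cameron-Martin direction\<close>

text \<open>A linear space of pairs and not a linear function: the same random variable may arise
  from several combinations of the \<open>W t\<close>, and no representation has to be
  chosen.\<close>

definition linear_graph :: "(('a \<Rightarrow> real) \<times> real) set \<Rightarrow> bool" where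
  "linear_graph V \<longleftrightarrow> (\<lambda>_. 0, 0) \<in> V \<and>
     (\<forall>Y l Z k u. (Y, l) \<in> V \<longrightarrow> (Z, k) \<in> V \<longrightarrow> (\<lambda>\<omega>. u * Y \<omega> + Z \<omega>, u * l + k) \<in> V)"

lemma (in prob_space) integrable_mult_of_squares:
  fixes X Y :: "'a \<Rightarrow> real"
  assumes "X \<in> borel_measurable M" "Y \<in> borel_measurable M"
    "integrable M (\<lambda>\<omega>. (X \<omega>)\<^sup>2)" "integrable M (\<lambda>\<omega>. (Y \<omega>)\<^sup>2)"
  shows "integrable M (\<lambda>\<omega>. X \<omega> * Y \<omega>)"
proof (rule Bochner_Integration.integrable_bound[OF Bochner_Integration.integrable_add[OF assms(3,4)]])
  have "\<bar>X \<omega> * Y \<omega>\<bar> \<le> (X \<omega>)\<^sup>2 + (Y \<omega>)\<^sup>2" for \<omega>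
    using sum_squares_bound[of "\<bar>X \<omega>\<bar>" "\<bar>Y \<omega>\<bar>"] mult_nonneg_nonneg[of "\<bar>X \<omega>\<bar>" "\<bar>Y \<omega>\<bar>"]
    unfolding abs_mult power2_abs by linarith
  then show "AE \<omega> in M. norm (X \<omega> * Y \<omega>) \<le> norm ((X \<omega>)\<^sup>2 + (Y \<omega>)\<^sup>2)" by auto
qed (use assms in measurable)

text \<open>By the inequality |D| \<le> (1/2)^n + 2^n * D^2 the n-th increment has mean absolute
  value at most (1 + B) * (1/2)^n. The series of increments is then absolutely convergent almost
  surely.\<close>

lemma (in prob_space) AE_convergent_of_summable_L2_increments:
  fixes Y :: "nat \<Rightarrow> 'a \<Rightarrow> real"
  assumes Y: "\<And>n. Y n \<in> borel_measurable M" "\<And>n. integrable M (\<lambda>\<omega>. (Y (Suc n) \<omega> - Y n \<omega>)\<^sup>2)"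
    and bound: "\<And>n. expectation (\<lambda>\<omega>. (Y (Suc n) \<omega> - Y n \<omega>)\<^sup>2) \<le> B * (1/4) ^ n"
  shows "AE \<omega> in M. convergent (\<lambda>n. Y n \<omega>)"
proof -
  define D where "D n \<omega> = Y (Suc n) \<omega> - Y n \<omega>" for n \<omega>
  note [measurable] = Y(1)
  have Dm [measurable]: "D n \<in> borel_measurable M" for n unfolding D_def by measurable
  have "(\<integral>\<^sup>+ \<omega>. ennreal \<bar>D n \<omega>\<bar> \<partial>M) \<le> ennreal ((1 + B) * (1/2) ^ n)" for n
  proof -
    have le: "\<bar>D n \<omega>\<bar> \<le> (1/2) ^ n + 2 ^ n * (D n \<omega>)\<^sup>2" for \<omega>
    proof -
      define p where "p = (1/2 :: real) ^ n"
      have p: "2 ^ n * p = 1" by (simp add: p_def power_mult_distrib[symmetric])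
      have "2 * p * \<bar>D n \<omega>\<bar> \<le> p * p + (D n \<omega>)\<^sup>2"
        using sum_squares_bound[of p "\<bar>D n \<omega>\<bar>"] unfolding power2_abs by (simp add: power2_eq_square[of p])
      then have "2 ^ n * (2 * p * \<bar>D n \<omega>\<bar>) \<le> 2 ^ n * (p * p + (D n \<omega>)\<^sup>2)"
        by (intro mult_left_mono) auto
      also have "2 ^ n * (2 * p * \<bar>D n \<omega>\<bar>) = 2 * \<bar>D n \<omega>\<bar> * (2 ^ n * p)" by (simp add: algebra_simps)
      also have "2 ^ n * (p * p + (D n \<omega>)\<^sup>2) = (2 ^ n * p) * p + 2 ^ n * (D n \<omega>)\<^sup>2" by (simp add: algebra_simps)
      finally have "2 * \<bar>D n \<omega>\<bar> \<le> p + 2 ^ n * (D n \<omega>)\<^sup>2" unfolding p by simp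
      then show ?thesis unfolding p_def by linarith
    qed
    have int: "integrable M (\<lambda>\<omega>. (1/2) ^ n + 2 ^ n * (D n \<omega>)\<^sup>2)" using Y(2)[of n] by (simp add: D_def)
    have "(\<integral>\<^sup>+ \<omega>. ennreal \<bar>D n \<omega>\<bar> \<partial>M) \<le> (\<integral>\<^sup>+ \<omega>. ennreal ((1/2) ^ n + 2 ^ n * (D n \<omega>)\<^sup>2) \<partial>M)"
      using le by (intro nn_integral_mono ennreal_leI)
    also have "\<dots> = ennreal (expectation (\<lambda>\<omega>. (1/2) ^ n + 2 ^ n * (D n \<omega>)\<^sup>2))"
      by (intro nn_integral_eq_integral int) auto
    also have "expectation (\<lambda>\<omega>. (1/2) ^ n + 2 ^ n * (D n \<omega>)\<^sup>2) = (1/2) ^ n + 2 ^ n * expectation (\<lambda>\<omega>. (D n \<omega>)\<^sup>2)"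
      using Y(2)[of n] by (simp add: D_def prob_space)
    also have "ennreal \<dots> \<le> ennreal ((1/2) ^ n + 2 ^ n * (B * (1/4) ^ n))"
      using bound[of n] by (intro ennreal_leI add_left_mono mult_left_mono) (auto simp: D_def)
    also have "(1/2) ^ n + 2 ^ n * (B * (1/4) ^ n) = (1 + B) * (1/2 :: real) ^ n"
    proof -
      have "(2::real) ^ n * (1/4) ^ n = (1/2) ^ n" by (simp add: power_mult_distrib[symmetric])
      then show ?thesis by (simp add: algebra_simps)
    qed
    finally show ?thesis .
  qed
  moreover have B: "B \<ge> 0"
  proof -
    have "0 \<le> expectation (\<lambda>\<omega>. (Y (Suc 0) \<omega> - Y 0 \<omega>)\<^sup>2)" by simp
    also have "\<dots> \<le> B * (1/4) ^ 0" by (rule bound)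
    finally show ?thesis by simp
  qed
  moreover have "(\<Sum>n. ennreal ((1 + B) * (1/2) ^ n)) < \<top>"
    using B by (subst suminf_ennreal2) (auto intro!: summable_mult summable_geometric)
  ultimately have "(\<Sum>n. \<integral>\<^sup>+ \<omega>. ennreal \<bar>D n \<omega>\<bar> \<partial>M) < \<top>"
    by (meson suminf_le summableI order.strict_trans1)
  then have "(\<integral>\<^sup>+ \<omega>. (\<Sum>n. ennreal \<bar>D n \<omega>\<bar>) \<partial>M) \<noteq> \<infinity>"
    by (subst nn_integral_suminf) auto
  then have "AE \<omega> in M. (\<Sum>n. ennreal \<bar>D n \<omega>\<bar>) \<noteq> \<infinity>"
    by (intro nn_integral_PInf_AE) measurable
  then show ?thesis
  proof (rule AE_mp, intro AE_I2 impI)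
    fix \<omega> assume "(\<Sum>n. ennreal \<bar>D n \<omega>\<bar>) \<noteq> \<infinity>"
    then have "summable (\<lambda>n. \<bar>D n \<omega>\<bar>)" by (intro summable_suminf_not_top) auto
    then have "summable (\<lambda>n. D n \<omega>)" by (rule summable_rabs_cancel)
    then have "convergent (\<lambda>n. (\<Sum>i<n. D i \<omega>) + Y 0 \<omega>)"
      by (intro convergent_add[OF _ convergent_const]) (simp add: summable_iff_convergent)
    moreover have "(\<Sum>i<n. D i \<omega>) + Y 0 \<omega> = Y n \<omega>" for n
      by (induction n) (auto simp: D_def)
    ultimately show "convergent (\<lambda>n. Y n \<omega>)" by simp
  qed
qed

text \<open>Riesz representation of a functional that is bounded in \<open>L\<^sup>2\<close>, on a space of random variables
  that is not closed. The functional is given as the graph \<open>V\<close>, and its representative \<open>\<xi>\<close> is obtained by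
  minimising \<open>E Y\<^sup>2 / 2 - l\<close> over \<open>(Y, l) \<in> V\<close>.\<close>

lemma (in prob_space) riesz_representative:
  assumes V: "linear_graph V"
    and meas: "\<And>Y l. (Y, l) \<in> V \<Longrightarrow> Y \<in> borel_measurable M"
    and square: "\<And>Y l. (Y, l) \<in> V \<Longrightarrow> integrable M (\<lambda>\<omega>. (Y \<omega>)\<^sup>2)"
    and bounded: "\<And>Y l. (Y, l) \<in> V \<Longrightarrow> l \<le> expectation (\<lambda>\<omega>. (Y \<omega>)\<^sup>2) / 4 + C"
    and nonzero: "(Y0, l0) \<in> V" "l0 \<noteq> 0"
  obtains Y l \<xi> v where "\<And>n. (Y n, l n) \<in> V" "\<xi> \<in> borel_measurable M" "v > 0"
    "AE \<omega> in M. (\<lambda>n. Y n \<omega>) \<longlonglongrightarrow> \<xi> \<omega>"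
    "(\<lambda>n. expectation (\<lambda>\<omega>. (Y n \<omega>)\<^sup>2)) \<longlonglongrightarrow> v"
    "\<And>Z k. (Z, k) \<in> V \<Longrightarrow> (\<lambda>n. expectation (\<lambda>\<omega>. Y n \<omega> * Z \<omega>)) \<longlonglongrightarrow> k"
proof -
  define q where "q Y = expectation (\<lambda>\<omega>. (Y \<omega>)\<^sup>2)" for Y :: "'a \<Rightarrow> real"
  define F where "F = (\<lambda>(Y, l). q Y / 2 - l)"
  have comb: "(\<lambda>\<omega>. u * Y \<omega> + Z \<omega>, u * l + k) \<in> V" if "(Y, l) \<in> V" "(Z, k) \<in> V" for Y l Z k u
    using V that by (auto simp: linear_graph_def)
  have zero: "(\<lambda>_. 0, 0) \<in> V" using V by (auto simp: linear_graph_def)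
  have q0: "q Y \<ge> 0" for Y by (simp add: q_def)
  have cross: "integrable M (\<lambda>\<omega>. Y \<omega> * Z \<omega>)" if "(Y, l) \<in> V" "(Z, k) \<in> V" for Y l Z k
    using that meas square by (intro integrable_mult_of_squares)
  have qcomb: "q (\<lambda>\<omega>. u * Y \<omega> + Z \<omega>) = u\<^sup>2 * q Y + 2 * u * expectation (\<lambda>\<omega>. Y \<omega> * Z \<omega>) + q Z"
    if "(Y, l) \<in> V" "(Z, k) \<in> V" for Y l Z k u
  proof -
    have "q (\<lambda>\<omega>. u * Y \<omega> + Z \<omega>) = expectation (\<lambda>\<omega>. u\<^sup>2 * (Y \<omega>)\<^sup>2 + 2 * u * (Y \<omega> * Z \<omega>) + (Z \<omega>)\<^sup>2)"
      unfolding q_def by (intro Bochner_Integration.integral_cong) (auto simp: power2_eq_square algebra_simps)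
    also have "\<dots> = u\<^sup>2 * q Y + 2 * u * expectation (\<lambda>\<omega>. Y \<omega> * Z \<omega>) + q Z"
      using square[OF that(1)] square[OF that(2)] cross[OF that] by (simp add: q_def)
    finally show ?thesis .
  qed
  \<comment> \<open>Half of the second moment minus the quarter allowed by the bound leaves a
    quarter: F is bounded below, and minimising sequences stay bounded in L2.\<close>
  have Flow: "q Y / 4 - C \<le> F (Y, l)" if "(Y, l) \<in> V" for Y l
    using bounded[OF that] by (simp add: F_def q_def)
  have bdd: "bdd_below (F ` V)"
  proof (rule bdd_belowI2[of _ "- C"], clarify)
    fix Y l assume "(Y, l) \<in> V"
    then show "- C \<le> F (Y, l)" using Flow[of Y l] q0[of Y] by linarith
  qed
  define m where "m = Inf (F ` V)"
  have m_le: "m \<le> F (Y, l)" if "(Y, l) \<in> V" for Y l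
    unfolding m_def using that bdd by (intro cInf_lower) auto
  have "\<exists>y\<in>V. F y < m + (1/4) ^ n" for n :: nat
  proof -
    have "Inf (F ` V) < m + (1/4) ^ n" by (simp add: m_def)
    then show ?thesis using cInf_lessD[of "F ` V"] zero by blast
  qed
  then obtain y where y: "\<And>n :: nat. y n \<in> V" "\<And>n. F (y n) < m + (1/4) ^ n" by metis
  define Y where "Y n = fst (y n)" for n
  define l where "l n = snd (y n)" for n
  have YV: "(Y n, l n) \<in> V" for n using y(1)[of n] by (simp add: Y_def l_def)
  have Fn: "q (Y n) / 2 - l n < m + (1/4) ^ n" for n using y(2)[of n] by (simp add: F_def Y_def l_def case_prod_beta)
  \<comment> \<open>First variation at an approximate minimiser: Y n is within (1/4)^n of the
    infimum, and the test shifts s * Z with s = \<plusminus> (1/2)^n balance this error against the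
    quadratic term s^2 * q Z / 2.\<close>
  have near: "\<bar>expectation (\<lambda>\<omega>. Y n \<omega> * Z \<omega>) - k\<bar> \<le> (1/2) ^ n * (1 + q Z / 2)" if Z: "(Z, k) \<in> V" for n Z k
  proof -
    define e where "e = expectation (\<lambda>\<omega>. Y n \<omega> * Z \<omega>) - k"
    have "0 \<le> (1/4) ^ n + s * e + s\<^sup>2 * q Z / 2" for s
    proof -
      have e': "expectation (\<lambda>\<omega>. Z \<omega> * Y n \<omega>) = e + k" by (simp add: e_def mult.commute)
      have "m \<le> q (\<lambda>\<omega>. s * Z \<omega> + Y n \<omega>) / 2 - (s * k + l n)"
        using m_le[OF comb[OF Z YV, of s n]] by (simp add: F_def)
      also have "\<dots> = s\<^sup>2 * q Z / 2 + s * e + (q (Y n) / 2 - l n)"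
        unfolding qcomb[OF Z YV] e' by (simp add: field_simps)
      finally show ?thesis using Fn[of n] by linarith
    qed
    from this[of "(1/2) ^ n"] this[of "- ((1/2) ^ n)"]
    have "(1/2) ^ n * \<bar>e\<bar> \<le> (1/4) ^ n + ((1/2) ^ n)\<^sup>2 * q Z / 2" by (auto simp: abs_if)
    also have "(1/4::real) ^ n = (1/2) ^ n * (1/2) ^ n" by (simp add: power_mult_distrib[symmetric])
    finally have "(1/2) ^ n * \<bar>e\<bar> \<le> (1/2) ^ n * ((1/2) ^ n * (1 + q Z / 2))"
      by (simp add: power2_eq_square algebra_simps)
    then show ?thesis by (simp add: e_def mult_le_cancel_left)
  qed
  have half: "(\<lambda>n. (1/2 :: real) ^ n * x) \<longlonglongrightarrow> 0" for x
    using tendsto_mult_right[OF LIMSEQ_realpow_zero[of "1/2 :: real"], of x] by (simp add: mult.commute)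
  have riesz: "(\<lambda>n. expectation (\<lambda>\<omega>. Y n \<omega> * Z \<omega>)) \<longlonglongrightarrow> k" if "(Z, k) \<in> V" for Z k
  proof -
    have "(\<lambda>n. expectation (\<lambda>\<omega>. Y n \<omega> * Z \<omega>) - k) \<longlonglongrightarrow> 0"
      by (rule Lim_null_comparison[OF _ half[of "1 + q Z / 2"]]) (use near[OF that] in \<open>auto intro!: always_eventually\<close>)
    then show ?thesis by (simp add: LIM_zero_iff)
  qed
  have small: "(1/4 :: real) ^ n \<le> 1" for n by (simp add: power_le_one)
  have qbound: "q (Y n) \<le> 4 * (m + 1 + C)" for n using Flow[OF YV, of n] Fn[of n] small[of n] by (simp add: F_def)
  have "(\<lambda>n. q (Y n) - l n) \<longlonglongrightarrow> 0"
  proof (rule Lim_null_comparison[OF _ half[of "1 + 4 * (m + 1 + C) / 2"]], intro always_eventually allI)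
    fix n
    have "\<bar>q (Y n) - l n\<bar> \<le> (1/2) ^ n * (1 + q (Y n) / 2)"
      using near[OF YV, of n n] by (simp add: q_def power2_eq_square)
    also have "\<dots> \<le> (1/2) ^ n * (1 + 4 * (m + 1 + C) / 2)"
      using qbound[of n] by (intro mult_left_mono) auto
    finally show "norm (q (Y n) - l n) \<le> (1/2) ^ n * (1 + 4 * (m + 1 + C) / 2)" by simp
  qed
  moreover have "(\<lambda>n. q (Y n) / 2 - l n) \<longlonglongrightarrow> m"
  proof (rule tendsto_sandwich[of "\<lambda>_. m" _ _ "\<lambda>n. m + (1/4) ^ n"])
    show "(\<lambda>n. m + (1/4) ^ n) \<longlonglongrightarrow> m"
      using tendsto_add[OF tendsto_const[of m] LIMSEQ_realpow_zero[of "1/4 :: real"]] by simp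
    show "\<forall>\<^sub>F n in sequentially. m \<le> q (Y n) / 2 - l n" using m_le[OF YV] by (auto simp: F_def)
    show "\<forall>\<^sub>F n in sequentially. q (Y n) / 2 - l n \<le> m + (1/4) ^ n" by (intro always_eventually allI less_imp_le Fn)
  qed simp
  \<comment> \<open>Twice the difference of the two brackets is q (Y n); this is how the limiting
    variance v = - 2 * m arises.\<close>
  ultimately have "(\<lambda>n. 2 * ((q (Y n) - l n) - (q (Y n) / 2 - l n))) \<longlonglongrightarrow> 2 * (0 - m)"
    by (intro tendsto_intros)
  then have qlim: "(\<lambda>n. q (Y n)) \<longlonglongrightarrow> - 2 * m" by (simp add: field_simps)
  have "m < 0"
  proof -
    \<comment> \<open>Along the multiples of (Y0, l0), this s makes F equal to - s^2 * (q Y0 / 2 +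
      1), which is negative; the added 1 covers q Y0 = 0.\<close>
    define s where "s = l0 / (q Y0 + 1)"
    have qp: "q Y0 + 1 > 0" using q0[of Y0] by linarith
    have sl: "s * l0 = s\<^sup>2 * (q Y0 + 1)" using qp by (simp add: s_def power2_eq_square)
    have "m \<le> q (\<lambda>\<omega>. s * Y0 \<omega> + 0) / 2 - (s * l0 + 0)"
      using m_le[OF comb[OF nonzero(1) zero, of s]] by (simp add: F_def)
    also have "q (\<lambda>\<omega>. s * Y0 \<omega> + 0) = s\<^sup>2 * q Y0"
      unfolding qcomb[OF nonzero(1) zero] by (simp add: q_def)
    finally have "m \<le> - (s\<^sup>2 * (q Y0 / 2 + 1))" using sl by (simp add: algebra_simps)
    also have "\<dots> < 0" using q0[of Y0] nonzero(2) qp by (simp add: s_def)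
    finally show ?thesis .
  qed
  \<comment> \<open>Parallelogram law: the midpoint of two approximate minimisers cannot lie below
    m, which forces them close together. The argument gives the factor 4 + 1, rounded up to
    8.\<close>
  have inc: "integrable M (\<lambda>\<omega>. (Y (Suc n) \<omega> - Y n \<omega>)\<^sup>2)" "q (\<lambda>\<omega>. Y (Suc n) \<omega> - Y n \<omega>) \<le> 8 * (1/4) ^ n" for n
  proof -
    have "((\<lambda>\<omega>. -1 * Y n \<omega> + Y (Suc n) \<omega>), -1 * l n + l (Suc n)) \<in> V" using comb[OF YV YV] .
    then show "integrable M (\<lambda>\<omega>. (Y (Suc n) \<omega> - Y n \<omega>)\<^sup>2)" using square by fastforce
    define e where "e = expectation (\<lambda>\<omega>. Y n \<omega> * Y (Suc n) \<omega>)"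
    have sumV: "((\<lambda>\<omega>. 1 * Y n \<omega> + Y (Suc n) \<omega>), 1 * l n + l (Suc n)) \<in> V" using comb[OF YV YV] .
    have "m \<le> q (\<lambda>\<omega>. 1/2 * (1 * Y n \<omega> + Y (Suc n) \<omega>) + 0) / 2 - (1/2 * (1 * l n + l (Suc n)) + 0)"
      using m_le[OF comb[OF sumV zero, of "1/2"]] by (simp add: F_def)
    also have "q (\<lambda>\<omega>. 1/2 * (1 * Y n \<omega> + Y (Suc n) \<omega>) + 0) = 1/4 * (q (Y n) + 2 * e + q (Y (Suc n)))"
      unfolding qcomb[OF sumV zero] unfolding qcomb[OF YV YV] by (simp add: q_def e_def power2_eq_square)
    finally have 1: "8 * m \<le> q (Y n) + 2 * e + q (Y (Suc n)) - 4 * l n - 4 * l (Suc n)" by (simp add: field_simps)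
    have "q (\<lambda>\<omega>. Y (Suc n) \<omega> - Y n \<omega>) = q (\<lambda>\<omega>. -1 * Y n \<omega> + Y (Suc n) \<omega>)" by (simp add: q_def)
    also have "\<dots> = q (Y n) - 2 * e + q (Y (Suc n))" unfolding qcomb[OF YV YV] by (simp add: e_def)
    also have "\<dots> \<le> 8 * (1/4) ^ n" using 1 Fn[of n] Fn[of "Suc n"] power_Suc[of "1/4::real" n] zero_le_power[of "1/4::real" n] by linarith
    finally show "q (\<lambda>\<omega>. Y (Suc n) \<omega> - Y n \<omega>) \<le> 8 * (1/4) ^ n" .
  qed
  have "AE \<omega> in M. convergent (\<lambda>n. Y n \<omega>)"
    using inc(2) by (intro AE_convergent_of_summable_L2_increments[of _ 8] meas[OF YV] inc(1)) (simp add: q_def)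
  then have "AE \<omega> in M. (\<lambda>n. Y n \<omega>) \<longlonglongrightarrow> lim (\<lambda>n. Y n \<omega>)" by (simp add: convergent_LIMSEQ_iff)
  moreover have "(\<lambda>\<omega>. lim (\<lambda>n. Y n \<omega>)) \<in> borel_measurable M" using meas[OF YV] by measurable
  ultimately show thesis
    using that[of Y l "\<lambda>\<omega>. lim (\<lambda>n. Y n \<omega>)" "- 2 * m"] YV riesz qlim \<open>m < 0\<close> by (auto simp: q_def)
qed

section \<open>Characteristic functions of Gaussian variables and the independent copy\<close>

lemma std_normal_cos_sin:
  "(LINT x|std_normal_distribution. cos (t * x)) = exp (- (t\<^sup>2) / 2)"
  "(LINT x|std_normal_distribution. sin (t * x)) = 0"
proof -
  interpret real_distribution std_normal_distribution by (rule real_dist_normal_dist)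
  have int: "integrable std_normal_distribution (\<lambda>x. iexp (t * x))"
    by (intro integrable_iexp) auto
  have c: "(CLINT x|std_normal_distribution. iexp (t * x)) = complex_of_real (exp (- (t\<^sup>2) / 2))"
    using char_std_normal_distribution by (simp add: char_def fun_eq_iff)
  show "(LINT x|std_normal_distribution. cos (t * x)) = exp (- (t\<^sup>2) / 2)"
    using arg_cong[OF c, of Re] integral_Re[OF int] by (simp add: Re_exp)
  show "(LINT x|std_normal_distribution. sin (t * x)) = 0"
    using arg_cong[OF c, of Im] integral_Im[OF int] by (simp add: Im_exp)
qed

text \<open>The point mass has to be covered too: it occurs for the fractional Brownian motion at
  time 0 and for the empty combination. In both cases the law depends on the second moment only, by
  the same formula.\<close>

lemma (in prob_space) centered_gaussian_rv:
  assumes X: "gaussian_rv M X" "expectation X = 0"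
  shows "X \<in> borel_measurable M" "integrable M X" "integrable M (\<lambda>\<omega>. (X \<omega>)\<^sup>2)"
    "expectation (\<lambda>\<omega>. cos (X \<omega>)) = exp (- expectation (\<lambda>\<omega>. (X \<omega>)\<^sup>2) / 2)"
    "expectation (\<lambda>\<omega>. sin (X \<omega>)) = 0"
proof -
  have "X \<in> borel_measurable M \<and> integrable M X \<and> integrable M (\<lambda>\<omega>. (X \<omega>)\<^sup>2) \<and>
    expectation (\<lambda>\<omega>. cos (X \<omega>)) = exp (- expectation (\<lambda>\<omega>. (X \<omega>)\<^sup>2) / 2) \<and> expectation (\<lambda>\<omega>. sin (X \<omega>)) = 0"
    using X(1) unfolding gaussian_rv_def
  proof (elim disjE exE conjE)
    fix \<mu> s :: real assume s: "s > 0" and d: "distributed M lborel X (normal_density \<mu> s)"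
    have Xm [measurable]: "X \<in> borel_measurable M" using distributed_measurable[OF d] by simp
    have "\<mu> = 0" using normal_distributed_expectation[OF s d] X(2) by simp
    note d = d[unfolded this]
    have int: "integrable M (\<lambda>\<omega>. X \<omega> ^ k)" for k
      using integrable_normal_moment[OF s, of 0 k] distributed_integrable[OF d, of "\<lambda>x. x ^ k"] by simp
    have var: "expectation (\<lambda>\<omega>. (X \<omega>)\<^sup>2) = s\<^sup>2"
      using normal_distributed_variance[OF s d] X(2) by simp
    have "distributed M lborel (\<lambda>x. (X x - 0) / s) std_normal_density"
      using normal_standard_normal_convert[OF s, of X 0] d by simp
    then have law: "distr M borel (\<lambda>\<omega>. X \<omega> / s) = std_normal_distribution"
      by (simp add: distributed_distr_eq_density[symmetric] cong: distr_cong)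
    have "expectation (\<lambda>\<omega>. cos (X \<omega>)) = exp (- (s\<^sup>2) / 2)" "expectation (\<lambda>\<omega>. sin (X \<omega>)) = 0"
      using std_normal_cos_sin[of s] s by (simp_all add: law[symmetric] integral_distr)
    then show ?thesis using int[of 1] int[of 2] var by simp
  next
    fix \<mu> assume Xm: "X \<in> borel_measurable M" and c: "AE \<omega> in M. X \<omega> = \<mu>"
    have "expectation X = expectation (\<lambda>_. \<mu>)" using Xm c by (intro integral_cong_AE) auto
    then have "\<mu> = 0" using X(2) by (simp add: prob_space)
    with c have c0: "AE \<omega> in M. X \<omega> = 0" by simp
    have "expectation (\<lambda>\<omega>. f (X \<omega>)) = expectation (\<lambda>_. f 0)" if "f \<in> borel_measurable borel" for f :: "real \<Rightarrow> real"
      using Xm c0 that by (intro integral_cong_AE) auto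
    from this[of cos] this[of sin] this[of "\<lambda>x. x\<^sup>2"]
    have "expectation (\<lambda>\<omega>. cos (X \<omega>)) = 1" "expectation (\<lambda>\<omega>. sin (X \<omega>)) = 0" "expectation (\<lambda>\<omega>. (X \<omega>)\<^sup>2) = 0"
      by (simp_all add: prob_space)
    moreover have "integrable M X" "integrable M (\<lambda>\<omega>. (X \<omega>)\<^sup>2)"
      using Xm c0 integrable_cong_AE[of X M "\<lambda>_. 0"] integrable_cong_AE[of "\<lambda>\<omega>. (X \<omega>)\<^sup>2" M "\<lambda>_. 0"] by auto
    ultimately show ?thesis using Xm by simp
  qed
  then show "X \<in> borel_measurable M" "integrable M X" "integrable M (\<lambda>\<omega>. (X \<omega>)\<^sup>2)"
    "expectation (\<lambda>\<omega>. cos (X \<omega>)) = exp (- expectation (\<lambda>\<omega>. (X \<omega>)\<^sup>2) / 2)"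
    "expectation (\<lambda>\<omega>. sin (X \<omega>)) = 0" by auto
qed

text \<open>Here \<open>\<rho> * x\<close> replaces \<open>\<xi>\<close> by an independent copy, so that \<open>W\<close> is written in law as the sum of a
  process and an independent Gaussian multiple of \<open>h\<close>.\<close>

proposition (in prob_space) gaussian_process_split:
  fixes W :: "real \<Rightarrow> 'a \<Rightarrow> real" and R :: "real \<Rightarrow> real \<Rightarrow> real"
  assumes W: "gaussian_process M I W" and mean: "\<And>t. t \<in> I \<Longrightarrow> expectation (W t) = 0"
    and cov: "\<And>t s. t \<in> I \<Longrightarrow> s \<in> I \<Longrightarrow> expectation (\<lambda>\<omega>. W t \<omega> * W s \<omega>) = R t s"
    and bounded: "\<And>J a. finite J \<Longrightarrow> J \<subseteq> I \<Longrightarrow>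
      (\<Sum>t\<in>J. a t * h t) \<le> (\<Sum>t\<in>J. \<Sum>s\<in>J. a t * a s * R t s) / 4 + C"
    and t0: "t0 \<in> I" "h t0 \<noteq> 0"
  obtains \<xi> \<rho> where "\<xi> \<in> borel_measurable M" "\<rho> > 0"
    "distr (std_normal_distribution \<Otimes>\<^sub>M M) (PiM I (\<lambda>_. borel)) (\<lambda>(x, \<omega>). \<lambda>t\<in>I. W t \<omega> + (\<rho> * x - \<xi> \<omega>) * h t)
      = distr M (PiM I (\<lambda>_. borel)) (\<lambda>\<omega>. \<lambda>t\<in>I. W t \<omega>)"
proof -
  have Wm [measurable]: "W t \<in> borel_measurable M" if "t \<in> I" for t
    using W that by (auto simp: gaussian_process_def)
  have Wg: "gaussian_rv M (\<lambda>\<omega>. \<Sum>t\<in>J. a t * W t \<omega>)" if "finite J" "J \<subseteq> I" for J a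
    using W that by (auto simp: gaussian_process_def)
  have W1: "gaussian_rv M (W t)" if "t \<in> I" for t using Wg[of "{t}" "\<lambda>_. 1"] that by simp
  note W1f = centered_gaussian_rv[OF W1 mean]
  have Wint: "integrable M (\<lambda>\<omega>. W t \<omega> * W s \<omega>)" if "t \<in> I" "s \<in> I" for t s
    using W1f that by (intro integrable_mult_of_squares) auto
  have comb_mean: "expectation (\<lambda>\<omega>. \<Sum>t\<in>J. a t * W t \<omega>) = 0" if "finite J" "J \<subseteq> I" for J a
  proof -
    have "expectation (\<lambda>\<omega>. \<Sum>t\<in>J. a t * W t \<omega>) = (\<Sum>t\<in>J. expectation (\<lambda>\<omega>. a t * W t \<omega>))"
      using that W1f by (intro Bochner_Integration.integral_sum) auto
    then show ?thesis using that mean by (simp add: subset_iff)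
  qed
  have comb_var: "expectation (\<lambda>\<omega>. (\<Sum>t\<in>J. a t * W t \<omega>)\<^sup>2) = (\<Sum>t\<in>J. \<Sum>s\<in>J. a t * a s * R t s)"
    if J: "finite J" "J \<subseteq> I" for J a
  proof -
    have "(\<Sum>t\<in>J. a t * W t \<omega>)\<^sup>2 = (\<Sum>t\<in>J. \<Sum>s\<in>J. a t * a s * (W t \<omega> * W s \<omega>))" for \<omega>
      unfolding power2_eq_square sum_product by (simp add: mult_ac)
    then have "expectation (\<lambda>\<omega>. (\<Sum>t\<in>J. a t * W t \<omega>)\<^sup>2) = expectation (\<lambda>\<omega>. \<Sum>t\<in>J. \<Sum>s\<in>J. a t * a s * (W t \<omega> * W s \<omega>))" by simp
    also have "\<dots> = (\<Sum>t\<in>J. expectation (\<lambda>\<omega>. \<Sum>s\<in>J. a t * a s * (W t \<omega> * W s \<omega>)))"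
      using J Wint by (intro Bochner_Integration.integral_sum Bochner_Integration.integrable_sum integrable_mult_right) auto
    also have "\<dots> = (\<Sum>t\<in>J. \<Sum>s\<in>J. expectation (\<lambda>\<omega>. a t * a s * (W t \<omega> * W s \<omega>)))"
      using J Wint by (intro sum.cong refl Bochner_Integration.integral_sum integrable_mult_right) auto
    also have "\<dots> = (\<Sum>t\<in>J. \<Sum>s\<in>J. a t * a s * R t s)"
      using J cov by (intro sum.cong refl) (auto simp: subset_iff)
    finally show ?thesis .
  qed
  define V where "V = {(\<lambda>\<omega>. \<Sum>t\<in>J. a t * W t \<omega>, \<Sum>t\<in>J. a t * h t) | J a. finite J \<and> J \<subseteq> I}"
  have VE: "\<exists>J a. Y = (\<lambda>\<omega>. \<Sum>t\<in>J. a t * W t \<omega>) \<and> l = (\<Sum>t\<in>J. a t * h t) \<and> finite J \<and> J \<subseteq> I" if "(Y, l) \<in> V" for Y l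
    using that unfolding V_def by blast
  have VI: "(\<lambda>\<omega>. \<Sum>t\<in>J. a t * W t \<omega>, \<Sum>t\<in>J. a t * h t) \<in> V" if "finite J" "J \<subseteq> I" for J a
    using that unfolding V_def by blast
  have comb: "(\<lambda>\<omega>. u * Y \<omega> + Z \<omega>, u * l + k) \<in> V" if YZ: "(Y, l) \<in> V" "(Z, k) \<in> V" for Y l Z k u
  proof -
    obtain J a where Y: "Y = (\<lambda>\<omega>. \<Sum>t\<in>J. a t * W t \<omega>)" "l = (\<Sum>t\<in>J. a t * h t)" "finite J" "J \<subseteq> I"
      using VE[OF YZ(1)] by blast
    obtain J' a' where Z: "Z = (\<lambda>\<omega>. \<Sum>t\<in>J'. a' t * W t \<omega>)" "k = (\<Sum>t\<in>J'. a' t * h t)" "finite J'" "J' \<subseteq> I"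
      using VE[OF YZ(2)] by blast
    define c where "c t = u * (if t \<in> J then a t else 0) + (if t \<in> J' then a' t else 0)" for t
    have split: "u * (\<Sum>t\<in>J. a t * f t) + (\<Sum>t\<in>J'. a' t * f t) = (\<Sum>t\<in>J \<union> J'. c t * f t)" for f
    proof -
      have "(\<Sum>t\<in>J. a t * f t) = (\<Sum>t\<in>J \<union> J'. (if t \<in> J then a t else 0) * f t)"
        using Y(3) Z(3) by (intro sum.mono_neutral_cong_left) auto
      moreover have "(\<Sum>t\<in>J'. a' t * f t) = (\<Sum>t\<in>J \<union> J'. (if t \<in> J' then a' t else 0) * f t)"
        using Y(3) Z(3) by (intro sum.mono_neutral_cong_left) auto
      ultimately show ?thesis by (simp add: c_def sum_distrib_left sum.distrib[symmetric] algebra_simps)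
    qed
    show ?thesis unfolding Y(1,2) Z(1,2) split using Y Z by (intro VI) auto
  qed
  have zero: "(\<lambda>_. 0, 0) \<in> V" using VI[of "{}"] by simp
  have lin: "linear_graph V" using comb zero by (auto simp: linear_graph_def)
  have gauss: "gaussian_rv M Y" "expectation Y = 0" if "(Y, l) \<in> V" for Y l
    using VE[OF that] Wg comb_mean by auto
  have gaussV: "Y \<in> borel_measurable M" "integrable M (\<lambda>\<omega>. (Y \<omega>)\<^sup>2)"
    "expectation (\<lambda>\<omega>. cos (Y \<omega>)) = exp (- expectation (\<lambda>\<omega>. (Y \<omega>)\<^sup>2) / 2)"
    "expectation (\<lambda>\<omega>. sin (Y \<omega>)) = 0" if "(Y, l) \<in> V" for Y l
    using centered_gaussian_rv[OF gauss[OF that]] by auto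
  have Vbound: "l \<le> expectation (\<lambda>\<omega>. (Y \<omega>)\<^sup>2) / 4 + C" if "(Y, l) \<in> V" for Y l
    using VE[OF that] bounded comb_var by auto
  have nz: "(W t0, h t0) \<in> V" using VI[of "{t0}" "\<lambda>_. 1"] t0(1) by simp
  obtain Y l \<zeta> v where Y: "\<And>n. (Y n, l n) \<in> V" and \<zeta>m [measurable]: "\<zeta> \<in> borel_measurable M" and v: "v > 0"
    and lim: "AE \<omega> in M. (\<lambda>n. Y n \<omega>) \<longlonglongrightarrow> \<zeta> \<omega>"
    and var: "(\<lambda>n. expectation (\<lambda>\<omega>. (Y n \<omega>)\<^sup>2)) \<longlonglongrightarrow> v"
    and cross: "\<And>Z k. (Z, k) \<in> V \<Longrightarrow> (\<lambda>n. expectation (\<lambda>\<omega>. Y n \<omega> * Z \<omega>)) \<longlonglongrightarrow> k"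
    by (rule riesz_representative[OF lin gaussV(1) gaussV(2) Vbound nz t0(2)]) (assumption | rule that)+
  \<comment> \<open>Dominated convergence carries the Gaussian characteristic functions of u * Y n +
    Z over to the limit: \<zeta> and Z are jointly Gaussian, v is the variance of \<zeta> and k its
    covariance with Z.\<close>
  have cf: "expectation (\<lambda>\<omega>. cos (u * \<zeta> \<omega> + Z \<omega>)) = exp (- (u\<^sup>2 * v + 2 * u * k + expectation (\<lambda>\<omega>. (Z \<omega>)\<^sup>2)) / 2)"
    "expectation (\<lambda>\<omega>. sin (u * \<zeta> \<omega> + Z \<omega>)) = 0" if Z: "(Z, k) \<in> V" for Z k u
  proof -
    have Zm [measurable]: "Z \<in> borel_measurable M" using gaussV(1)[OF Z] .
    have Ym [measurable]: "Y n \<in> borel_measurable M" for n using gaussV(1)[OF Y] .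
    define q where "q n = expectation (\<lambda>\<omega>. (u * Y n \<omega> + Z \<omega>)\<^sup>2)" for n
    have q_eq: "q n = u\<^sup>2 * expectation (\<lambda>\<omega>. (Y n \<omega>)\<^sup>2) + 2 * u * expectation (\<lambda>\<omega>. Y n \<omega> * Z \<omega>) + expectation (\<lambda>\<omega>. (Z \<omega>)\<^sup>2)" for n
    proof -
      have "q n = expectation (\<lambda>\<omega>. u\<^sup>2 * (Y n \<omega>)\<^sup>2 + 2 * u * (Y n \<omega> * Z \<omega>) + (Z \<omega>)\<^sup>2)"
        unfolding q_def by (intro Bochner_Integration.integral_cong) (auto simp: power2_eq_square algebra_simps)
      also have "\<dots> = u\<^sup>2 * expectation (\<lambda>\<omega>. (Y n \<omega>)\<^sup>2) + 2 * u * expectation (\<lambda>\<omega>. Y n \<omega> * Z \<omega>) + expectation (\<lambda>\<omega>. (Z \<omega>)\<^sup>2)"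
        using gaussV(2)[OF Y] gaussV(2)[OF Z] integrable_mult_of_squares[OF gaussV(1)[OF Y] gaussV(1)[OF Z] gaussV(2)[OF Y] gaussV(2)[OF Z]]
        by simp
      finally show ?thesis .
    qed
    have "(\<lambda>n. q n) \<longlonglongrightarrow> u\<^sup>2 * v + 2 * u * k + expectation (\<lambda>\<omega>. (Z \<omega>)\<^sup>2)"
      unfolding q_eq by (intro tendsto_intros var cross[OF Z])
    then have "(\<lambda>n. exp (- q n / 2)) \<longlonglongrightarrow> exp (- (u\<^sup>2 * v + 2 * u * k + expectation (\<lambda>\<omega>. (Z \<omega>)\<^sup>2)) / 2)"
      by (intro tendsto_intros) auto
    moreover have "exp (- q n / 2) = expectation (\<lambda>\<omega>. cos (u * Y n \<omega> + Z \<omega>))" for n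
      using gaussV(3)[OF comb[OF Y Z]] by (simp add: q_def)
    moreover have "(\<lambda>n. expectation (\<lambda>\<omega>. cos (u * Y n \<omega> + Z \<omega>))) \<longlonglongrightarrow> expectation (\<lambda>\<omega>. cos (u * \<zeta> \<omega> + Z \<omega>))"
      by (rule integral_dominated_convergence[where w = "\<lambda>_. 1"])
        (use lim in \<open>auto elim!: eventually_mono intro!: tendsto_intros\<close>)
    ultimately show "expectation (\<lambda>\<omega>. cos (u * \<zeta> \<omega> + Z \<omega>)) = exp (- (u\<^sup>2 * v + 2 * u * k + expectation (\<lambda>\<omega>. (Z \<omega>)\<^sup>2)) / 2)"
      using LIMSEQ_unique by auto
    have "(\<lambda>n. expectation (\<lambda>\<omega>. sin (u * Y n \<omega> + Z \<omega>))) \<longlonglongrightarrow> expectation (\<lambda>\<omega>. sin (u * \<zeta> \<omega> + Z \<omega>))"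
      by (rule integral_dominated_convergence[where w = "\<lambda>_. 1"])
        (use lim in \<open>auto elim!: eventually_mono intro!: tendsto_intros\<close>)
    moreover have "expectation (\<lambda>\<omega>. sin (u * Y n \<omega> + Z \<omega>)) = 0" for n
      using gaussV(4)[OF comb[OF Y Z]] by simp
    ultimately show "expectation (\<lambda>\<omega>. sin (u * \<zeta> \<omega> + Z \<omega>)) = 0"
      by (simp add: LIMSEQ_const_iff)
  qed
  \<comment> \<open>The covariance of \<zeta> with \<open>W t\<close> is h t, so \<zeta> / v is the
    coefficient for which W - \<xi> * h is uncorrelated with \<zeta>. It has variance 1 / v, which
    is that of \<rho> * x for \<rho> = 1 / sqrt v.\<close>
  define \<xi> where "\<xi> \<omega> = \<zeta> \<omega> / v" for \<omega>
  define \<rho> where "\<rho> = 1 / sqrt v"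
  have \<xi>m [measurable]: "\<xi> \<in> borel_measurable M" unfolding \<xi>_def by measurable
  interpret N: prob_space std_normal_distribution by (rule prob_space_normal_density) simp
  interpret NM: pair_prob_space std_normal_distribution M ..
  let ?\<Phi> = "\<lambda>(x, \<omega>). \<lambda>t\<in>I. W t \<omega> + (\<rho> * x - \<xi> \<omega>) * h t"
  have \<Phi>m: "?\<Phi> \<in> measurable (std_normal_distribution \<Otimes>\<^sub>M M) (PiM I (\<lambda>_. borel))"
    unfolding split_beta' by (rule measurable_restrict) measurable
  have Wm': "(\<lambda>\<omega>. \<lambda>t\<in>I. W t \<omega>) \<in> measurable M (PiM I (\<lambda>_. borel))"
    by (rule measurable_restrict) measurable
  have "distr (std_normal_distribution \<Otimes>\<^sub>M M) (PiM I (\<lambda>_. borel)) ?\<Phi> = distr M (PiM I (\<lambda>_. borel)) (\<lambda>\<omega>. \<lambda>t\<in>I. W t \<omega>)"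
  proof (rule cramer_wold_PiM)
    show "prob_space (distr (std_normal_distribution \<Otimes>\<^sub>M M) (PiM I (\<lambda>_. borel)) ?\<Phi>)"
      using \<Phi>m by (rule NM.prob_space_distr)
    show "prob_space (distr M (PiM I (\<lambda>_. borel)) (\<lambda>\<omega>. \<lambda>t\<in>I. W t \<omega>))" using Wm' by (rule prob_space_distr)
    fix K and a :: "real \<Rightarrow> real" assume K: "finite K" "K \<subseteq> I"
    define Z where "Z \<omega> = (\<Sum>t\<in>K. a t * W t \<omega>)" for \<omega>
    define k where "k = (\<Sum>t\<in>K. a t * h t)"
    have ZV: "(Z, k) \<in> V" unfolding Z_def k_def by (rule VI[OF K])
    have Zm [measurable]: "Z \<in> borel_measurable M" using gaussV(1)[OF ZV] .
    \<comment> \<open>S = Z - k * \<xi> is the part of Z uncorrelated with \<zeta>. Removing k *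
      \<xi> lowers the variance by k^2 / v, and the independent term \<rho> * k * x restores exactly
      this amount.\<close>
    define S where "S \<omega> = (- k / v) * \<zeta> \<omega> + Z \<omega>" for \<omega>
    have Sm [measurable]: "S \<in> borel_measurable M" unfolding S_def by measurable
    have Ec: "expectation (\<lambda>\<omega>. cos (S \<omega>)) = exp (k\<^sup>2 / v / 2) * expectation (\<lambda>\<omega>. cos (Z \<omega>))"
      and Es: "expectation (\<lambda>\<omega>. sin (S \<omega>)) = 0"
      using cf[OF ZV, of "- k / v"] gaussV(3)[OF ZV] v
      by (simp_all add: S_def exp_add[symmetric] power2_eq_square field_simps)
    have int: "integrable M (\<lambda>\<omega>. cos (S \<omega>))" "integrable M (\<lambda>\<omega>. sin (S \<omega>))"
      by (auto intro!: integrable_bounded[of _ 1])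
    have meas_sum: "(\<lambda>x. \<Sum>t\<in>K. a t * x t) \<in> borel_measurable (PiM I (\<lambda>_. borel))"
      using K by (intro borel_measurable_sum borel_measurable_times borel_measurable_const measurable_component_singleton) auto
    have sum: "(\<Sum>t\<in>K. a t * ?\<Phi> p t) = \<rho> * k * fst p + S (snd p)" for p
    proof -
      have "(\<Sum>t\<in>K. a t * ?\<Phi> p t) = (\<Sum>t\<in>K. a t * W t (snd p) + (\<rho> * fst p - \<xi> (snd p)) * (a t * h t))"
        using K by (intro sum.cong) (auto simp: case_prod_beta algebra_simps)
      also have "\<dots> = Z (snd p) + (\<rho> * fst p - \<xi> (snd p)) * k"
        by (simp add: sum.distrib sum_distrib_left Z_def k_def)
      finally show ?thesis by (simp add: S_def \<xi>_def algebra_simps)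
    qed
    have sum': "(\<Sum>t\<in>K. a t * (if t \<in> I then W t \<omega> else undefined)) = Z \<omega>" for \<omega>
      using K unfolding Z_def by (intro sum.cong) auto
    have \<rho>k: "exp (- ((\<rho> * k)\<^sup>2) / 2) = exp (- (k\<^sup>2 / v / 2))"
      using v by (simp add: \<rho>_def power_mult_distrib power_divide)
    have "(LINT x|(distr (std_normal_distribution \<Otimes>\<^sub>M M) (PiM I (\<lambda>_. borel)) ?\<Phi>). cos (\<Sum>t\<in>K. a t * x t))
        = (LINT p|(std_normal_distribution \<Otimes>\<^sub>M M). cos (\<rho> * k * fst p + S (snd p)))"
      using \<Phi>m meas_sum by (subst integral_distr) (auto simp: sum)
    also have "\<dots> = (LINT x|std_normal_distribution. expectation (\<lambda>\<omega>. cos (\<rho> * k * x + S \<omega>)))"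
      by (subst NM.integral_fst'[symmetric]) (auto intro!: NM.integrable_bounded[of _ 1])
    also have "\<dots> = (LINT x|std_normal_distribution. cos (\<rho> * k * x) * expectation (\<lambda>\<omega>. cos (S \<omega>)))"
      using int Es by (simp add: cos_add)
    also have "\<dots> = (LINT x|std_normal_distribution. cos (\<rho> * k * x)) * expectation (\<lambda>\<omega>. cos (S \<omega>))"
      by simp
    also have "\<dots> = exp (- (k\<^sup>2 / v / 2)) * (exp (k\<^sup>2 / v / 2) * expectation (\<lambda>\<omega>. cos (Z \<omega>)))"
      unfolding std_normal_cos_sin \<rho>k Ec ..
    also have "\<dots> = expectation (\<lambda>\<omega>. cos (Z \<omega>))" by (simp add: exp_minus)
    also have "\<dots> = (LINT x|(distr M (PiM I (\<lambda>_. borel)) (\<lambda>\<omega>. \<lambda>t\<in>I. W t \<omega>)). cos (\<Sum>t\<in>K. a t * x t))"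
      using Wm' meas_sum by (subst integral_distr) (auto simp: sum')
    finally show "(LINT x|(distr (std_normal_distribution \<Otimes>\<^sub>M M) (PiM I (\<lambda>_. borel)) ?\<Phi>). cos (\<Sum>t\<in>K. a t * x t))
        = (LINT x|(distr M (PiM I (\<lambda>_. borel)) (\<lambda>\<omega>. \<lambda>t\<in>I. W t \<omega>)). cos (\<Sum>t\<in>K. a t * x t))" .
    have "(LINT x|(distr (std_normal_distribution \<Otimes>\<^sub>M M) (PiM I (\<lambda>_. borel)) ?\<Phi>). sin (\<Sum>t\<in>K. a t * x t))
        = (LINT p|(std_normal_distribution \<Otimes>\<^sub>M M). sin (\<rho> * k * fst p + S (snd p)))"
      using \<Phi>m meas_sum by (subst integral_distr) (auto simp: sum)
    also have "\<dots> = (LINT x|std_normal_distribution. expectation (\<lambda>\<omega>. sin (\<rho> * k * x + S \<omega>)))"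
      by (subst NM.integral_fst'[symmetric]) (auto intro!: NM.integrable_bounded[of _ 1])
    also have "\<dots> = (LINT x|std_normal_distribution. sin (\<rho> * k * x) * expectation (\<lambda>\<omega>. cos (S \<omega>)))"
      using int Es by (simp add: sin_add)
    also have "\<dots> = expectation (\<lambda>\<omega>. sin (Z \<omega>))"
      using std_normal_cos_sin(2)[of "\<rho> * k"] gaussV(4)[OF ZV] by simp
    also have "\<dots> = (LINT x|(distr M (PiM I (\<lambda>_. borel)) (\<lambda>\<omega>. \<lambda>t\<in>I. W t \<omega>)). sin (\<Sum>t\<in>K. a t * x t))"
      using Wm' meas_sum by (subst integral_distr) (auto simp: sum')
    finally show "(LINT x|(distr (std_normal_distribution \<Otimes>\<^sub>M M) (PiM I (\<lambda>_. borel)) ?\<Phi>). sin (\<Sum>t\<in>K. a t * x t))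
        = (LINT x|(distr M (PiM I (\<lambda>_. borel)) (\<lambda>\<omega>. \<lambda>t\<in>I. W t \<omega>)). sin (\<Sum>t\<in>K. a t * x t))" .
  qed simp_all
  with \<xi>m v that[of \<xi> \<rho>] show thesis by (simp add: \<rho>_def)
qed

section \<open>Absolute continuity\<close>

text \<open>On the image of E the inverse of \<phi> is Lipschitz with constant 1 / c, and Lipschitz
  maps preserve negligible sets. E may be an arbitrary set, and nothing is asked of \<phi> off
  E.\<close>

lemma negligible_of_expanding:
  fixes \<phi> :: "real \<Rightarrow> real"
  assumes c: "c > 0" and exp: "\<And>x y. x \<in> E \<Longrightarrow> y \<in> E \<Longrightarrow> x < y \<Longrightarrow> c * (y - x) \<le> \<phi> y - \<phi> x"
    and A: "\<phi> ` E \<subseteq> A" "negligible A"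
  shows "negligible E"
proof -
  have exp': "c * \<bar>y - x\<bar> \<le> \<bar>\<phi> y - \<phi> x\<bar>" if "x \<in> E" "y \<in> E" for x y
    using exp[of x y] exp[of y x] that by (cases x y rule: linorder_cases) (auto simp: abs_if)
  have inj: "inj_on \<phi> E"
  proof (rule inj_onI)
    fix x y assume "x \<in> E" "y \<in> E" "\<phi> x = \<phi> y"
    then show "x = y" using exp'[of x y] c by (simp add: mult_le_0_iff)
  qed
  define \<psi> where "\<psi> = inv_into E \<phi>"
  have \<psi>: "\<psi> (\<phi> x) = x" if "x \<in> E" for x using that inj by (simp add: \<psi>_def)
  have "negligible (\<phi> ` E)" using A negligible_subset by blast
  moreover have "\<exists>T B. open T \<and> u \<in> T \<and> (\<forall>w\<in>\<phi> ` E \<inter> T. norm (\<psi> w - \<psi> u) \<le> B * norm (w - u))" if u: "u \<in> \<phi> ` E" for u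
  proof (intro exI[of _ UNIV] exI[of _ "1 / c"] conjI ballI)
    fix w assume "w \<in> \<phi> ` E \<inter> UNIV"
    then obtain x y where "x \<in> E" "y \<in> E" "u = \<phi> x" "w = \<phi> y" using u by auto
    then show "norm (\<psi> w - \<psi> u) \<le> 1 / c * norm (w - u)" using exp'[of x y] c \<psi> by (simp add: field_simps)
  qed auto
  ultimately have "negligible (\<psi> ` (\<phi> ` E))"
    by (rule negligible_locally_Lipschitz_image[where S = "\<phi> ` E" and f = \<psi>, OF order_refl])
  moreover have "\<psi> ` \<phi> ` E = E" using \<psi> by (force simp: image_iff)
  ultimately show ?thesis by simp
qed

text \<open>It recovers a lower bound on a whole interval from the countably many conditions that a
  measurable event can impose.\<close>

lemma continuous_ge_of_rational:
  fixes f :: "real \<Rightarrow> real"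
  assumes f: "continuous_on {a..c} f" "a < c" and q: "\<And>q. q \<in> \<rat> \<Longrightarrow> q \<in> {a..c} \<Longrightarrow> f q \<ge> \<epsilon>" and t: "t \<in> {a..c}"
  shows "f t \<ge> \<epsilon>"
proof (rule ccontr)
  assume "\<not> f t \<ge> \<epsilon>"
  then have "\<epsilon> - f t > 0" by simp
  then obtain d where d: "d > 0" "\<And>s. s \<in> {a..c} \<Longrightarrow> dist s t < d \<Longrightarrow> dist (f s) (f t) < \<epsilon> - f t"
    using f(1) t unfolding continuous_on_iff by meson
  have "max a (t - d) < min c (t + d)" using t f(2) d(1) by auto
  then obtain q' where q': "q' \<in> \<rat>" "max a (t - d) < q'" "q' < min c (t + d)"
    using Rats_dense_in_real by blast
  then have "q' \<in> {a..c}" "dist q' t < d" by (auto simp: dist_real_def)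
  then show False using d(2)[of q'] q[OF q'(1)] by (auto simp: dist_real_def)
qed

section \<open>The canonical path space and the conclusion\<close>

lemma space_C0: "space (C0_space T) = {w \<in> extensional {0..T}. continuous_on {0..T} w \<and> w 0 = 0}"
  by (auto simp: C0_space_def space_restrict_space space_PiM PiE_def)

text \<open>\<open>space (C0_space T)\<close> is not measurable in the product space, but every event of \<open>P\<close> is the trace
  of an event of the product space.\<close>

lemma C0_distr_eqI:
  assumes P: "sets P = sets (C0_space T)" and Q: "prob_space Q"
    and f: "f \<in> measurable Q (PiM {0..T} (\<lambda>_. borel))" "\<And>x. x \<in> space Q \<Longrightarrow> f x \<in> space (C0_space T)"
    and eq: "distr Q (PiM {0..T} (\<lambda>_. borel)) f = distr P (PiM {0..T} (\<lambda>_. borel)) (\<lambda>w. \<lambda>t\<in>{0..T}. w t)"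
  shows "f \<in> measurable Q P" "distr Q P f = P"
proof -
  let ?\<Omega> = "{w. continuous_on {0..T} w \<and> w 0 = 0}" and ?S = "PiM {0..T} (\<lambda>_. borel :: real measure)"
  have spP: "space P = space (C0_space T)" using P by (rule sets_eq_imp_space_eq)
  have fC: "f \<in> measurable Q (C0_space T)"
    unfolding C0_space_def using f by (intro measurable_restrict_space2) (auto simp: space_C0)
  then show fP: "f \<in> measurable Q P" using P by (simp cong: measurable_cong_sets)
  show "distr Q P f = P"
  proof (rule measure_eqI)
    fix A assume "A \<in> sets (distr Q P f)"
    then have A: "A \<in> sets P" by simp
    then obtain A' where A': "A' \<in> sets ?S" "A = A' \<inter> ?\<Omega>"
      using P by (auto simp: C0_space_def sets_restrict_space)
    have r: "(\<lambda>t\<in>{0..T}. w t) = w" if "w \<in> space P" for w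
      using that spP by (auto simp: space_C0 intro: extensional_restrict)
    have rm: "(\<lambda>w. \<lambda>t\<in>{0..T}. w t) \<in> measurable P ?S"
    proof -
      have "(\<lambda>w. w) \<in> measurable (C0_space T) ?S"
        unfolding C0_space_def by (intro measurable_restrict_space1) simp
      then have "(\<lambda>w. w) \<in> measurable P ?S" using P by (simp cong: measurable_cong_sets)
      then show ?thesis by (rule measurable_cong[THEN iffD1, rotated]) (simp add: r)
    qed
    have "f -` A \<inter> space Q = f -` A' \<inter> space Q" using A'(2) f(2) by (auto simp: space_C0)
    then have "emeasure (distr Q P f) A = emeasure (distr Q ?S f) A'"
      using A A' fP f(1) by (simp add: emeasure_distr)
    also have "\<dots> = emeasure P ((\<lambda>w. \<lambda>t\<in>{0..T}. w t) -` A' \<inter> space P)"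
      unfolding eq using A'(1) rm by (rule emeasure_distr[rotated])
    also have "(\<lambda>w. \<lambda>t\<in>{0..T}. w t) -` A' \<inter> space P = A"
      using A'(2) r sets.sets_into_space[OF A] spP by (auto simp: space_C0)
    finally show "emeasure (distr Q P f) A = emeasure P A" .
  qed simp
qed

theorem theorem1p1:
  fixes r T\<^sub>0 H \<alpha> t\<^sub>0 :: real
    and b \<sigma> \<eta> :: "real \<Rightarrow> real"
    and P :: "(real \<Rightarrow> real) measure"
    and X :: "real \<Rightarrow> (real \<Rightarrow> real) \<Rightarrow> real"
  assumes "r > 0" and "T\<^sub>0 > 0"
    and "H \<in> {1/2<..<1}" and "\<alpha> \<in> {1 - H<..<1/2}"
    and "prob_space P" and "sets P = sets (C0_space T\<^sub>0)"
    and "fractional_brownian_motion P T\<^sub>0 H canonical_process"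
    and "b \<in> Ckb 2" and "\<sigma> \<in> Ckb 2"
    and "\<eta> \<in> {-r..0} \<rightarrow> {0..}" and "holder_continuous_on (1 - \<alpha>) {-r..0} \<eta>"
    and "reflected_delay_solution P b \<sigma> \<eta> r T\<^sub>0 canonical_process X"
    and "\<And>x. x \<ge> 0 \<Longrightarrow> \<sigma> x > 0"
    and "t\<^sub>0 \<in> {0<..T\<^sub>0}"
  shows "absolutely_continuous
           (restrict_space lborel {0<..})
           (restrict_space (distr (completion P) borel (X t\<^sub>0)) {0<..})"
proof -
  interpret prob_space P by fact
  obtain L where L: "L \<ge> 0" "\<And>x y. \<bar>b x - b y\<bar> \<le> L * \<bar>x - y\<bar>"
    using Ckb_lipschitz[OF assms(8)] by auto
  obtain L' where L': "L' \<ge> 0" "\<And>x y. \<bar>\<sigma> x - \<sigma> y\<bar> \<le> L' * \<bar>x - y\<bar>"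
    using Ckb_lipschitz[OF assms(9)] by auto
  interpret reflected_delay_coefficients b \<sigma> \<eta> r T\<^sub>0 L
  proof
    show "continuous_on UNIV \<sigma>" using L' by (intro lipschitz_continuous_on) auto
    show "continuous_on {-r..0} \<eta>"
      using assms(4) by (intro holder_continuous_on_imp_continuous_on[OF assms(11)]) auto
  qed (use assms L in auto)
  have t0: "0 < t\<^sub>0" "t\<^sub>0 \<le> T\<^sub>0" using assms(14) by auto
  have space_P: "space P = space (C0_space T\<^sub>0)" using assms(6) by (rule sets_eq_imp_space_eq)
  have wcont: "continuous_on {0..T\<^sub>0} w" if "w \<in> space P" for w using that by (simp add: space_P space_C0)
  have Xm: "X t \<in> borel_measurable (completion P)" if "t \<in> {-r..T\<^sub>0}" for t
    using assms(12) that by (auto simp: reflected_delay_solution_def)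
  have "AE w in P. solves w (\<lambda>t. X t w)"
    using assms(12) by (auto simp: reflected_delay_solution_def canonical_process_def)
  then obtain N0 where N0: "{w \<in> space P. \<not> solves w (\<lambda>t. X t w)} \<subseteq> N0" "emeasure P N0 = 0" "N0 \<in> sets P"
    by (rule AE_E)
  have fbm: "gaussian_process P {0..T\<^sub>0} canonical_process"
    "\<And>t. t \<in> {0..T\<^sub>0} \<Longrightarrow> expectation (canonical_process t) = 0"
    "\<And>t s. t \<in> {0..T\<^sub>0} \<Longrightarrow> s \<in> {0..T\<^sub>0} \<Longrightarrow>
      expectation (\<lambda>w. canonical_process t w * canonical_process s w) = fbm_covariance H t s"
    using assms(7) by (auto simp: fractional_brownian_motion_def)
  \<comment> \<open>A bound by \<epsilon> > 0 at rational times passes to all times of the interval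
    by continuity; strict positivity at rational times alone would allow zeros in between.\<close>
  have null: "{w \<in> space P. X t\<^sub>0 w \<in> A \<and> (\<forall>q\<in>\<rat> \<inter> {t\<^sub>0 - d..t\<^sub>0}. \<epsilon> \<le> X q w)} \<in> null_sets (completion P)"
    if A: "negligible A" "A \<in> sets borel" and d: "0 < d" "d \<le> t\<^sub>0" "d \<le> r" and \<epsilon>: "\<epsilon> > 0" for A d \<epsilon>
  proof -
    define S where "S = {w \<in> space P. X t\<^sub>0 w \<in> A \<and> (\<forall>q\<in>\<rat> \<inter> {t\<^sub>0 - d..t\<^sub>0}. \<epsilon> \<le> X q w)}"
    have S: "S \<in> sets (completion P)"
    proof -
      have "{w \<in> space (completion P). X t\<^sub>0 w \<in> A} \<in> sets (completion P)"
        using measurable_sets[OF Xm A(2), of t\<^sub>0] t0 assms(1) by (simp add: vimage_def Int_def conj_commute)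
      moreover have "{w \<in> space (completion P). \<forall>q\<in>\<rat> \<inter> {t\<^sub>0 - d..t\<^sub>0}. \<epsilon> \<le> X q w} \<in> sets (completion P)"
      proof (rule sets.sets_Collect_countable_All')
        fix q assume "q \<in> \<rat> \<inter> {t\<^sub>0 - d..t\<^sub>0}"
        then have "X q \<in> borel_measurable (completion P)" using d t0 assms(1) by (intro Xm) auto
        then show "{w \<in> space (completion P). \<epsilon> \<le> X q w} \<in> sets (completion P)" by measurable
      qed (intro countable_Int1 countable_rat)
      ultimately have "{w \<in> space (completion P). X t\<^sub>0 w \<in> A} \<inter> {w \<in> space (completion P). \<forall>q\<in>\<rat> \<inter> {t\<^sub>0 - d..t\<^sub>0}. \<epsilon> \<le> X q w} \<in> sets (completion P)"
        by (rule sets.Int)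
      moreover have "S = {w \<in> space (completion P). X t\<^sub>0 w \<in> A} \<inter> {w \<in> space (completion P). \<forall>q\<in>\<rat> \<inter> {t\<^sub>0 - d..t\<^sub>0}. \<epsilon> \<le> X q w}"
        by (auto simp: S_def)
      ultimately show ?thesis by simp
    qed
    \<comment> \<open>S is measurable only for the completion, whereas the image law under \<Phi>
      and Fubini concern P itself. The set D lies in \<open>sets P\<close>, differs from S by a null
      set, and on it the equation holds for every path.\<close>
    define D where "D = main_part P S - N0"
    have D: "D \<in> sets P" unfolding D_def using S N0(3) by auto
    have DS: "D \<subseteq> S" using main_part_null_part_Un[OF S] by (auto simp: D_def)
    have Dsol: "solves w (\<lambda>t. X t w)" "continuous_on {0..T\<^sub>0} w" if "w \<in> D" for w
      using that DS N0(1) wcont by (auto simp: D_def S_def)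
    have Dpos: "X t w > 0" if w: "w \<in> D" and t: "t \<in> {t\<^sub>0 - d..t\<^sub>0}" for w t
    proof -
      have "continuous_on {t\<^sub>0 - d..t\<^sub>0} (\<lambda>t. X t w)"
        using solves_continuous[OF Dsol[OF w]] by (rule continuous_on_subset) (use d t0 assms(1) in auto)
      then have "\<epsilon> \<le> X t w"
        by (rule continuous_ge_of_rational[OF _ _ _ t]) (use w DS d in \<open>auto simp: S_def\<close>)
      then show ?thesis using \<epsilon> by simp
    qed
    let ?h = "tent t\<^sub>0 d"
    \<comment> \<open>The weight 1/4 is the one that leaves the minimisation behind
      \<open>gaussian_process_split\<close> coercive.\<close>
    obtain C where C: "\<And>J a. finite J \<Longrightarrow> J \<subseteq> {0..} \<Longrightarrow> (\<Sum>t\<in>J. a t * ?h t) \<le>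
        (1/4) * (\<Sum>t\<in>J. \<Sum>s\<in>J. a t * a s * fbm_covariance H t s) + C"
      using fbm_tent_bound[of H d t\<^sub>0 "1/4"] assms(3) d by auto
    obtain \<xi> \<rho> where \<xi>: "\<xi> \<in> borel_measurable P" and \<rho>: "\<rho> > 0" and
      law: "distr (std_normal_distribution \<Otimes>\<^sub>M P) (PiM {0..T\<^sub>0} (\<lambda>_. borel))
          (\<lambda>(x, w). \<lambda>t\<in>{0..T\<^sub>0}. canonical_process t w + (\<rho> * x - \<xi> w) * ?h t)
        = distr P (PiM {0..T\<^sub>0} (\<lambda>_. borel)) (\<lambda>w. \<lambda>t\<in>{0..T\<^sub>0}. canonical_process t w)"
    proof (rule gaussian_process_split[OF fbm, of ?h C t\<^sub>0])
      fix J and a :: "real \<Rightarrow> real" assume "finite J" "J \<subseteq> {0..T\<^sub>0}"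
      moreover from this have "J \<subseteq> {0..}" by auto
      ultimately show "(\<Sum>t\<in>J. a t * ?h t) \<le> (\<Sum>t\<in>J. \<Sum>s\<in>J. a t * a s * fbm_covariance H t s) / 4 + C"
        using C[of J a] by simp
    qed (use t0 in \<open>auto simp: tent_def\<close>)
    define \<Phi> where "\<Phi> = (\<lambda>(x, w). \<lambda>t\<in>{0..T\<^sub>0}. w t + (\<rho> * x - \<xi> w) * ?h t)"
    interpret N: prob_space std_normal_distribution by (rule prob_space_normal_density) simp
    interpret NP: pair_prob_space std_normal_distribution P ..
    have coord: "(\<lambda>w. w t) \<in> borel_measurable P" if "t \<in> {0..T\<^sub>0}" for t
    proof -
      have "canonical_process t \<in> borel_measurable P" using fbm(1) that by (simp add: gaussian_process_def)
      moreover have "canonical_process t = (\<lambda>w. w t)" by (simp add: fun_eq_iff canonical_process_def)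
      ultimately show ?thesis by simp
    qed
    have h_cont: "continuous_on UNIV ?h" unfolding tent_def using d by (intro continuous_intros) auto
    have h0: "?h t = 0" if "t \<le> t\<^sub>0 - d" for t using that d by (simp add: tent_def field_simps)
    have hlin: "?h t = (t - (t\<^sub>0 - d)) / d" if "t \<in> {t\<^sub>0 - d..t\<^sub>0}" for t
      using that d by (auto simp: tent_def field_simps max_def)
    have "\<Phi> \<in> measurable (std_normal_distribution \<Otimes>\<^sub>M P) (PiM {0..T\<^sub>0} (\<lambda>_. borel))"
      unfolding \<Phi>_def split_beta'
    proof (rule measurable_restrict)
      fix t assume t: "t \<in> {0..T\<^sub>0}"
      note [measurable] = coord[OF t] \<xi>
      show "(\<lambda>p. snd p t + (\<rho> * fst p - \<xi> (snd p)) * ?h t) \<in> borel_measurable (std_normal_distribution \<Otimes>\<^sub>M P)"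
        using measurable_compose[OF measurable_snd coord[OF t]] by measurable
    qed
    moreover have "\<Phi> p \<in> space (C0_space T\<^sub>0)" if pp: "p \<in> space (std_normal_distribution \<Otimes>\<^sub>M P)" for p
    proof -
      obtain x w where p: "p = (x, w)" "w \<in> space P" using pp by (auto simp: space_pair_measure)
      have "continuous_on {0..T\<^sub>0} (\<lambda>t. w t + (\<rho> * x - \<xi> w) * ?h t)"
        using wcont[OF p(2)] h_cont by (intro continuous_intros) (auto intro: continuous_on_subset)
      then have "continuous_on {0..T\<^sub>0} (\<Phi> p)"
        by (rule continuous_on_eq) (simp add: \<Phi>_def p)
      moreover have "w 0 = 0" using p(2) by (simp add: space_P space_C0)
      ultimately show ?thesis using t0 d h0[of 0] by (simp add: \<Phi>_def p space_C0)
    qed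
    ultimately have \<Phi>: "\<Phi> \<in> measurable (std_normal_distribution \<Otimes>\<^sub>M P) P" "distr (std_normal_distribution \<Otimes>\<^sub>M P) P \<Phi> = P"
      using law by (auto intro!: C0_distr_eqI[OF assms(6) NP.prob_space_axioms] simp: \<Phi>_def canonical_process_def)
    have slice: "emeasure std_normal_distribution {x. \<Phi> (x, w) \<in> D} = 0" if w: "w \<in> space P" for w
    proof -
      define E where "E = {x. \<Phi> (x, w) \<in> D}"
      have \<Phi>w: "(\<lambda>x. \<Phi> (x, w)) \<in> measurable std_normal_distribution P"
        using measurable_compose[OF measurable_Pair2' \<Phi>(1)] w by simp
      have E: "E \<in> sets borel" using measurable_sets[OF \<Phi>w D] by (simp add: E_def vimage_def)
      have "negligible E"
      proof (cases "E = {}")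
        case False
        then obtain x0 where x0: "x0 \<in> E" by auto
        define \<omega> where "\<omega> x = \<Phi> (x, w)" for x
        have \<omega>D: "\<omega> x \<in> D" if "x \<in> E" for x using that by (simp add: E_def \<omega>_def)
        have \<omega>: "\<omega> x t = w t + (\<rho> * x - \<xi> w) * ?h t" if "t \<in> {0..T\<^sub>0}" for x t
          using that by (simp add: \<omega>_def \<Phi>_def)
        have same: "\<omega> x t = \<omega> y t" if "t \<in> {0..t\<^sub>0 - d}" for x y t
          using that t0 d h0[of t] by (simp add: \<omega>)
        \<comment> \<open>The lower bound is read off the path of one reference point x0. It serves
          every x in E, because t - r \<le> t0 - d falls into the past that all these paths
          share.\<close>
        define g where "g t = \<sigma> (X (t - r) (\<omega> x0))" for t
        have "continuous_on {t\<^sub>0 - d..t\<^sub>0} g"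
          unfolding g_def using d t0 by (intro delayed_diffusion_continuous[OF Dsol[OF \<omega>D[OF x0]]]) auto
        then obtain s where s: "s \<in> {t\<^sub>0 - d..t\<^sub>0}" "\<And>t. t \<in> {t\<^sub>0 - d..t\<^sub>0} \<Longrightarrow> g s \<le> g t"
          using continuous_attains_inf[of "{t\<^sub>0 - d..t\<^sub>0}" g] d by auto
        have gs: "g s > 0" unfolding g_def
        proof (rule assms(13), rule solves_nonneg[OF Dsol[OF \<omega>D[OF x0]]])
          show "s - r \<in> {- r..T\<^sub>0}" using s(1) d t0 assms(1) by auto
        qed
        have lower: "g s \<le> \<sigma> (X (t - r) (\<omega> x))" if "x \<in> E" "t \<in> {t\<^sub>0 - d..t\<^sub>0}" for x t
        proof -
          have "X (t - r) (\<omega> x) = X (t - r) (\<omega> x0)"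
            using that d t0 same
            by (intro solves_unique[OF Dsol[OF \<omega>D[OF that(1)]] Dsol[OF \<omega>D[OF x0]], where a = "t\<^sub>0 - d"]) auto
          then show ?thesis using s(2)[OF that(2)] by (simp add: g_def)
        qed
        \<comment> \<open>The paths for x < y differ on the last interval by an affine function of
          slope \<kappa> = \<rho> * (y - x) / d; over the length d this amounts to \<rho> * (y - x),
          and the drift can shrink the effect at most by the factor exp (- L * d).\<close>
        show ?thesis
        proof (rule negligible_of_expanding[where \<phi> = "\<lambda>x. X t\<^sub>0 (\<omega> x)" and c = "\<rho> * g s / exp (L * d)"])
          fix x y assume xy: "x \<in> E" "y \<in> E" "x < y"
          have "\<rho> * (y - x) / d * g s * (t\<^sub>0 - (t\<^sub>0 - d)) \<le> exp (L * (t\<^sub>0 - (t\<^sub>0 - d))) * (X t\<^sub>0 (\<omega> y) - X t\<^sub>0 (\<omega> x))"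
          proof (rule solves_expansion[OF Dsol[OF \<omega>D[OF xy(1)]] Dsol[OF \<omega>D[OF xy(2)]]])
            fix t assume t: "t \<in> {t\<^sub>0 - d..t\<^sub>0}"
            then have "t \<in> {0..T\<^sub>0}" using d t0 by auto
            moreover have "(\<rho> * y - q) * (s / d) = (\<rho> * x - q) * (s / d) + \<rho> * (y - x) / d * s" for q s
              by (simp add: left_diff_distrib right_diff_distrib diff_divide_distrib)
            ultimately show "\<omega> y t = \<omega> x t + \<rho> * (y - x) / d * (t - (t\<^sub>0 - d))"
              by (simp only: \<omega> hlin[OF t] add.assoc)
          qed (use d t0 same \<rho> gs xy Dpos[OF \<omega>D] lower in auto)
          moreover have "\<rho> * (y - x) / d * g s * (t\<^sub>0 - (t\<^sub>0 - d)) = \<rho> * g s * (y - x)"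
            "t\<^sub>0 - (t\<^sub>0 - d) = d" using d by auto
          ultimately have "\<rho> * g s * (y - x) \<le> exp (L * d) * (X t\<^sub>0 (\<omega> y) - X t\<^sub>0 (\<omega> x))"
            by (simp only:)
          then show "\<rho> * g s / exp (L * d) * (y - x) \<le> X t\<^sub>0 (\<omega> y) - X t\<^sub>0 (\<omega> x)"
            by (simp add: field_simps)
        next
          show "(\<lambda>x. X t\<^sub>0 (\<omega> x)) ` E \<subseteq> A" using \<omega>D DS by (auto simp: S_def)
        qed (use A \<rho> gs in auto)
      qed simp
      then have "E \<in> null_sets lborel" using E by (simp add: negligible_iff_null_sets null_sets_completion_iff)
      then have "E \<in> null_sets std_normal_distribution"
        using absolutely_continuousI_density[of "\<lambda>x. ennreal (std_normal_density x)" lborel]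
        by (auto simp: absolutely_continuous_def)
      then show ?thesis by (simp add: E_def null_setsD1)
    qed
    have "emeasure P D = emeasure (distr (std_normal_distribution \<Otimes>\<^sub>M P) P \<Phi>) D" by (simp add: \<Phi>(2))
    also have "\<dots> = emeasure (std_normal_distribution \<Otimes>\<^sub>M P) (\<Phi> -` D \<inter> space (std_normal_distribution \<Otimes>\<^sub>M P))"
      using \<Phi>(1) D by (rule emeasure_distr)
    also have "\<dots> = (\<integral>\<^sup>+ w. emeasure std_normal_distribution ((\<lambda>x. (x, w)) -` (\<Phi> -` D \<inter> space (std_normal_distribution \<Otimes>\<^sub>M P))) \<partial>P)"
      using measurable_sets[OF \<Phi>(1) D] by (rule NP.emeasure_pair_measure_alt2)
    also have "\<dots> = (\<integral>\<^sup>+ w. 0 \<partial>P)"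
    proof (rule nn_integral_cong)
      fix w assume w: "w \<in> space P"
      have "(\<lambda>x. (x, w)) -` (\<Phi> -` D \<inter> space (std_normal_distribution \<Otimes>\<^sub>M P)) = {x. \<Phi> (x, w) \<in> D}"
        using w by (auto simp: space_pair_measure)
      then show "emeasure std_normal_distribution ((\<lambda>x. (x, w)) -` (\<Phi> -` D \<inter> space (std_normal_distribution \<Otimes>\<^sub>M P))) = 0"
        using slice[OF w] by simp
    qed
    finally have "emeasure P D = 0" by simp
    moreover have "emeasure P (main_part P S) \<le> emeasure P (D \<union> N0)"
      using sets.Un[OF D N0(3)] by (intro emeasure_mono) (auto simp: D_def)
    moreover have "emeasure P (D \<union> N0) \<le> emeasure P D + emeasure P N0"
      using D N0(3) by (rule emeasure_subadditive)
    ultimately have "emeasure P (main_part P S) = 0" using N0(2) by simp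
    then have "S \<in> null_sets (completion P)" using S by (intro null_setsI) simp_all
    then show ?thesis by (simp add: S_def)
  qed
  show ?thesis
    unfolding absolutely_continuous_def
  proof
    fix A :: "real set" assume "A \<in> null_sets (restrict_space lborel {0<..})"
    then have A: "A \<subseteq> {0<..}" "A \<in> null_sets lborel"
      using null_sets_restrict_space[of "{0<..}" lborel A] by auto
    then have Ab: "A \<in> sets borel" and An: "negligible A"
      by (auto simp: negligible_iff_null_sets null_sets_completionI)
    have Xt0: "X t\<^sub>0 \<in> borel_measurable (completion P)" using t0 assms(1) by (intro Xm) auto
    \<comment> \<open>One index drives both the interval length min r t0 / (n + 1), which is at most
      r and t0, and the lower bound 1 / (n + 1).\<close>
    define S where "S n = {w \<in> space P. X t\<^sub>0 w \<in> A \<and>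
      (\<forall>q\<in>\<rat> \<inter> {t\<^sub>0 - min r t\<^sub>0 / real (Suc n)..t\<^sub>0}. 1 / real (Suc n) \<le> X q w)}" for n
    have Sn: "S n \<in> null_sets (completion P)" for n
    proof -
      have le: "min r t\<^sub>0 / real (Suc n) \<le> min r t\<^sub>0 / 1"
        using assms(1) t0 by (intro divide_left_mono) auto
      have "0 < min r t\<^sub>0 / real (Suc n)" using assms(1) t0 by simp
      then show ?thesis
        unfolding S_def using le by (intro null[OF An Ab]) auto
    qed
    have "X t\<^sub>0 -` A \<inter> space P \<subseteq> N0 \<union> (\<Union>n. S n)"
    proof
      fix w assume w: "w \<in> X t\<^sub>0 -` A \<inter> space P"
      show "w \<in> N0 \<union> (\<Union>n. S n)"
      proof (cases "w \<in> N0")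
        case False
        then have sol: "solves w (\<lambda>t. X t w)" using N0(1) w by auto
        have pos: "X t\<^sub>0 w > 0" using w A(1) by auto
        have "continuous_on {- r..T\<^sub>0} (\<lambda>t. X t w)" using sol wcont w by (intro solves_continuous) auto
        moreover have "t\<^sub>0 \<in> {- r..T\<^sub>0}" using t0 assms(1) by auto
        ultimately obtain e where e: "e > 0" "\<And>t. t \<in> {- r..T\<^sub>0} \<Longrightarrow> dist t t\<^sub>0 < e \<Longrightarrow> dist (X t w) (X t\<^sub>0 w) < X t\<^sub>0 w / 2"
          unfolding continuous_on_iff using pos by (metis half_gt_zero)
        obtain n where n: "1 / real (Suc n) < min (e / (min r t\<^sub>0 + 1)) (X t\<^sub>0 w / 2)"
          using nat_approx_posE[of "min (e / (min r t\<^sub>0 + 1)) (X t\<^sub>0 w / 2)"] e(1) pos assms(1) t0 by auto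
        have rt: "min r t\<^sub>0 > 0" using assms(1) t0 by auto
        have small: "min r t\<^sub>0 / real (Suc n) < e"
        proof -
          have "min r t\<^sub>0 / real (Suc n) \<le> (min r t\<^sub>0 + 1) * (1 / real (Suc n))" by (simp add: field_simps)
          also have "\<dots> < (min r t\<^sub>0 + 1) * (e / (min r t\<^sub>0 + 1))" using n rt by (intro mult_strict_left_mono) auto
          also have "\<dots> = e" using add_pos_pos[OF rt zero_less_one] by simp
          finally show ?thesis .
        qed
        have "min r t\<^sub>0 / real (Suc n) \<le> min r t\<^sub>0 / 1" using rt by (intro divide_left_mono) auto
        then have le: "min r t\<^sub>0 / real (Suc n) \<le> t\<^sub>0" by simp
        have "1 / real (Suc n) \<le> X q w" if "q \<in> {t\<^sub>0 - min r t\<^sub>0 / real (Suc n)..t\<^sub>0}" for q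
        proof -
          have "dist (X q w) (X t\<^sub>0 w) < X t\<^sub>0 w / 2"
            using that small le t0 assms(1) by (intro e(2)) (auto simp: dist_real_def)
          then have "X t\<^sub>0 w / 2 < X q w" by (simp add: dist_real_def abs_if split: if_splits)
          then show ?thesis using n by linarith
        qed
        then have "w \<in> S n" using w unfolding S_def by blast
        then show ?thesis by blast
      qed simp
    qed
    moreover have "N0 \<union> (\<Union>n. S n) \<in> null_sets (completion P)"
      using Sn N0 null_sets_completionI[of N0 P] by (intro null_sets.Un null_sets_UN) auto
    ultimately have "X t\<^sub>0 -` A \<inter> space P \<in> null_sets (completion P)"
      by (rule null_sets_completion_subset)
    then have "A \<in> null_sets (distr (completion P) borel (X t\<^sub>0))"
      using Xt0 Ab by (simp add: null_sets_distr_iff)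
    then show "A \<in> null_sets (restrict_space (distr (completion P) borel (X t\<^sub>0)) {0<..})"
      using A(1) by (simp add: null_sets_restrict_space)
  qed
qed

end
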